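(* Let $k$ be a field, $H$ a Hopf algebra over $k$, $A$ a right $H$-comodule algebra over $k$ with structure map $\delta_A:A\to A\otimes H$ and $B=A^{co\,H}$, and assume that $A/B$ is $H$-Galois. Let $Q\in\mathrm{Quot}_{gen}(H)$ with projection $\pi:H\to Q$. Then the following two conditions are equivalent: (i) the canonical map $\mathrm{can}_Q:A\otimes_{A^{co\,Q}}A\to A\otimes Q$, $a\otimes b\mapsto ab_{(0)}\otimes\pi(b_{(1)})$, is a bijection; (ii) (a) $Q$ is closed in the Galois connection $(\phi,\psi)$ between $\mathrm{Sub}_{Alg}(A/B)$ and $\mathrm{Quot}_{gen}(H)$, and (b) the map $$\delta_A\otimes\delta_A:A\otimes_{A^{co\,Q}}A\to(A\otimes H)\otimes_{A\otimes H^{co\,Q}}(A\otimes H)$$ is injective.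
   Context: A right $H$-comodule algebra is an algebra $A$ with a counital coassociative coaction $\delta_A:A\to A\otimes H$, $a\mapsto a_{(0)}\otimes a_{(1)}$, that is an algebra homomorphism; $A^{co\,H}=\{a:\delta_A(a)=a\otimes1_H\}$. $A/B$ is $H$-Galois if $A\otimes_BA\to A\otimes H$, $a\otimes b\mapsto ab_{(0)}\otimes b_{(1)}$, is bijective. $\mathrm{Sub}_{Alg}(A/B)$ is the poset (under inclusion) of subalgebras $S$ with $B\subseteq S\subseteq A$. $\mathrm{Quot}_{gen}(H)$ is the complete lattice of quotients $H/I$ by right ideal coideals $I$, ordered by $H/I\succcurlyeq H/J\Leftrightarrow I\subseteq J$. For $Q$ in it with projection $\pi$, $A^{co\,Q}=\{a\in A:a_{(0)}\otimes\pi(a_{(1)})=a\otimes\pi(1_H)\}$ and $H^{co\,Q}=\{h\in H:h_{(1)}\otimes\pi(h_{(2)})=h\otimes\pi(1_H)\}$. The Galois connection is $\phi(Q)=A^{co\,Q}$, $\psi(S)=\bigvee\{Q:S\subseteq A^{co\,Q}\}$, and $Q$ is closed if $\psi\phi(Q)=Q$. The map in (b) is well defined since $\delta_A$ is an algebra map with $\delta_A(A^{co\,Q})\subseteq A\otimes H^{co\,Q}$.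
   Formalization: The algebra A is assumed nonzero; for A = 0 the H-Galois condition and (i) hold trivially for every Q, but only Q = H is closed, so the equivalence fails (e.g. H = k[Z/2], Q = k). *)

theory Defs
  imports "HOL-Algebra.Algebra"
begin

section \<open>Balanced tensor products\<close>

text \<open>
  The tensor product of a right \<open>R\<close>-module \<open>M\<close> and a left \<open>R\<close>-module \<open>N\<close> is the free abelian group
  on \<open>M \<times> N\<close> modulo biadditivity and \<open>(m r, n) = (m, r n)\<close>. Only the set \<open>R\<close> of scalars and the two
  actions \<open>\<rho>\<close> and \<open>l\<close> enter. As the library's quotient groups are, the result is written
  multiplicatively: the product of two cosets is the sum of the two tensors.
\<close>

definition balanced_relators ::
  "'r set \<Rightarrow> ('m \<Rightarrow> 'r \<Rightarrow> 'm) \<Rightarrow> ('r \<Rightarrow> 'n \<Rightarrow> 'n) \<Rightarrow> ('m, 'x) ring_scheme \<Rightarrow> ('n, 'y) ring_scheme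
    \<Rightarrow> ('m \<times> 'n \<Rightarrow>\<^sub>0 int) set" where
  "balanced_relators R \<rho> l M N =
     {frag_of (m \<oplus>\<^bsub>M\<^esub> m', n) - frag_of (m, n) - frag_of (m', n) | m m' n.
        m \<in> carrier M \<and> m' \<in> carrier M \<and> n \<in> carrier N} \<union>
     {frag_of (m, n \<oplus>\<^bsub>N\<^esub> n') - frag_of (m, n) - frag_of (m, n') | m n n'.
        m \<in> carrier M \<and> n \<in> carrier N \<and> n' \<in> carrier N} \<union>
     {frag_of (\<rho> m r, n) - frag_of (m, l r n) | m r n.
        m \<in> carrier M \<and> r \<in> R \<and> n \<in> carrier N}"

definition balanced_kernel ::
  "'r set \<Rightarrow> ('m \<Rightarrow> 'r \<Rightarrow> 'm) \<Rightarrow> ('r \<Rightarrow> 'n \<Rightarrow> 'n) \<Rightarrow> ('m, 'x) ring_scheme \<Rightarrow> ('n, 'y) ring_scheme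
    \<Rightarrow> ('m \<times> 'n \<Rightarrow>\<^sub>0 int) set" where
  "balanced_kernel R \<rho> l M N =
     generate (free_Abelian_group (carrier M \<times> carrier N)) (balanced_relators R \<rho> l M N)"

definition balanced_tensor ::
  "'r set \<Rightarrow> ('m \<Rightarrow> 'r \<Rightarrow> 'm) \<Rightarrow> ('r \<Rightarrow> 'n \<Rightarrow> 'n) \<Rightarrow> ('m, 'x) ring_scheme \<Rightarrow> ('n, 'y) ring_scheme
    \<Rightarrow> ('m \<times> 'n \<Rightarrow>\<^sub>0 int) set monoid" where
  "balanced_tensor R \<rho> l M N =
     free_Abelian_group (carrier M \<times> carrier N) Mod balanced_kernel R \<rho> l M N"

definition balanced_pure ::
  "'r set \<Rightarrow> ('m \<Rightarrow> 'r \<Rightarrow> 'm) \<Rightarrow> ('r \<Rightarrow> 'n \<Rightarrow> 'n) \<Rightarrow> ('m, 'x) ring_scheme \<Rightarrow> ('n, 'y) ring_scheme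
    \<Rightarrow> 'm \<Rightarrow> 'n \<Rightarrow> ('m \<times> 'n \<Rightarrow>\<^sub>0 int) set" where
  "balanced_pure R \<rho> l M N m n =
     balanced_kernel R \<rho> l M N #>\<^bsub>free_Abelian_group (carrier M \<times> carrier N)\<^esub> frag_of (m, n)"

text \<open>
  The homomorphism into the (multiplicatively written) commutative group \<open>G\<close> that is determined
  on pure tensors by \<open>m \<otimes> n \<mapsto> F m n\<close>, evaluated on a coset \<open>t\<close>. If \<open>F\<close> is biadditive and balanced,
  the image set is a singleton.
\<close>

definition tensor_lift ::
  "('g, 'z) monoid_scheme \<Rightarrow> ('m \<Rightarrow> 'n \<Rightarrow> 'g) \<Rightarrow> ('m \<times> 'n \<Rightarrow>\<^sub>0 int) set \<Rightarrow> 'g" where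
  "tensor_lift G F t =
     the_elem ((\<lambda>x. finprod G (\<lambda>p. F (fst p) (snd p) [^]\<^bsub>G\<^esub> Poly_Mapping.lookup x p)
                            (Poly_Mapping.keys x)) ` t)"


section \<open>Tensor products over the ground field\<close>

definition ground_tensor_group ::
  "('k, 'w) ring_scheme \<Rightarrow> ('k, 'm, 'x) module_scheme \<Rightarrow> ('k, 'n, 'y) module_scheme
    \<Rightarrow> ('m \<times> 'n \<Rightarrow>\<^sub>0 int) set monoid" where
  "ground_tensor_group K M N =
     balanced_tensor (carrier K) (\<lambda>m c. c \<odot>\<^bsub>M\<^esub> m) (\<lambda>c n. c \<odot>\<^bsub>N\<^esub> n) M N"

definition pure_tensor ::
  "('k, 'w) ring_scheme \<Rightarrow> ('k, 'm, 'x) module_scheme \<Rightarrow> ('k, 'n, 'y) module_scheme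
    \<Rightarrow> 'm \<Rightarrow> 'n \<Rightarrow> ('m \<times> 'n \<Rightarrow>\<^sub>0 int) set" where
  "pure_tensor K M N =
     balanced_pure (carrier K) (\<lambda>m c. c \<odot>\<^bsub>M\<^esub> m) (\<lambda>c n. c \<odot>\<^bsub>N\<^esub> n) M N"

text \<open>
  The product \<open>(m \<otimes> n)(m' \<otimes> n') = m m' \<otimes> n n'\<close> and the unit are meaningful only if \<open>M\<close> and \<open>N\<close>
  are algebras; for mere modules these two fields are never used.
\<close>

definition tensor ::
  "('k, 'w) ring_scheme \<Rightarrow> ('k, 'm, 'x) module_scheme \<Rightarrow> ('k, 'n, 'y) module_scheme
    \<Rightarrow> ('k, ('m \<times> 'n \<Rightarrow>\<^sub>0 int) set) module" where
  "tensor K M N = (let G = ground_tensor_group K M N in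
     \<lparr>carrier = carrier G,
      monoid.mult = (\<lambda>t u. tensor_lift G (\<lambda>m n. tensor_lift G (\<lambda>m' n'.
         pure_tensor K M N (m \<otimes>\<^bsub>M\<^esub> m') (n \<otimes>\<^bsub>N\<^esub> n')) u) t),
      one = pure_tensor K M N \<one>\<^bsub>M\<^esub> \<one>\<^bsub>N\<^esub>,
      ring.zero = \<one>\<^bsub>G\<^esub>,
      ring.add = (\<lambda>t u. t \<otimes>\<^bsub>G\<^esub> u),
      smult = (\<lambda>c. tensor_lift G (\<lambda>m n. pure_tensor K M N (c \<odot>\<^bsub>M\<^esub> m) n))\<rparr>)"

text \<open>\<open>f \<otimes> g\<close> with values in \<open>M' \<otimes> N'\<close>.\<close>

definition tensor_map ::
  "('k, 'w) ring_scheme \<Rightarrow> ('k, 'm, 'x) module_scheme \<Rightarrow> ('k, 'n, 'y) module_scheme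
    \<Rightarrow> ('p \<Rightarrow> 'm) \<Rightarrow> ('q \<Rightarrow> 'n) \<Rightarrow> ('p \<times> 'q \<Rightarrow>\<^sub>0 int) set \<Rightarrow> ('m \<times> 'n \<Rightarrow>\<^sub>0 int) set" where
  "tensor_map K M' N' f g =
     tensor_lift (add_monoid (tensor K M' N')) (\<lambda>m n. pure_tensor K M' N' (f m) (g n))"

definition tensor_assoc ::
  "('k, 'w) ring_scheme \<Rightarrow> ('k, 'm, 'x) module_scheme \<Rightarrow> ('k, 'n, 'y) module_scheme
    \<Rightarrow> ('k, 'p, 'z) module_scheme
    \<Rightarrow> (('m \<times> 'n \<Rightarrow>\<^sub>0 int) set \<times> 'p \<Rightarrow>\<^sub>0 int) set \<Rightarrow> ('m \<times> ('n \<times> 'p \<Rightarrow>\<^sub>0 int) set \<Rightarrow>\<^sub>0 int) set" where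
  "tensor_assoc K M N P =
     (let G = add_monoid (tensor K M (tensor K N P)) in
      tensor_lift G (\<lambda>x p. tensor_lift G (\<lambda>m n.
        pure_tensor K M (tensor K N P) m (pure_tensor K N P n p)) x))"

text \<open>The image of \<open>U \<otimes> V\<close> in \<open>M \<otimes> N\<close> for subspaces \<open>U\<close> and \<open>V\<close>; over a field it is \<open>U \<otimes> V\<close> itself.\<close>

definition subtensor ::
  "('k, 'w) ring_scheme \<Rightarrow> ('k, 'm, 'x) module_scheme \<Rightarrow> ('k, 'n, 'y) module_scheme
    \<Rightarrow> 'm set \<Rightarrow> 'n set \<Rightarrow> ('m \<times> 'n \<Rightarrow>\<^sub>0 int) set set" where
  "subtensor K M N U V =
     generate (add_monoid (tensor K M N)) {pure_tensor K M N u v | u v. u \<in> U \<and> v \<in> V}"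


section \<open>Tensor products over a subring\<close>

text \<open>\<open>A \<otimes>\<^sub>S A\<close> for a subring \<open>S\<close> of a not necessarily commutative ring \<open>A\<close>.\<close>

definition tensor_over ::
  "('a, 'x) ring_scheme \<Rightarrow> 'a set \<Rightarrow> ('a \<times> 'a \<Rightarrow>\<^sub>0 int) set monoid" where
  "tensor_over A S = balanced_tensor S (\<lambda>a s. a \<otimes>\<^bsub>A\<^esub> s) (\<lambda>s a. s \<otimes>\<^bsub>A\<^esub> a) A A"

definition pure_tensor_over ::
  "('a, 'x) ring_scheme \<Rightarrow> 'a set \<Rightarrow> 'a \<Rightarrow> 'a \<Rightarrow> ('a \<times> 'a \<Rightarrow>\<^sub>0 int) set" where
  "pure_tensor_over A S = balanced_pure S (\<lambda>a s. a \<otimes>\<^bsub>A\<^esub> s) (\<lambda>s a. s \<otimes>\<^bsub>A\<^esub> a) A A"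

definition tensor_map_over ::
  "('a, 'x) ring_scheme \<Rightarrow> 'a set \<Rightarrow> ('p \<Rightarrow> 'a) \<Rightarrow> ('q \<Rightarrow> 'a) \<Rightarrow> ('p \<times> 'q \<Rightarrow>\<^sub>0 int) set
    \<Rightarrow> ('a \<times> 'a \<Rightarrow>\<^sub>0 int) set" where
  "tensor_map_over A S f g =
     tensor_lift (tensor_over A S) (\<lambda>x y. pure_tensor_over A S (f x) (g y))"


section \<open>Hopf algebras and comodule algebras\<close>

text \<open>The library locale \<open>algebra\<close> is restricted to commutative algebras.\<close>

locale unital_algebra = module K A + ring A
  for K :: "('k, 'w) ring_scheme" and A :: "('k, 'a, 'x) module_scheme" +
  assumes smult_mult_left:
      "\<lbrakk>c \<in> carrier K; x \<in> carrier A; y \<in> carrier A\<rbrakk>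
        \<Longrightarrow> (c \<odot>\<^bsub>A\<^esub> x) \<otimes>\<^bsub>A\<^esub> y = c \<odot>\<^bsub>A\<^esub> (x \<otimes>\<^bsub>A\<^esub> y)"
    and smult_mult_right:
      "\<lbrakk>c \<in> carrier K; x \<in> carrier A; y \<in> carrier A\<rbrakk>
        \<Longrightarrow> x \<otimes>\<^bsub>A\<^esub> (c \<odot>\<^bsub>A\<^esub> y) = c \<odot>\<^bsub>A\<^esub> (x \<otimes>\<^bsub>A\<^esub> y)"

definition linear_hom ::
  "('k, 'w) ring_scheme \<Rightarrow> ('k, 'm, 'x) module_scheme \<Rightarrow> ('k, 'n, 'y) module_scheme
    \<Rightarrow> ('m \<Rightarrow> 'n) set" where
  "linear_hom K M N =
     {f \<in> hom (add_monoid M) (add_monoid N).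
        \<forall>c\<in>carrier K. \<forall>x\<in>carrier M. f (c \<odot>\<^bsub>M\<^esub> x) = c \<odot>\<^bsub>N\<^esub> f x}"

definition algebra_hom ::
  "('k, 'w) ring_scheme \<Rightarrow> ('k, 'm, 'x) module_scheme \<Rightarrow> ('k, 'n, 'y) module_scheme
    \<Rightarrow> ('m \<Rightarrow> 'n) set" where
  "algebra_hom K A A' = ring_hom A A' \<inter> linear_hom K A A'"

locale hopf_algebra = field K + H: unital_algebra K H
  for K :: "('k, 'w) ring_scheme" and H :: "('k, 'h, 'x) module_scheme"
    and \<Delta> :: "'h \<Rightarrow> ('h \<times> 'h \<Rightarrow>\<^sub>0 int) set" and \<epsilon> :: "'h \<Rightarrow> 'k" and antipode :: "'h \<Rightarrow> 'h" +
  assumes comult_hom: "\<Delta> \<in> algebra_hom K H (tensor K H H)"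
    and counit_hom: "\<epsilon> \<in> ring_hom H K"
    and counit_linear:
      "\<lbrakk>c \<in> carrier K; h \<in> carrier H\<rbrakk> \<Longrightarrow> \<epsilon> (c \<odot>\<^bsub>H\<^esub> h) = c \<otimes>\<^bsub>K\<^esub> \<epsilon> h"
    and coassoc: "h \<in> carrier H \<Longrightarrow>
      tensor_assoc K H H H (tensor_map K (tensor K H H) H \<Delta> (\<lambda>g. g) (\<Delta> h)) =
      tensor_map K H (tensor K H H) (\<lambda>g. g) \<Delta> (\<Delta> h)"
    and counit_left: "h \<in> carrier H \<Longrightarrow>
      tensor_lift (add_monoid H) (\<lambda>h\<^sub>1 h\<^sub>2. \<epsilon> h\<^sub>1 \<odot>\<^bsub>H\<^esub> h\<^sub>2) (\<Delta> h) = h"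
    and counit_right: "h \<in> carrier H \<Longrightarrow>
      tensor_lift (add_monoid H) (\<lambda>h\<^sub>1 h\<^sub>2. \<epsilon> h\<^sub>2 \<odot>\<^bsub>H\<^esub> h\<^sub>1) (\<Delta> h) = h"
    and antipode_linear: "antipode \<in> linear_hom K H H"
    and antipode_left: "h \<in> carrier H \<Longrightarrow>
      tensor_lift (add_monoid H) (\<lambda>h\<^sub>1 h\<^sub>2. antipode h\<^sub>1 \<otimes>\<^bsub>H\<^esub> h\<^sub>2) (\<Delta> h) = \<epsilon> h \<odot>\<^bsub>H\<^esub> \<one>\<^bsub>H\<^esub>"
    and antipode_right: "h \<in> carrier H \<Longrightarrow>
      tensor_lift (add_monoid H) (\<lambda>h\<^sub>1 h\<^sub>2. h\<^sub>1 \<otimes>\<^bsub>H\<^esub> antipode h\<^sub>2) (\<Delta> h) = \<epsilon> h \<odot>\<^bsub>H\<^esub> \<one>\<^bsub>H\<^esub>"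

locale right_comodule_algebra = hopf_algebra K H \<Delta> \<epsilon> antipode + A: unital_algebra K A
  for K :: "('k, 'w) ring_scheme" and H :: "('k, 'h, 'x) module_scheme"
    and \<Delta> :: "'h \<Rightarrow> ('h \<times> 'h \<Rightarrow>\<^sub>0 int) set" and \<epsilon> :: "'h \<Rightarrow> 'k" and antipode :: "'h \<Rightarrow> 'h"
    and A :: "('k, 'a, 'y) module_scheme" and \<delta> :: "'a \<Rightarrow> ('a \<times> 'h \<Rightarrow>\<^sub>0 int) set" +
  assumes coaction_hom: "\<delta> \<in> algebra_hom K A (tensor K A H)"
    and coaction_coassoc: "a \<in> carrier A \<Longrightarrow>
      tensor_assoc K A H H (tensor_map K (tensor K A H) H \<delta> (\<lambda>h. h) (\<delta> a)) =
      tensor_map K A (tensor K H H) (\<lambda>x. x) \<Delta> (\<delta> a)"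
    and coaction_counit: "a \<in> carrier A \<Longrightarrow>
      tensor_lift (add_monoid A) (\<lambda>a\<^sub>0 a\<^sub>1. \<epsilon> a\<^sub>1 \<odot>\<^bsub>A\<^esub> a\<^sub>0) (\<delta> a) = a"


section \<open>Quotients by right ideal coideals, and coinvariants\<close>

text \<open>
  A right ideal of an algebra is automatically a subspace, since
  \<open>c \<odot> x = x \<otimes> (c \<odot> \<one>)\<close>.
\<close>

definition right_ideal_coideal ::
  "('k, 'w) ring_scheme \<Rightarrow> ('k, 'h, 'x) module_scheme \<Rightarrow> ('h \<Rightarrow> ('h \<times> 'h \<Rightarrow>\<^sub>0 int) set)
    \<Rightarrow> ('h \<Rightarrow> 'k) \<Rightarrow> 'h set \<Rightarrow> bool" where
  "right_ideal_coideal K H \<Delta> \<epsilon> I \<longleftrightarrow>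
     additive_subgroup I H \<and>
     (\<forall>x\<in>I. \<forall>h\<in>carrier H. x \<otimes>\<^bsub>H\<^esub> h \<in> I) \<and>
     \<Delta> ` I \<subseteq> subtensor K H H I (carrier H) <+>\<^bsub>tensor K H H\<^esub> subtensor K H H (carrier H) I \<and>
     (\<forall>x\<in>I. \<epsilon> x = \<zero>\<^bsub>K\<^esub>)"

text \<open>
  \<open>H/I\<close> as a vector space with the distinguished element \<open>\<pi>(1)\<close>. It has no product
  because \<open>I\<close> is only a right ideal.
\<close>

definition quot_module :: "('k, 'h, 'x) module_scheme \<Rightarrow> 'h set \<Rightarrow> ('k, 'h set) module" where
  "quot_module H I =
     \<lparr>carrier = a_rcosets\<^bsub>H\<^esub> I, monoid.mult = undefined, one = I +>\<^bsub>H\<^esub> \<one>\<^bsub>H\<^esub>,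
      ring.zero = I, ring.add = (\<lambda>U V. U <+>\<^bsub>H\<^esub> V),
      smult = (\<lambda>c U. \<Union>x\<in>U. I +>\<^bsub>H\<^esub> (c \<odot>\<^bsub>H\<^esub> x))\<rparr>"

definition quot_proj :: "('k, 'h, 'x) module_scheme \<Rightarrow> 'h set \<Rightarrow> 'h \<Rightarrow> 'h set" where
  "quot_proj H I h = I +>\<^bsub>H\<^esub> h"

text \<open>
  The poset of quotients \<open>H/I\<close>. Its elements are represented by the ideals \<open>I\<close>, hence the order is
  reverse inclusion.
\<close>

definition Quot_gen ::
  "('k, 'w) ring_scheme \<Rightarrow> ('k, 'h, 'x) module_scheme \<Rightarrow> ('h \<Rightarrow> ('h \<times> 'h \<Rightarrow>\<^sub>0 int) set)
    \<Rightarrow> ('h \<Rightarrow> 'k) \<Rightarrow> 'h set gorder" where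
  "Quot_gen K H \<Delta> \<epsilon> =
     \<lparr>carrier = {I. right_ideal_coideal K H \<Delta> \<epsilon> I}, eq = (=), le = (\<lambda>J I. I \<subseteq> J)\<rparr>"

definition coinvariants ::
  "('k, 'w) ring_scheme \<Rightarrow> ('k, 'h, 'x) module_scheme \<Rightarrow> ('k, 'a, 'y) module_scheme
    \<Rightarrow> ('a \<Rightarrow> ('a \<times> 'h \<Rightarrow>\<^sub>0 int) set) \<Rightarrow> 'a set" where
  "coinvariants K H A \<delta> = {a \<in> carrier A. \<delta> a = pure_tensor K A H a \<one>\<^bsub>H\<^esub>}"

text \<open>
  Coinvariants with respect to \<open>H/I\<close>. For \<open>A = H\<close> and \<open>\<delta> = \<Delta>\<close> these are the coinvariants of \<open>H\<close> itself.
\<close>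

definition quot_coinvariants ::
  "('k, 'w) ring_scheme \<Rightarrow> ('k, 'h, 'x) module_scheme \<Rightarrow> ('k, 'a, 'y) module_scheme
    \<Rightarrow> ('a \<Rightarrow> ('a \<times> 'h \<Rightarrow>\<^sub>0 int) set) \<Rightarrow> 'h set \<Rightarrow> 'a set" where
  "quot_coinvariants K H A \<delta> I =
     {a \<in> carrier A. tensor_map K A (quot_module H I) (\<lambda>x. x) (quot_proj H I) (\<delta> a) =
        pure_tensor K A (quot_module H I) a (quot_proj H I \<one>\<^bsub>H\<^esub>)}"


section \<open>Canonical maps\<close>

text \<open>
  \<open>a \<otimes> b \<mapsto> a b\<^sub>0 \<otimes> \<pi>(b\<^sub>1)\<close> on \<open>A \<otimes>\<^sub>S A\<close>, for a linear map \<open>\<pi>\<close> from \<open>H\<close> to \<open>N\<close>: the value is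
  the image of \<open>\<delta> b\<close> under \<open>x \<otimes> h \<mapsto> a x \<otimes> \<pi>(h)\<close>. The subring \<open>S\<close> enters only through the domain
  to which the map is applied.
\<close>

definition canonical_map ::
  "('k, 'w) ring_scheme \<Rightarrow> ('k, 'a, 'y) module_scheme \<Rightarrow> ('a \<Rightarrow> ('a \<times> 'h \<Rightarrow>\<^sub>0 int) set)
    \<Rightarrow> ('k, 'n, 'z) module_scheme \<Rightarrow> ('h \<Rightarrow> 'n) \<Rightarrow> ('a \<times> 'a \<Rightarrow>\<^sub>0 int) set
    \<Rightarrow> ('a \<times> 'n \<Rightarrow>\<^sub>0 int) set" where
  "canonical_map K A \<delta> N \<pi> =
     tensor_lift (add_monoid (tensor K A N))
       (\<lambda>a b. tensor_map K A N (\<lambda>x. a \<otimes>\<^bsub>A\<^esub> x) \<pi> (\<delta> b))"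

definition hopf_galois ::
  "('k, 'w) ring_scheme \<Rightarrow> ('k, 'h, 'x) module_scheme \<Rightarrow> ('k, 'a, 'y) module_scheme
    \<Rightarrow> ('a \<Rightarrow> ('a \<times> 'h \<Rightarrow>\<^sub>0 int) set) \<Rightarrow> 'a set \<Rightarrow> bool" where
  "hopf_galois K H A \<delta> B \<longleftrightarrow>
     bij_betw (canonical_map K A \<delta> H (\<lambda>h. h)) (carrier (tensor_over A B)) (carrier (tensor K A H))"


section \<open>The Galois connection\<close>

definition Sub_Alg ::
  "('k, 'w) ring_scheme \<Rightarrow> ('k, 'a, 'y) module_scheme \<Rightarrow> 'a set \<Rightarrow> 'a set gorder" where
  "Sub_Alg K A B =
     \<lparr>carrier = {S. subring S A \<and> (\<forall>c\<in>carrier K. \<forall>s\<in>S. c \<odot>\<^bsub>A\<^esub> s \<in> S) \<and> B \<subseteq> S},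
      eq = (=), le = (\<subseteq>)\<rparr>"

definition galois_phi ::
  "('k, 'w) ring_scheme \<Rightarrow> ('k, 'h, 'x) module_scheme \<Rightarrow> ('h \<Rightarrow> ('h \<times> 'h \<Rightarrow>\<^sub>0 int) set)
    \<Rightarrow> ('h \<Rightarrow> 'k) \<Rightarrow> ('k, 'a, 'y) module_scheme \<Rightarrow> ('a \<Rightarrow> ('a \<times> 'h \<Rightarrow>\<^sub>0 int) set)
    \<Rightarrow> 'h set \<Rightarrow> 'a set" where
  "galois_phi K H \<Delta> \<epsilon> A \<delta> = (\<lambda>I \<in> carrier (Quot_gen K H \<Delta> \<epsilon>). quot_coinvariants K H A \<delta> I)"

definition galois_psi ::
  "('k, 'w) ring_scheme \<Rightarrow> ('k, 'h, 'x) module_scheme \<Rightarrow> ('h \<Rightarrow> ('h \<times> 'h \<Rightarrow>\<^sub>0 int) set)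
    \<Rightarrow> ('h \<Rightarrow> 'k) \<Rightarrow> ('k, 'a, 'y) module_scheme \<Rightarrow> ('a \<Rightarrow> ('a \<times> 'h \<Rightarrow>\<^sub>0 int) set)
    \<Rightarrow> 'a set \<Rightarrow> 'h set" where
  "galois_psi K H \<Delta> \<epsilon> A \<delta> =
     (\<lambda>S \<in> carrier (Sub_Alg K A (coinvariants K H A \<delta>)).
        \<Squnion>\<^bsub>Quot_gen K H \<Delta> \<epsilon>\<^esub>
          {I \<in> carrier (Quot_gen K H \<Delta> \<epsilon>). S \<subseteq> quot_coinvariants K H A \<delta> I})"

definition galois_closed ::
  "('k, 'w) ring_scheme \<Rightarrow> ('k, 'h, 'x) module_scheme \<Rightarrow> ('h \<Rightarrow> ('h \<times> 'h \<Rightarrow>\<^sub>0 int) set)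
    \<Rightarrow> ('h \<Rightarrow> 'k) \<Rightarrow> ('k, 'a, 'y) module_scheme \<Rightarrow> ('a \<Rightarrow> ('a \<times> 'h \<Rightarrow>\<^sub>0 int) set)
    \<Rightarrow> 'h set \<Rightarrow> bool" where
  "galois_closed K H \<Delta> \<epsilon> A \<delta> I \<longleftrightarrow>
     galois_psi K H \<Delta> \<epsilon> A \<delta> (galois_phi K H \<Delta> \<epsilon> A \<delta> I) = I"

end

theory Submission
  imports Defs
begin

text \<open>
  Write \<open>S = A\<^sup>c\<^sup>o\<^sup>Q\<close> and \<open>C = H\<^sup>c\<^sup>o\<^sup>Q\<close>, let \<open>Q = H/I\<close>, and let \<open>T\<close> be the target \<open>(A \<otimes> H) \<otimes> (A \<otimes> H)\<close>, balanced
  over \<open>A \<otimes> C\<close>, of \<open>\<delta> \<otimes> \<delta>\<close>. A formal sum \<open>x\<close> of pairs \<open>(a, b)\<close> represents a tensor over every subalgebra of \<open>A\<close>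
  at once. It has a value \<open>c(x) = \<Sum> (a \<otimes> 1) \<delta>(b)\<close> in \<open>A \<otimes> H\<close> and a value \<open>d(x) = \<Sum> \<delta>(a) \<otimes> \<delta>(b)\<close> in \<open>T\<close>.
  By exactness of the tensor product over a field, the kernel of \<open>id \<otimes> \<pi>\<close> is \<open>A \<otimes> I\<close>. The Galois property says that every element of
  \<open>A \<otimes> H\<close> is some \<open>c(x)\<close>. Hence \<open>can\<^sub>Q\<close>, which is \<open>id \<otimes> \<pi>\<close> after \<open>c\<close>, is always surjective, and it is bijective
  if and only if \<open>c(x) \<in> A \<otimes> I\<close> implies that \<open>x\<close> represents \<open>0\<close> over \<open>S\<close> (\<open>canonical_bij_iff\<close>). Likewise,
  \<open>\<delta> \<otimes> \<delta>\<close> is injective if and only if \<open>d(x) = 0\<close> implies this (\<open>tensor_map_over_inj_iff\<close>).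

  The two conditions on \<open>x\<close> are compared by maps in both directions. The map
  \<open>t \<otimes> u \<mapsto> (id \<otimes> \<pi>) (((id \<otimes> \<epsilon>)(t) \<otimes> 1) u)\<close> sends \<open>d(x)\<close> to the class of \<open>c(x)\<close>, so \<open>d(x) = 0\<close> implies
  \<open>c(x) \<in> A \<otimes> I\<close> (\<open>coact_sum_zero_canon_sum\<close>); it is balanced over \<open>A \<otimes> C\<close> because \<open>\<pi>(k) = \<epsilon>(k) \<pi>(1)\<close> on \<open>C\<close>.
  Thus (i) implies (b). In the other direction, \<open>\<Xi>(a \<otimes> h) = \<delta>(a) (1 \<otimes> \<sigma>(h\<^sub>1)) \<otimes> (1 \<otimes> h\<^sub>2)\<close>, where \<open>\<sigma>\<close> is the
  antipode, satisfies \<open>\<Xi>(c(x)) = d(x)\<close> (\<open>Xi_canon\<close>). It vanishes on \<open>A \<otimes> J\<close> for the right ideal \<open>J\<close> generated by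
  the elements of \<open>C\<close> of counit \<open>0\<close> (\<open>xi_generator\<close>). Therefore (b) and \<open>I \<subseteq> J\<close> imply (i).

  It remains to relate both sides to closedness. The right ideal \<open>J\<close> is a coideal, and \<open>S\<close> consists of
  coinvariants for \<open>H/J\<close>, because \<open>\<delta>(S) \<subseteq> A \<otimes> C\<close>; so \<open>I \<subseteq> J\<close> if \<open>Q\<close> is closed (\<open>closed_imp_coinv_ideal\<close>).
  Conversely assume (i), and let \<open>S\<close> consist of coinvariants for \<open>H/I'\<close>. An element of \<open>A \<otimes> I\<close> is some
  \<open>c(x)\<close>; by (i) \<open>x\<close> represents \<open>0\<close> over \<open>S\<close>, hence \<open>c(x) \<in> A \<otimes> I'\<close>. So \<open>A \<otimes> I \<subseteq> A \<otimes> I'\<close>, and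
  \<open>I \<subseteq> I'\<close> as \<open>A \<noteq> 0\<close> (\<open>bij_imp_closed\<close>).
\<close>

section \<open>The universal property of balanced tensor products\<close>

text \<open>
  The value of \<open>tensor_lift\<close> on one representative of a tensor.
\<close>

definition frag_lift :: "('g, 'z) monoid_scheme \<Rightarrow> ('m \<Rightarrow> 'n \<Rightarrow> 'g) \<Rightarrow> ('m \<times> 'n \<Rightarrow>\<^sub>0 int) \<Rightarrow> 'g" where
  "frag_lift G F x = finprod G (\<lambda>p. F (fst p) (snd p) [^]\<^bsub>G\<^esub> Poly_Mapping.lookup x p)
                        (Poly_Mapping.keys x)"

text \<open>
  The supports of \<open>x\<close>, \<open>y\<close> and \<open>x + y\<close> may differ; additivity is proved over a common finite index set.
\<close>

lemma frag_lift_superset: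
  assumes "comm_group G" "\<And>m n. (m, n) \<in> S \<Longrightarrow> F m n \<in> carrier G"
    and "finite T" "Poly_Mapping.keys x \<subseteq> T" "T \<subseteq> S"
  shows "frag_lift G F x = finprod G (\<lambda>p. F (fst p) (snd p) [^]\<^bsub>G\<^esub> Poly_Mapping.lookup x p) T"
proof -
  interpret comm_group G by fact
  show ?thesis
    unfolding frag_lift_def using assms
    by (intro finprod_mono_neutral_cong_left)
       (auto simp: in_keys_iff intro!: int_pow_closed)
qed

lemma frag_lift_hom:
  fixes F :: "'m \<Rightarrow> 'n \<Rightarrow> 'g"
  assumes "comm_group G" "\<And>m n. (m, n) \<in> S \<Longrightarrow> F m n \<in> carrier G"
  shows "frag_lift G F \<in> hom (free_Abelian_group S) G"
proof -
  interpret comm_group G by fact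
  have closed: "(\<lambda>p. F (fst p) (snd p) [^]\<^bsub>G\<^esub> Poly_Mapping.lookup x p) \<in> T \<rightarrow> carrier G"
    if "T \<subseteq> S" for T and x :: "'m \<times> 'n \<Rightarrow>\<^sub>0 int"
    using that assms(2) by (auto intro!: int_pow_closed dest: subsetD)
  show ?thesis
  proof (rule homI)
    fix x assume "x \<in> carrier (free_Abelian_group S)"
    then show "frag_lift G F x \<in> carrier G"
      unfolding frag_lift_def using closed by (intro finprod_closed) auto
  next
    fix x y assume xy: "x \<in> carrier (free_Abelian_group S)" "y \<in> carrier (free_Abelian_group S)"
    define T where "T = Poly_Mapping.keys x \<union> Poly_Mapping.keys y"
    have T: "finite T" "T \<subseteq> S" "Poly_Mapping.keys x \<subseteq> T" "Poly_Mapping.keys y \<subseteq> T"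
      "Poly_Mapping.keys (x + y) \<subseteq> T"
      using xy Poly_Mapping.keys_add[of x y] by (auto simp: T_def)
    let ?f = "\<lambda>x p. F (fst p) (snd p) [^]\<^bsub>G\<^esub> Poly_Mapping.lookup x p"
    have "frag_lift G F (x + y) = finprod G (?f (x + y)) T"
      using T by (intro frag_lift_superset[OF assms]) auto
    also have "\<dots> = finprod G (\<lambda>p. ?f x p \<otimes>\<^bsub>G\<^esub> ?f y p) T"
      using T(2) assms(2)
      by (intro finprod_cong) (auto simp: simp_implies_def lookup_add int_pow_mult)
    also have "\<dots> = finprod G (?f x) T \<otimes>\<^bsub>G\<^esub> finprod G (?f y) T"
      using closed T(2) by (intro finprod_multf) auto
    also have "\<dots> = frag_lift G F x \<otimes>\<^bsub>G\<^esub> frag_lift G F y"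
      using T frag_lift_superset[where S = S and F = F and T = T, OF assms] by simp
    finally show "frag_lift G F (x \<otimes>\<^bsub>free_Abelian_group S\<^esub> y) = frag_lift G F x \<otimes>\<^bsub>G\<^esub> frag_lift G F y"
      by simp
  qed
qed

lemma frag_lift_frag_of:
  assumes "comm_group G" "F m n \<in> carrier G"
  shows "frag_lift G F (frag_of (m, n)) = F m n"
proof -
  interpret comm_group G by fact
  show ?thesis
    using assms(2) by (simp add: frag_lift_def finprod_singleton)
qed

lemma frag_lift_diff:
  assumes "comm_group G" "\<And>m n. (m, n) \<in> S \<Longrightarrow> F m n \<in> carrier G"
    and "Poly_Mapping.keys x \<subseteq> S" "Poly_Mapping.keys y \<subseteq> S"
  shows "frag_lift G F (x - y) = frag_lift G F x \<otimes>\<^bsub>G\<^esub> inv\<^bsub>G\<^esub> frag_lift G F y"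
proof -
  interpret comm_group G by fact
  interpret h: group_hom "free_Abelian_group S" G "frag_lift G F"
    using frag_lift_hom[OF assms(1,2)] by (auto simp: group_hom_def group_hom_axioms_def is_group)
  have "frag_lift G F (x - y) = frag_lift G F (x \<otimes>\<^bsub>free_Abelian_group S\<^esub> inv\<^bsub>free_Abelian_group S\<^esub> y)"
    using assms by simp
  also have "\<dots> = frag_lift G F x \<otimes>\<^bsub>G\<^esub> inv\<^bsub>G\<^esub> frag_lift G F y"
    using assms(3,4) h.hom_mult h.hom_inv
    by (metis carrier_free_Abelian_group_iff h.G.inv_closed)
  finally show ?thesis .
qed

lemma frag_lift_comp:
  assumes G: "comm_group G" and G': "comm_group G'" and \<phi>: "\<phi> \<in> hom G G'"
    and F: "\<And>m n. (m, n) \<in> S \<Longrightarrow> F m n \<in> carrier G" and x: "Poly_Mapping.keys x \<subseteq> S"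
  shows "\<phi> (frag_lift G F x) = frag_lift G' (\<lambda>m n. \<phi> (F m n)) x"
proof -
  interpret G: comm_group G by fact
  interpret G': comm_group G' by fact
  interpret \<phi>: group_hom G G' \<phi> using \<phi> by (simp add: group_hom_def group_hom_axioms_def G.is_group G'.is_group)
  have F': "\<And>m n. (m, n) \<in> S \<Longrightarrow> \<phi> (F m n) \<in> carrier G'" using F by simp
  note h = frag_lift_hom[where S = S and F = F, OF G F]
    and h' = frag_lift_hom[where S = S and F = "\<lambda>m n. \<phi> (F m n)", OF G' F']
  show ?thesis
    using x
  proof (rule free_Abelian_group_induct[where P = "\<lambda>x. \<phi> (frag_lift G F x) = frag_lift G' (\<lambda>m n. \<phi> (F m n)) x"], goal_cases)
    case 1
    interpret h: group_hom "free_Abelian_group S" G "frag_lift G F"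
      using h by (simp add: group_hom_def group_hom_axioms_def G.is_group)
    interpret h': group_hom "free_Abelian_group S" G' "frag_lift G' (\<lambda>m n. \<phi> (F m n))"
      using h' by (simp add: group_hom_def group_hom_axioms_def G'.is_group)
    show ?case using h.hom_one h'.hom_one by simp
  next
    case (2 x y)
    have c: "frag_lift G F x \<in> carrier G" "frag_lift G F y \<in> carrier G"
      using hom_in_carrier[OF h] 2 by auto
    have d: "frag_lift G F (x - y) = frag_lift G F x \<otimes>\<^bsub>G\<^esub> inv\<^bsub>G\<^esub> frag_lift G F y"
      by (rule frag_lift_diff[where S = S, OF G F]) (use 2 in auto)
    have d': "frag_lift G' (\<lambda>m n. \<phi> (F m n)) (x - y) =
        frag_lift G' (\<lambda>m n. \<phi> (F m n)) x \<otimes>\<^bsub>G'\<^esub> inv\<^bsub>G'\<^esub> frag_lift G' (\<lambda>m n. \<phi> (F m n)) y"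
      by (rule frag_lift_diff[where S = S, OF G' F']) (use 2 in auto)
    show ?case unfolding d d' using c 2 by simp
  next
    case (3 p)
    then show ?case
      using frag_lift_frag_of[where F = F and m = "fst p" and n = "snd p", OF G]
        frag_lift_frag_of[where F = "\<lambda>m n. \<phi> (F m n)" and m = "fst p" and n = "snd p", OF G'] F F' by simp
  qed
qed

lemma frag_lift_cong:
  assumes "comm_group G" "Poly_Mapping.keys x \<subseteq> S"
    and "\<And>m n. (m, n) \<in> S \<Longrightarrow> F m n = F' m n" "\<And>m n. (m, n) \<in> S \<Longrightarrow> F' m n \<in> carrier G"
  shows "frag_lift G F x = frag_lift G F' x"
proof -
  interpret G: comm_group G by fact
  show ?thesis
    unfolding frag_lift_def
    by (rule G.finprod_cong') (use assms(2-4) in \<open>auto simp: subset_iff intro!: G.int_pow_closed\<close>)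
qed

definition balanced_map where
  "balanced_map R \<rho> l M N G F \<longleftrightarrow>
     (\<forall>m\<in>carrier M. \<forall>n\<in>carrier N. F m n \<in> carrier G) \<and>
     (\<forall>m\<in>carrier M. \<forall>m'\<in>carrier M. \<forall>n\<in>carrier N. F (m \<oplus>\<^bsub>M\<^esub> m') n = F m n \<otimes>\<^bsub>G\<^esub> F m' n) \<and>
     (\<forall>m\<in>carrier M. \<forall>n\<in>carrier N. \<forall>n'\<in>carrier N. F m (n \<oplus>\<^bsub>N\<^esub> n') = F m n \<otimes>\<^bsub>G\<^esub> F m n') \<and>
     (\<forall>m\<in>carrier M. \<forall>r\<in>R. \<forall>n\<in>carrier N. F (\<rho> m r) n = F m (l r n))"

locale balanced_pair =
  M: abelian_group M + N: abelian_group N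
  for R :: "'r set" and \<rho> :: "'m \<Rightarrow> 'r \<Rightarrow> 'm" and l :: "'r \<Rightarrow> 'n \<Rightarrow> 'n"
    and M :: "('m, 'x) ring_scheme" and N :: "('n, 'y) ring_scheme" +
  assumes right_closed: "\<lbrakk>m \<in> carrier M; r \<in> R\<rbrakk> \<Longrightarrow> \<rho> m r \<in> carrier M"
    and left_closed: "\<lbrakk>r \<in> R; n \<in> carrier N\<rbrakk> \<Longrightarrow> l r n \<in> carrier N"
begin

abbreviation FA where "FA \<equiv> free_Abelian_group (carrier M \<times> carrier N)"
abbreviation Ker where "Ker \<equiv> balanced_kernel R \<rho> l M N"
abbreviation BT where "BT \<equiv> balanced_tensor R \<rho> l M N"
abbreviation bp where "bp \<equiv> balanced_pure R \<rho> l M N"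

lemma relators_closed: "balanced_relators R \<rho> l M N \<subseteq> carrier FA"
proof -
  have d: "Poly_Mapping.keys (x - y) \<subseteq> S"
    if "Poly_Mapping.keys x \<subseteq> S" "Poly_Mapping.keys y \<subseteq> S" for x y :: "'m \<times> 'n \<Rightarrow>\<^sub>0 int" and S
    using that keys_diff[of x y] by blast
  have f: "Poly_Mapping.keys (frag_of p) \<subseteq> carrier M \<times> carrier N" if "p \<in> carrier M \<times> carrier N" for p
    using that by simp
  show ?thesis
    unfolding balanced_relators_def
    by (intro Un_least subsetI; elim CollectE exE conjE; hypsubst;
        unfold carrier_free_Abelian_group_iff; intro d f)
       (auto simp: right_closed left_closed)
qed

lemma Ker_subgroup: "subgroup Ker FA"
  unfolding balanced_kernel_def using relators_closed
  by (intro group.generate_is_subgroup) auto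

lemma Ker_normal: "Ker \<lhd> FA"
  using Ker_subgroup abelian_free_Abelian_group comm_group.subgroup_imp_normal by blast

lemma BT_comm_group: "comm_group BT"
  unfolding balanced_tensor_def
  using comm_group.abelian_FactGroup[OF abelian_free_Abelian_group Ker_subgroup] .

lemma BT_carrier: "carrier BT = (\<lambda>x. Ker #>\<^bsub>FA\<^esub> x) ` carrier FA"
  unfolding balanced_tensor_def by (rule carrier_FactGroup)

lemma coset_hom: "(\<lambda>x. Ker #>\<^bsub>FA\<^esub> x) \<in> hom FA BT"
  unfolding balanced_tensor_def using normal.r_coset_hom_Mod[OF Ker_normal] .

lemma coset_add:
  assumes "x \<in> carrier FA" "y \<in> carrier FA"
  shows "Ker #>\<^bsub>FA\<^esub> (x + y) = (Ker #>\<^bsub>FA\<^esub> x) \<otimes>\<^bsub>BT\<^esub> (Ker #>\<^bsub>FA\<^esub> y)"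
  using hom_mult[OF coset_hom assms] by simp

lemma coset_eq_iff:
  assumes "x \<in> carrier FA" "y \<in> carrier FA"
  shows "Ker #>\<^bsub>FA\<^esub> x = Ker #>\<^bsub>FA\<^esub> y \<longleftrightarrow> x - y \<in> Ker"
proof -
  interpret FA: comm_group FA by (rule abelian_free_Abelian_group)
  interpret Ker: normal Ker FA by (rule Ker_normal)
  have "Ker #>\<^bsub>FA\<^esub> x = Ker #>\<^bsub>FA\<^esub> y \<longleftrightarrow> x \<in> Ker #>\<^bsub>FA\<^esub> y"
    using assms FA.repr_independence[OF _ _ Ker_subgroup]
    by (metis FA.rcos_self Ker_subgroup)
  also have "\<dots> \<longleftrightarrow> x \<otimes>\<^bsub>FA\<^esub> inv\<^bsub>FA\<^esub> y \<in> Ker"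
    using assms Ker.rcos_module[OF FA.is_group] by blast
  also have "x \<otimes>\<^bsub>FA\<^esub> inv\<^bsub>FA\<^esub> y = x - y"
    using assms by simp
  finally show ?thesis .
qed

lemma coset_eq_one_iff:
  assumes "x \<in> carrier FA"
  shows "Ker #>\<^bsub>FA\<^esub> x = \<one>\<^bsub>BT\<^esub> \<longleftrightarrow> x \<in> Ker"
proof -
  have "\<one>\<^bsub>BT\<^esub> = Ker #>\<^bsub>FA\<^esub> 0"
    using group_hom.hom_one[of FA BT "\<lambda>x. Ker #>\<^bsub>FA\<^esub> x"] coset_hom BT_comm_group
    by (simp add: group_hom_def group_hom_axioms_def comm_group_def)
  then show ?thesis
    using coset_eq_iff[OF assms, of 0] by simp
qed

lemma pure_closed: "\<lbrakk>m \<in> carrier M; n \<in> carrier N\<rbrakk> \<Longrightarrow> bp m n \<in> carrier BT"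
  unfolding BT_carrier balanced_pure_def by auto

lemma pure_balanced: "balanced_map R \<rho> l M N BT bp"
proof -
  have rel: "x \<in> Ker" if "x \<in> balanced_relators R \<rho> l M N" for x
    unfolding balanced_kernel_def using that by (rule generate.incl)
  have rel1: "frag_of (m \<oplus>\<^bsub>M\<^esub> m', n) - (frag_of (m, n) + frag_of (m', n)) \<in> Ker"
    if "m \<in> carrier M" "m' \<in> carrier M" "n \<in> carrier N" for m m' n
    by (rule rel, unfold balanced_relators_def diff_diff_eq[symmetric], rule UnI1, rule UnI1,
        intro CollectI exI conjI, rule refl) (use that in auto)
  have rel2: "frag_of (m, n \<oplus>\<^bsub>N\<^esub> n') - (frag_of (m, n) + frag_of (m, n')) \<in> Ker"
    if "m \<in> carrier M" "n' \<in> carrier N" "n \<in> carrier N" for m n n'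
    by (rule rel, unfold balanced_relators_def diff_diff_eq[symmetric], rule UnI1, rule UnI2,
        intro CollectI exI conjI, rule refl) (use that in auto)
  have rel3: "frag_of (\<rho> m r, n) - frag_of (m, l r n) \<in> Ker"
    if "m \<in> carrier M" "r \<in> R" "n \<in> carrier N" for m r n
    by (rule rel, unfold balanced_relators_def, rule UnI2, intro CollectI exI conjI, rule refl)
      (use that in auto)
  have add: "bp m n \<otimes>\<^bsub>BT\<^esub> bp m' n' = Ker #>\<^bsub>FA\<^esub> (frag_of (m, n) + frag_of (m', n'))"
    if "m \<in> carrier M" "m' \<in> carrier M" "n \<in> carrier N" "n' \<in> carrier N" for m m' n n'
    unfolding balanced_pure_def using that by (subst coset_add) auto
  have add_closed: "frag_of (m, n) + frag_of (m', n') \<in> carrier FA"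
    if "m \<in> carrier M" "m' \<in> carrier M" "n \<in> carrier N" "n' \<in> carrier N" for m m' n n'
    using that by (auto dest!: subsetD[OF keys_add])
  have 1: "bp (m \<oplus>\<^bsub>M\<^esub> m') n = bp m n \<otimes>\<^bsub>BT\<^esub> bp m' n"
    if "m \<in> carrier M" "m' \<in> carrier M" "n \<in> carrier N" for m m' n
    unfolding add[OF that(1,2,3,3)] unfolding balanced_pure_def
    using that add_closed rel1 by (subst coset_eq_iff) auto
  have 2: "bp m (n \<oplus>\<^bsub>N\<^esub> n') = bp m n \<otimes>\<^bsub>BT\<^esub> bp m n'"
    if "m \<in> carrier M" "n' \<in> carrier N" "n \<in> carrier N" for m n n'
    unfolding add[OF that(1,1,3,2)] unfolding balanced_pure_def
    using that add_closed rel2 by (subst coset_eq_iff) auto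
  have 3: "bp (\<rho> m r) n = bp m (l r n)" if "m \<in> carrier M" "r \<in> R" "n \<in> carrier N" for m r n
    unfolding balanced_pure_def using that
rel3
    by (subst coset_eq_iff) (auto simp: right_closed left_closed)
  show ?thesis
    unfolding balanced_map_def by (intro conjI ballI pure_closed 1 2 3)
qed

text \<open>
  Inverses need no case of their own, because \<open>- (m \<otimes> n) = (- m) \<otimes> n\<close>; and \<open>0\<close> is the pure tensor \<open>0 \<otimes> 0\<close>.
\<close>

lemma tensor_induct [consumes 1, case_names pure add]:
  assumes t: "t \<in> carrier BT"
    and pure: "\<And>m n. \<lbrakk>m \<in> carrier M; n \<in> carrier N\<rbrakk> \<Longrightarrow> P (bp m n)"
    and add: "\<And>t u. \<lbrakk>t \<in> carrier BT; u \<in> carrier BT; P t; P u\<rbrakk> \<Longrightarrow> P (t \<otimes>\<^bsub>BT\<^esub> u)"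
  shows "P t"
proof -
  interpret BT: comm_group BT by (rule BT_comm_group)
  obtain x where x: "x \<in> carrier FA" "t = Ker #>\<^bsub>FA\<^esub> x"
    using t BT_carrier by auto
  have one: "bp \<zero>\<^bsub>M\<^esub> n = \<one>\<^bsub>BT\<^esub>" if "n \<in> carrier N" for n
  proof -
    have "bp \<zero>\<^bsub>M\<^esub> n \<otimes>\<^bsub>BT\<^esub> bp \<zero>\<^bsub>M\<^esub> n = bp \<zero>\<^bsub>M\<^esub> n"
      using pure_balanced that unfolding balanced_map_def by (metis M.zero_closed M.l_zero)
    then show ?thesis
      using BT.l_cancel_one pure_closed that by blast
  qed
  have P1: "P \<one>\<^bsub>BT\<^esub>"
    using pure[of "\<zero>\<^bsub>M\<^esub>" "\<zero>\<^bsub>N\<^esub>"] one by auto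
  have inv: "inv\<^bsub>BT\<^esub> (bp m n) = bp (\<ominus>\<^bsub>M\<^esub> m) n" if "m \<in> carrier M" "n \<in> carrier N" for m n
  proof (rule BT.inv_equality)
    have "bp (\<ominus>\<^bsub>M\<^esub> m) n \<otimes>\<^bsub>BT\<^esub> bp m n = bp (\<ominus>\<^bsub>M\<^esub> m \<oplus>\<^bsub>M\<^esub> m) n"
      using pure_balanced that unfolding balanced_map_def by (metis M.a_inv_closed)
    then show "bp (\<ominus>\<^bsub>M\<^esub> m) n \<otimes>\<^bsub>BT\<^esub> bp m n = \<one>\<^bsub>BT\<^esub>"
      using that one by (simp add: M.l_neg)
  qed (use that pure_closed in auto)
  interpret h: group_hom FA BT "\<lambda>x. Ker #>\<^bsub>FA\<^esub> x"
    using coset_hom by (auto simp: group_hom_def group_hom_axioms_def BT.is_group)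
  let ?Q = "\<lambda>x. P (Ker #>\<^bsub>FA\<^esub> x) \<and> P (inv\<^bsub>BT\<^esub> (Ker #>\<^bsub>FA\<^esub> x))"
  have keys: "Poly_Mapping.keys x \<subseteq> carrier M \<times> carrier N"
    using x(1) by simp
  have "?Q x"
    using keys
  proof (rule free_Abelian_group_induct[where P = ?Q], goal_cases)
    case 1
    have "Ker #>\<^bsub>FA\<^esub> 0 = \<one>\<^bsub>BT\<^esub>" using h.hom_one by simp
    then show ?case using P1 by simp
  next
    case (2 x y)
    then have c: "x \<in> carrier FA" "y \<in> carrier FA" by auto
    have e: "Ker #>\<^bsub>FA\<^esub> (x - y) = (Ker #>\<^bsub>FA\<^esub> x) \<otimes>\<^bsub>BT\<^esub> inv\<^bsub>BT\<^esub> (Ker #>\<^bsub>FA\<^esub> y)"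
      using h.hom_mult[OF c(1), of "inv\<^bsub>FA\<^esub> y"] h.hom_inv[OF c(2)] c(2) by simp
    let ?a = "Ker #>\<^bsub>FA\<^esub> x" and ?b = "Ker #>\<^bsub>FA\<^esub> y"
    have ab: "?a \<in> carrier BT" "?b \<in> carrier BT"
      using h.hom_closed[OF c(1)] h.hom_closed[OF c(2)] by auto
    then have e': "inv\<^bsub>BT\<^esub> (?a \<otimes>\<^bsub>BT\<^esub> inv\<^bsub>BT\<^esub> ?b) = inv\<^bsub>BT\<^esub> ?a \<otimes>\<^bsub>BT\<^esub> ?b"
      by (simp add: BT.inv_mult)
    have "P (?a \<otimes>\<^bsub>BT\<^esub> inv\<^bsub>BT\<^esub> ?b)" "P (inv\<^bsub>BT\<^esub> ?a \<otimes>\<^bsub>BT\<^esub> ?b)"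
      using 2 add[OF ab(1) BT.inv_closed[OF ab(2)]] add[OF BT.inv_closed[OF ab(1)] ab(2)] by auto
    then show ?case
      unfolding e e' by simp
  next
    case (3 p)
    then obtain m n where p: "p = (m, n)" "m \<in> carrier M" "n \<in> carrier N" by auto
    then show ?case
      using pure[of m n] pure[of "\<ominus>\<^bsub>M\<^esub> m" n] inv[of m n]
      by (simp add: balanced_pure_def)
  qed
  then show ?thesis using x by simp
qed

context
  fixes G :: "('g, 'z) monoid_scheme" and F
  assumes G: "comm_group G" and F: "balanced_map R \<rho> l M N G F"
begin

text \<open>
  A map is biadditive and balanced if and only if its additive extension kills the relators. This makes \<open>tensor_lift\<close>
  independent of the representative.
\<close>

lemma frag_lift_kernel:
  assumes "x \<in> Ker"
  shows "frag_lift G F x = \<one>\<^bsub>G\<^esub>"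
proof -
  interpret G: comm_group G by (rule G)
  have Fc: "\<And>m n. (m, n) \<in> carrier M \<times> carrier N \<Longrightarrow> F m n \<in> carrier G"
    using F unfolding balanced_map_def by auto
  interpret h: group_hom FA G "frag_lift G F"
    using frag_lift_hom[where S = "carrier M \<times> carrier N" and F = F, OF G Fc]
    by (auto simp: group_hom_def group_hom_axioms_def G.is_group)
  have ker: "subgroup (kernel FA G (frag_lift G F)) FA"
    by (rule h.subgroup_kernel)
  have d: "Poly_Mapping.keys (x - y) \<subseteq> S"
    if "Poly_Mapping.keys x \<subseteq> S" "Poly_Mapping.keys y \<subseteq> S" for x y :: "'m \<times> 'n \<Rightarrow>\<^sub>0 int" and S
    using that keys_diff[of x y] by blast
  let ?F = "\<lambda>p. F (fst p) (snd p)"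
  have of: "frag_lift G F (frag_of p) = ?F p" "?F p \<in> carrier G"
    if "p \<in> carrier M \<times> carrier N" for p
    using that Fc frag_lift_frag_of[OF G, of F "fst p" "snd p"] by auto
  have two: "frag_lift G F (frag_of p - frag_of q) = ?F p \<otimes>\<^bsub>G\<^esub> inv\<^bsub>G\<^esub> ?F q"
    if "p \<in> carrier M \<times> carrier N" "q \<in> carrier M \<times> carrier N" for p q
    using that of frag_lift_diff[where S = "carrier M \<times> carrier N" and F = F, OF G Fc, of "frag_of p" "frag_of q"]
    by simp
  have three: "frag_lift G F (frag_of p - frag_of q - frag_of r) = \<one>\<^bsub>G\<^esub>"
    if "p \<in> carrier M \<times> carrier N" "q \<in> carrier M \<times> carrier N" "r \<in> carrier M \<times> carrier N"
      and eq: "?F p = ?F q \<otimes>\<^bsub>G\<^esub> ?F r" for p q r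
  proof -
    have "Poly_Mapping.keys (frag_of p - frag_of q) \<subseteq> carrier M \<times> carrier N"
      using that keys_diff[of "frag_of p" "frag_of q"] by auto
    then have "frag_lift G F (frag_of p - frag_of q - frag_of r) =
        ?F p \<otimes>\<^bsub>G\<^esub> inv\<^bsub>G\<^esub> ?F q \<otimes>\<^bsub>G\<^esub> inv\<^bsub>G\<^esub> ?F r"
      using that of two[of p q] frag_lift_diff[where S = "carrier M \<times> carrier N" and F = F, OF G Fc,
          of "frag_of p - frag_of q" "frag_of r"]
      by simp
    also have "?F p \<otimes>\<^bsub>G\<^esub> inv\<^bsub>G\<^esub> ?F q = ?F r"
      using of[OF that(2)] of[OF that(3)]
      by (simp only: eq G.m_comm[of "?F q" "?F r"]) (simp add: G.m_assoc)
    finally show ?thesis using of[OF that(3)] by simp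
  qed
  have "balanced_relators R \<rho> l M N \<subseteq> kernel FA G (frag_lift G F)"
  proof
    fix x assume x: "x \<in> balanced_relators R \<rho> l M N"
    have "frag_lift G F x = \<one>\<^bsub>G\<^esub>"
      using x unfolding balanced_relators_def
    proof (elim UnE CollectE exE conjE)
      fix m m' n assume *: "x = frag_of (m \<oplus>\<^bsub>M\<^esub> m', n) - frag_of (m, n) - frag_of (m', n)"
        "m \<in> carrier M" "m' \<in> carrier M" "n \<in> carrier N"
      have "F (m \<oplus>\<^bsub>M\<^esub> m') n = F m n \<otimes>\<^bsub>G\<^esub> F m' n"
        using F * unfolding balanced_map_def by blast
      then show ?thesis
        unfolding *(1) using * three by simp
    next
      fix m n n' assume *: "x = frag_of (m, n \<oplus>\<^bsub>N\<^esub> n') - frag_of (m, n) - frag_of (m, n')"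
        "m \<in> carrier M" "n \<in> carrier N" "n' \<in> carrier N"
      have "F m (n \<oplus>\<^bsub>N\<^esub> n') = F m n \<otimes>\<^bsub>G\<^esub> F m n'"
        using F * unfolding balanced_map_def by blast
      then show ?thesis
        unfolding *(1) using * three by simp
    next
      fix m r n assume *: "x = frag_of (\<rho> m r, n) - frag_of (m, l r n)"
        "m \<in> carrier M" "r \<in> R" "n \<in> carrier N"
      have "F (\<rho> m r) n = F m (l r n)"
        using F * unfolding balanced_map_def by blast
      then show ?thesis
        unfolding *(1) using * two[of "(\<rho> m r, n)" "(m, l r n)"] Fc by (simp add: right_closed left_closed)
    qed
    then show "x \<in> kernel FA G (frag_lift G F)"
      using x relators_closed unfolding kernel_def by blast
  qed
  then have "Ker \<subseteq> kernel FA G (frag_lift G F)"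
    unfolding balanced_kernel_def using ker by (intro group.generate_subgroup_incl) auto
  then show ?thesis using assms unfolding kernel_def by blast
qed

lemma tensor_lift_coset:
  assumes "x \<in> carrier FA"
  shows "tensor_lift G F (Ker #>\<^bsub>FA\<^esub> x) = frag_lift G F x"
proof -
  interpret G: comm_group G by (rule G)
  have Fc: "\<And>m n. (m, n) \<in> carrier M \<times> carrier N \<Longrightarrow> F m n \<in> carrier G"
    using F unfolding balanced_map_def by auto
  interpret h: group_hom FA G "frag_lift G F"
    using frag_lift_hom[where S = "carrier M \<times> carrier N" and F = F, OF G Fc]
    by (auto simp: group_hom_def group_hom_axioms_def G.is_group)
  have "frag_lift G F y = frag_lift G F x" if "y \<in> Ker #>\<^bsub>FA\<^esub> x" for y
  proof -
    obtain k where k: "k \<in> Ker" "y = k + x"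
      using \<open>y \<in> _\<close> unfolding r_coset_def by auto
    then have "k \<in> carrier FA" using Ker_subgroup subgroup.mem_carrier by fastforce
    then show ?thesis
      using h.hom_mult[of k x] k assms frag_lift_kernel[OF k(1)] h.hom_closed[OF assms] by simp
  qed
  moreover have "x \<in> Ker #>\<^bsub>FA\<^esub> x"
    using assms Ker_subgroup by (intro group.rcos_self) auto
  ultimately have "frag_lift G F ` (Ker #>\<^bsub>FA\<^esub> x) = {frag_lift G F x}" by blast
  moreover have "tensor_lift G F (Ker #>\<^bsub>FA\<^esub> x) = the_elem (frag_lift G F ` (Ker #>\<^bsub>FA\<^esub> x))"
    unfolding tensor_lift_def frag_lift_def ..
  ultimately show ?thesis by simp
qed

lemma tensor_lift_hom: "tensor_lift G F \<in> hom BT G"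
proof -
  have Fc: "\<And>m n. (m, n) \<in> carrier M \<times> carrier N \<Longrightarrow> F m n \<in> carrier G"
    using F unfolding balanced_map_def by auto
  note h = frag_lift_hom[where S = "carrier M \<times> carrier N" and F = F, OF G Fc]
  show ?thesis
  proof (rule homI)
    fix t assume "t \<in> carrier BT"
    then show "tensor_lift G F t \<in> carrier G"
      using BT_carrier tensor_lift_coset hom_in_carrier[OF h] by auto
  next
    fix t u assume "t \<in> carrier BT" "u \<in> carrier BT"
    then obtain x y where *: "x \<in> carrier FA" "t = Ker #>\<^bsub>FA\<^esub> x" "y \<in> carrier FA" "u = Ker #>\<^bsub>FA\<^esub> y"
      using BT_carrier by auto
    have "x + y \<in> carrier FA"
      using * by (metis abelian_free_Abelian_group comm_group_def group.is_monoid monoid.m_closed mult_free_Abelian_group)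
    then show "tensor_lift G F (t \<otimes>\<^bsub>BT\<^esub> u) = tensor_lift G F t \<otimes>\<^bsub>G\<^esub> tensor_lift G F u"
      using * hom_mult[OF h *(1,3)] by (simp add: tensor_lift_coset flip: coset_add)
  qed
qed

lemma tensor_lift_pure:
  assumes "m \<in> carrier M" "n \<in> carrier N"
  shows "tensor_lift G F (bp m n) = F m n"
  using assms F frag_lift_frag_of[where F = F and m = m and n = n, OF G]
  by (simp add: balanced_pure_def tensor_lift_coset balanced_map_def)

end

end

section \<open>Linear and bilinear maps\<close>

lemma abelian_group_of_add_monoid:
  fixes P (structure)
  shows "comm_group (add_monoid P) \<Longrightarrow> abelian_group P"
  by (simp add: abelian_group_def abelian_group_axioms_def abelian_monoid_def comm_group_def)

lemma module_comm_group: "module K M \<Longrightarrow> comm_group (add_monoid M)"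
  using module.axioms(2) abelian_group.a_comm_group by blast

text \<open>
  The additive monoid of a module keeps the further fields of its record, so it has another type than the
  quotient group from which a tensor product is formed. The next two lemmas identify the two.
\<close>

lemma comm_group_same_operations:
  assumes "comm_group G" "carrier G' = carrier G" "(\<otimes>\<^bsub>G'\<^esub>) = (\<otimes>\<^bsub>G\<^esub>)" "\<one>\<^bsub>G'\<^esub> = \<one>\<^bsub>G\<^esub>"
  shows "comm_group G'"
proof -
  interpret G: comm_group G by fact
  show ?thesis
    by (rule comm_groupI) (use assms G.m_assoc G.m_comm G.l_inv_ex in auto)
qed

lemma tensor_lift_same_operations:
  assumes "carrier G' = carrier G" "(\<otimes>\<^bsub>G'\<^esub>) = (\<otimes>\<^bsub>G\<^esub>)" "\<one>\<^bsub>G'\<^esub> = \<one>\<^bsub>G\<^esub>"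
  shows "tensor_lift G' F = tensor_lift G F"
proof -
  have "inv\<^bsub>G'\<^esub> x = inv\<^bsub>G\<^esub> x" for x
    by (simp add: m_inv_def assms)
  then have "x [^]\<^bsub>G'\<^esub> (n :: int) = x [^]\<^bsub>G\<^esub> n" for x n
    by (simp add: int_pow_def nat_pow_def assms Let_def)
  then show ?thesis
    by (simp add: tensor_lift_def finprod_def assms fun_eq_iff)
qed

lemma linear_homI:
  assumes "\<And>x. x \<in> carrier M \<Longrightarrow> f x \<in> carrier N"
    and "\<And>x y. \<lbrakk>x \<in> carrier M; y \<in> carrier M\<rbrakk> \<Longrightarrow> f (x \<oplus>\<^bsub>M\<^esub> y) = f x \<oplus>\<^bsub>N\<^esub> f y"
    and "\<And>c x. \<lbrakk>c \<in> carrier K; x \<in> carrier M\<rbrakk> \<Longrightarrow> f (c \<odot>\<^bsub>M\<^esub> x) = c \<odot>\<^bsub>N\<^esub> f x"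
  shows "f \<in> linear_hom K M N"
  using assms unfolding linear_hom_def by (auto intro!: homI)

lemma linear_hom_closed: "\<lbrakk>f \<in> linear_hom K M N; x \<in> carrier M\<rbrakk> \<Longrightarrow> f x \<in> carrier N"
  unfolding linear_hom_def hom_def by auto

lemma linear_hom_add:
  "\<lbrakk>f \<in> linear_hom K M N; x \<in> carrier M; y \<in> carrier M\<rbrakk> \<Longrightarrow> f (x \<oplus>\<^bsub>M\<^esub> y) = f x \<oplus>\<^bsub>N\<^esub> f y"
  unfolding linear_hom_def hom_def by auto

lemma linear_hom_smult:
  "\<lbrakk>f \<in> linear_hom K M N; c \<in> carrier K; x \<in> carrier M\<rbrakk> \<Longrightarrow> f (c \<odot>\<^bsub>M\<^esub> x) = c \<odot>\<^bsub>N\<^esub> f x"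
  unfolding linear_hom_def by auto

lemma linear_hom_group_hom:
  assumes "module K M" "module K N" "f \<in> linear_hom K M N"
  shows "group_hom (add_monoid M) (add_monoid N) f"
proof -
  interpret M: module K M by fact
  interpret N: module K N by fact
  show ?thesis
    using assms(3) M.a_group N.a_group
    by (auto simp: group_hom_def group_hom_axioms_def linear_hom_def)
qed

lemma linear_hom_zero:
  assumes "module K M" "module K N" "f \<in> linear_hom K M N"
  shows "f \<zero>\<^bsub>M\<^esub> = \<zero>\<^bsub>N\<^esub>"
  using group_hom.hom_one[OF linear_hom_group_hom[OF assms]] by simp

lemma linear_hom_inv:
  assumes "module K M" "module K N" "f \<in> linear_hom K M N" "x \<in> carrier M"
  shows "f (\<ominus>\<^bsub>M\<^esub> x) = \<ominus>\<^bsub>N\<^esub> f x"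
  using group_hom.hom_inv[OF linear_hom_group_hom[OF assms(1-3)]] assms(4)
  by (simp add: a_inv_def)

lemma linear_hom_diff:
  assumes "module K M" "module K N" "f \<in> linear_hom K M N" "x \<in> carrier M" "y \<in> carrier M"
  shows "f (x \<ominus>\<^bsub>M\<^esub> y) = f x \<ominus>\<^bsub>N\<^esub> f y"
proof -
  interpret M: module K M by fact
  show ?thesis
    using assms linear_hom_inv[OF assms(1-3)]
    by (simp add: a_minus_def linear_hom_add[OF assms(3)])
qed

lemma linear_hom_ident: "(\<lambda>x. x) \<in> linear_hom K M M"
  by (rule linear_homI) auto

lemma linear_hom_comp:
  "\<lbrakk>f \<in> linear_hom K L M; g \<in> linear_hom K M N\<rbrakk> \<Longrightarrow> (\<lambda>x. g (f x)) \<in> linear_hom K L N"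
  by (rule linear_homI) (auto simp: linear_hom_closed linear_hom_add linear_hom_smult)

lemma linear_hom_pointwise_diff:
  assumes "module K N" "f \<in> linear_hom K M N" "g \<in> linear_hom K M N"
  shows "(\<lambda>x. f x \<ominus>\<^bsub>N\<^esub> g x) \<in> linear_hom K M N"
proof -
  interpret N: module K N by fact
  note [simp] = linear_hom_closed[OF assms(2)] linear_hom_closed[OF assms(3)]
  show ?thesis
    by (rule linear_homI)
       (simp_all add: linear_hom_add[OF assms(2)] linear_hom_add[OF assms(3)] N.a_ac N.minus_add
         linear_hom_smult[OF assms(2)] linear_hom_smult[OF assms(3)] N.smult_r_distr N.smult_r_minus a_minus_def)
qed

definition bilinear where
  "bilinear K M N P F \<longleftrightarrow>
     (\<forall>m\<in>carrier M. (\<lambda>n. F m n) \<in> linear_hom K N P) \<and>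
     (\<forall>n\<in>carrier N. (\<lambda>m. F m n) \<in> linear_hom K M P)"

lemma bilinearI:
  assumes "\<And>m. m \<in> carrier M \<Longrightarrow> (\<lambda>n. F m n) \<in> linear_hom K N P"
    and "\<And>n. n \<in> carrier N \<Longrightarrow> (\<lambda>m. F m n) \<in> linear_hom K M P"
  shows "bilinear K M N P F"
  using assms unfolding bilinear_def by blast

lemma bilinear_left: "\<lbrakk>bilinear K M N P F; n \<in> carrier N\<rbrakk> \<Longrightarrow> (\<lambda>m. F m n) \<in> linear_hom K M P"
  and bilinear_right: "\<lbrakk>bilinear K M N P F; m \<in> carrier M\<rbrakk> \<Longrightarrow> (\<lambda>n. F m n) \<in> linear_hom K N P"
  unfolding bilinear_def by blast+

lemma bilinear_closed:
  "\<lbrakk>bilinear K M N P F; m \<in> carrier M; n \<in> carrier N\<rbrakk> \<Longrightarrow> F m n \<in> carrier P"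
  using linear_hom_closed[OF bilinear_left] .

lemma bilinear_cong:
  assumes "bilinear K M N P F" "module K M" "module K N"
    and eq: "\<And>m n. \<lbrakk>m \<in> carrier M; n \<in> carrier N\<rbrakk> \<Longrightarrow> F m n = G m n"
  shows "bilinear K M N P G"
proof -
  interpret M: module K M by fact
  interpret N: module K N by fact
  have l: "G m n \<in> carrier P" "G (m \<oplus>\<^bsub>M\<^esub> m') n = G m n \<oplus>\<^bsub>P\<^esub> G m' n"
    "c \<in> carrier K \<Longrightarrow> G (c \<odot>\<^bsub>M\<^esub> m) n = c \<odot>\<^bsub>P\<^esub> G m n"
    if "m \<in> carrier M" "m' \<in> carrier M" "n \<in> carrier N" for m m' n c
    using that bilinear_closed[OF assms(1)] linear_hom_add[OF bilinear_left[OF assms(1)]]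
      linear_hom_smult[OF bilinear_left[OF assms(1)]]
    by (simp_all flip: eq)
  have r: "G m (n \<oplus>\<^bsub>N\<^esub> n') = G m n \<oplus>\<^bsub>P\<^esub> G m n'"
    "c \<in> carrier K \<Longrightarrow> G m (c \<odot>\<^bsub>N\<^esub> n) = c \<odot>\<^bsub>P\<^esub> G m n"
    if "m \<in> carrier M" "n' \<in> carrier N" "n \<in> carrier N" for m n n' c
    using that linear_hom_add[OF bilinear_right[OF assms(1)]]
      linear_hom_smult[OF bilinear_right[OF assms(1)]]
    by (simp_all flip: eq)
  show ?thesis
    by (intro bilinearI linear_homI) (use l r in auto)
qed

lemma bilinear_balanced_map:
  assumes "bilinear K M N P F"
  shows "balanced_map (carrier K) (\<lambda>m c. c \<odot>\<^bsub>M\<^esub> m) (\<lambda>c n. c \<odot>\<^bsub>N\<^esub> n) M N (add_monoid P) F"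
  unfolding balanced_map_def
  using bilinear_closed[OF assms] linear_hom_add[OF bilinear_left[OF assms]]
    linear_hom_add[OF bilinear_right[OF assms]] linear_hom_smult[OF bilinear_left[OF assms]]
    linear_hom_smult[OF bilinear_right[OF assms]]
  by simp


abbreviation lift_to where "lift_to P \<equiv> tensor_lift (add_monoid P)"

section \<open>Module structure on tensor products\<close>

locale balanced_module_pair = balanced_pair R \<rho> l M N + M: module K M
  for K :: "('k, 'w) ring_scheme" and R :: "'r set" and \<rho> :: "'m \<Rightarrow> 'r \<Rightarrow> 'm" and l :: "'r \<Rightarrow> 'n \<Rightarrow> 'n"
    and M :: "('k, 'm, 'x) module_scheme" and N :: "('n, 'y) ring_scheme" +
  assumes smult_right: "\<lbrakk>c \<in> carrier K; m \<in> carrier M; r \<in> R\<rbrakk> \<Longrightarrow> \<rho> (c \<odot>\<^bsub>M\<^esub> m) r = c \<odot>\<^bsub>M\<^esub> \<rho> m r"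
begin

lemma smult_balanced:
  assumes c: "c \<in> carrier K"
  shows "balanced_map R \<rho> l M N BT (\<lambda>m n. bp (c \<odot>\<^bsub>M\<^esub> m) n)"
  using pure_balanced c unfolding balanced_map_def
  by (simp add: M.smult_r_distr right_closed flip: smult_right)

text \<open>
  \<open>W\<close> is any record with these operations: it is instantiated both by \<open>tensor\<close>, which carries a product as well, and by
  the tensor product over a subalgebra.
\<close>

context
  fixes W :: "('k, ('m \<times> 'n \<Rightarrow>\<^sub>0 int) set, 'z) module_scheme"
  assumes W_carrier: "carrier W = carrier BT"
    and W_add: "(\<oplus>\<^bsub>W\<^esub>) = (\<otimes>\<^bsub>BT\<^esub>)"
    and W_zero: "\<zero>\<^bsub>W\<^esub> = \<one>\<^bsub>BT\<^esub>"
    and W_smult: "\<And>c t. c \<odot>\<^bsub>W\<^esub> t = tensor_lift BT (\<lambda>m n. bp (c \<odot>\<^bsub>M\<^esub> m) n) t"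
begin

lemma smult_hom: "c \<in> carrier K \<Longrightarrow> (\<lambda>t. c \<odot>\<^bsub>W\<^esub> t) \<in> hom BT BT"
  using tensor_lift_hom[OF BT_comm_group smult_balanced] unfolding W_smult by simp

lemma smult_pure:
  "\<lbrakk>c \<in> carrier K; m \<in> carrier M; n \<in> carrier N\<rbrakk> \<Longrightarrow> c \<odot>\<^bsub>W\<^esub> bp m n = bp (c \<odot>\<^bsub>M\<^esub> m) n"
  using tensor_lift_pure[OF BT_comm_group smult_balanced] unfolding W_smult by simp

lemma module_structure: "module K W"
proof -
  interpret BT: comm_group BT by (rule BT_comm_group)
  interpret W: abelian_group W
    by (rule abelian_group_of_add_monoid, rule comm_group_same_operations[OF BT_comm_group])
       (simp_all add: W_carrier W_add W_zero)
  have cl: "c \<odot>\<^bsub>W\<^esub> t \<in> carrier BT" if "c \<in> carrier K" "t \<in> carrier BT" for c t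
    using hom_in_carrier[OF smult_hom] that by blast
  have hadd: "c \<odot>\<^bsub>W\<^esub> (t \<otimes>\<^bsub>BT\<^esub> u) = (c \<odot>\<^bsub>W\<^esub> t) \<otimes>\<^bsub>BT\<^esub> (c \<odot>\<^bsub>W\<^esub> u)"
    if "c \<in> carrier K" "t \<in> carrier BT" "u \<in> carrier BT" for c t u
    using hom_mult[OF smult_hom] that by blast
  have 1: "(a \<oplus>\<^bsub>K\<^esub> b) \<odot>\<^bsub>W\<^esub> t = (a \<odot>\<^bsub>W\<^esub> t) \<otimes>\<^bsub>BT\<^esub> (b \<odot>\<^bsub>W\<^esub> t)"
    if "a \<in> carrier K" "b \<in> carrier K" "t \<in> carrier BT" for a b t
    using that(3)
  proof (induction rule: tensor_induct)
    case (pure m n)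
    then show ?case
      using that(1,2) pure_balanced unfolding balanced_map_def
      by (simp add: smult_pure M.smult_l_distr)
  next
    case (add t u)
    then show ?case using that(1,2) by (simp add: hadd cl BT.m_ac)
  qed
  have 2: "(a \<otimes>\<^bsub>K\<^esub> b) \<odot>\<^bsub>W\<^esub> t = a \<odot>\<^bsub>W\<^esub> (b \<odot>\<^bsub>W\<^esub> t)"
    if "a \<in> carrier K" "b \<in> carrier K" "t \<in> carrier BT" for a b t
    using that(3)
  proof (induction rule: tensor_induct)
    case (pure m n)
    then show ?case using that(1,2) by (simp add: smult_pure M.smult_assoc1)
  next
    case (add t u)
    then show ?case using that(1,2) by (simp add: hadd cl)
  qed
  have 3: "\<one>\<^bsub>K\<^esub> \<odot>\<^bsub>W\<^esub> t = t" if "t \<in> carrier BT" for t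
    using that
  proof (induction rule: tensor_induct)
    case (pure m n)
    then show ?case by (simp add: smult_pure)
  next
    case (add t u)
    then show ?case by (simp add: hadd)
  qed
  show ?thesis
    by (rule moduleI) (use 1 2 3 cl hadd M.R.cring_axioms W.abelian_group_axioms in \<open>auto simp: W_carrier W_add\<close>)
qed

lemma lift_linear_hom:
  assumes "module K P" "balanced_map R \<rho> l M N (add_monoid P) F"
    and "\<And>c m n. \<lbrakk>c \<in> carrier K; m \<in> carrier M; n \<in> carrier N\<rbrakk> \<Longrightarrow> F (c \<odot>\<^bsub>M\<^esub> m) n = c \<odot>\<^bsub>P\<^esub> F m n"
  shows "lift_to P F \<in> linear_hom K W P"
proof -
  interpret P: module K P by fact
  interpret W: module K W by (rule module_structure)
  have G: "comm_group (add_monoid P)" by (rule P.a_comm_group)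
  note h = tensor_lift_hom[OF G assms(2)] and p = tensor_lift_pure[OF G assms(2)]
  have cl: "lift_to P F t \<in> carrier P" if "t \<in> carrier BT" for t
    using hom_in_carrier[OF h that] by simp
  have hadd: "lift_to P F (t \<otimes>\<^bsub>BT\<^esub> u) =
      lift_to P F t \<oplus>\<^bsub>P\<^esub> lift_to P F u"
    if "t \<in> carrier BT" "u \<in> carrier BT" for t u
    using hom_mult[OF h that] by simp
  have "lift_to P F (c \<odot>\<^bsub>W\<^esub> t) = c \<odot>\<^bsub>P\<^esub> lift_to P F t"
    if "c \<in> carrier K" "t \<in> carrier BT" for c t
    using that(2)
  proof (induction rule: tensor_induct)
    case (pure m n)
    then show ?case using that(1) assms(3) by (simp add: smult_pure p)
  next
    case (add t u)
    have "c \<odot>\<^bsub>W\<^esub> (t \<otimes>\<^bsub>BT\<^esub> u) = (c \<odot>\<^bsub>W\<^esub> t) \<otimes>\<^bsub>BT\<^esub> (c \<odot>\<^bsub>W\<^esub> u)" "c \<odot>\<^bsub>W\<^esub> t \<in> carrier BT" "c \<odot>\<^bsub>W\<^esub> u \<in> carrier BT"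
      using hom_mult[OF smult_hom] hom_in_carrier[OF smult_hom] add(1,2) that(1) by blast+
    then show ?case using that(1) add by (simp add: hadd cl P.smult_r_distr)
  qed
  then show ?thesis
    by (intro linear_homI) (use cl hadd in \<open>auto simp: W_carrier W_add\<close>)
qed

end

end

section \<open>Tensor products over the ground ring\<close>

lemma tensor_simps:
  "carrier (tensor K M N) = carrier (ground_tensor_group K M N)"
  "(\<oplus>\<^bsub>tensor K M N\<^esub>) = (\<otimes>\<^bsub>ground_tensor_group K M N\<^esub>)"
  "\<zero>\<^bsub>tensor K M N\<^esub> = \<one>\<^bsub>ground_tensor_group K M N\<^esub>"
  "\<one>\<^bsub>tensor K M N\<^esub> = pure_tensor K M N \<one>\<^bsub>M\<^esub> \<one>\<^bsub>N\<^esub>"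
  "(\<odot>\<^bsub>tensor K M N\<^esub>) c t = tensor_lift (ground_tensor_group K M N) (\<lambda>m n. pure_tensor K M N (c \<odot>\<^bsub>M\<^esub> m) n) t"
  by (simp_all add: tensor_def Let_def)

lemma tensor_lift_ground:
  "tensor_lift (ground_tensor_group K M N) F = lift_to (tensor K M N) F"
  by (rule tensor_lift_same_operations) (simp_all add: tensor_simps)

lemma tensor_mult:
  "t \<otimes>\<^bsub>tensor K M N\<^esub> u = lift_to (tensor K M N) (\<lambda>m n.
     lift_to (tensor K M N) (\<lambda>m' n'.
         pure_tensor K M N (m \<otimes>\<^bsub>M\<^esub> m') (n \<otimes>\<^bsub>N\<^esub> n')) u) t"
proof -
  have "t \<otimes>\<^bsub>tensor K M N\<^esub> u = tensor_lift (ground_tensor_group K M N) (\<lambda>m n.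
     tensor_lift (ground_tensor_group K M N) (\<lambda>m' n'.
         pure_tensor K M N (m \<otimes>\<^bsub>M\<^esub> m') (n \<otimes>\<^bsub>N\<^esub> n')) u) t"
    by (simp add: tensor_def Let_def)
  then show ?thesis by (simp only: tensor_lift_ground)
qed

locale ground_pair = M: module K M + N: module K N
  for K :: "('k, 'w) ring_scheme" and M :: "('k, 'm, 'x) module_scheme" and N :: "('k, 'n, 'y) module_scheme"

sublocale ground_pair \<subseteq> bal: balanced_module_pair K "carrier K" "\<lambda>m c. c \<odot>\<^bsub>M\<^esub> m" "\<lambda>c n. c \<odot>\<^bsub>N\<^esub> n" M N
proof (intro_locales, unfold_locales)
  show "c \<odot>\<^bsub>M\<^esub> m \<in> carrier M" if "m \<in> carrier M" "c \<in> carrier K" for c m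
    using that by simp
  show "c \<odot>\<^bsub>N\<^esub> n \<in> carrier N" if "c \<in> carrier K" "n \<in> carrier N" for c n
    using that by simp
  show "r \<odot>\<^bsub>M\<^esub> (c \<odot>\<^bsub>M\<^esub> m) = c \<odot>\<^bsub>M\<^esub> (r \<odot>\<^bsub>M\<^esub> m)"
    if "c \<in> carrier K" "m \<in> carrier M" "r \<in> carrier K" for c m r
    using that by (metis M.R.m_comm M.smult_assoc1)
qed

context ground_pair
begin

abbreviation MN where "MN \<equiv> tensor K M N"
abbreviation tp where "tp \<equiv> pure_tensor K M N"

lemma ground_BT: "bal.BT = ground_tensor_group K M N"
  by (simp add: ground_tensor_group_def)

lemma ground_bp: "bal.bp = tp"
  by (simp add: pure_tensor_def fun_eq_iff)

lemma tensor_structure: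
  "carrier MN = carrier bal.BT"
  "(\<oplus>\<^bsub>MN\<^esub>) = (\<otimes>\<^bsub>bal.BT\<^esub>)"
  "\<zero>\<^bsub>MN\<^esub> = \<one>\<^bsub>bal.BT\<^esub>"
  "c \<odot>\<^bsub>MN\<^esub> t = tensor_lift bal.BT (\<lambda>m n. bal.bp (c \<odot>\<^bsub>M\<^esub> m) n) t"
  unfolding ground_BT ground_bp by (simp_all only: tensor_simps)

lemma tensor_module: "module K MN"
  by (rule bal.module_structure) (rule tensor_structure)+

lemma pure_bilinear: "bilinear K M N MN tp"
proof -
  note b = bal.pure_balanced[unfolded balanced_map_def, folded tensor_structure, unfolded ground_bp]
  have s: "tp (c \<odot>\<^bsub>M\<^esub> m) n = c \<odot>\<^bsub>MN\<^esub> tp m n"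
    if "c \<in> carrier K" "m \<in> carrier M" "n \<in> carrier N" for c m n
    using bal.smult_pure[OF tensor_structure that] by (simp add: ground_bp)
  moreover have "tp m (c \<odot>\<^bsub>N\<^esub> n) = c \<odot>\<^bsub>MN\<^esub> tp m n"
    if "c \<in> carrier K" "m \<in> carrier M" "n \<in> carrier N" for c m n
    using s[OF that] b that by simp
  moreover have "tp (m \<oplus>\<^bsub>M\<^esub> m') n = tp m n \<oplus>\<^bsub>MN\<^esub> tp m' n"
    if "m \<in> carrier M" "m' \<in> carrier M" "n \<in> carrier N" for m m' n
    using that b by simp
  moreover have "tp m (n \<oplus>\<^bsub>N\<^esub> n') = tp m n \<oplus>\<^bsub>MN\<^esub> tp m n'"
    if "m \<in> carrier M" "n \<in> carrier N" "n' \<in> carrier N" for m n n'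
    using that b by simp
  moreover have "tp m n \<in> carrier MN"
    if "m \<in> carrier M" "n \<in> carrier N" for m n
    using that b by simp
  ultimately show ?thesis
    by (intro bilinearI linear_homI)
qed

lemma pure_tensor_closed:
  "\<lbrakk>m \<in> carrier M; n \<in> carrier N\<rbrakk> \<Longrightarrow> tp m n \<in> carrier MN"
  using bilinear_closed[OF pure_bilinear] .

lemma ground_induct [consumes 1, case_names pure add]:
  assumes "t \<in> carrier MN"
    and "\<And>m n. \<lbrakk>m \<in> carrier M; n \<in> carrier N\<rbrakk> \<Longrightarrow> P (tp m n)"
    and "\<And>t u. \<lbrakk>t \<in> carrier MN; u \<in> carrier MN; P t; P u\<rbrakk>
          \<Longrightarrow> P (t \<oplus>\<^bsub>MN\<^esub> u)"
  shows "P t"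
  using bal.tensor_induct[of t P] assms unfolding tensor_structure ground_bp by blast

lemma linear_ext:
  assumes "f \<in> linear_hom K MN P" "g \<in> linear_hom K MN P"
    and "\<And>m n. \<lbrakk>m \<in> carrier M; n \<in> carrier N\<rbrakk> \<Longrightarrow> f (tp m n) = g (tp m n)"
    and "t \<in> carrier MN"
  shows "f t = g t"
  using assms(4)
  by (induction rule: ground_induct)
     (simp_all add: assms(3) linear_hom_add[OF assms(1)] linear_hom_add[OF assms(2)])

context
  fixes P :: "('k, 'p, 'z) module_scheme" and F
  assumes P: "module K P" and F: "bilinear K M N P F"
begin

lemma lift_linear: "lift_to P F \<in> linear_hom K MN P"
  by (rule bal.lift_linear_hom[OF tensor_structure P bilinear_balanced_map[OF F]])
     (rule linear_hom_smult[OF bilinear_left[OF F]])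

lemma lift_pure:
  "\<lbrakk>m \<in> carrier M; n \<in> carrier N\<rbrakk> \<Longrightarrow> lift_to P F (tp m n) = F m n"
  using bal.tensor_lift_pure[OF module.axioms(2)[OF P, THEN abelian_group.a_comm_group] bilinear_balanced_map[OF F]]
  unfolding ground_bp .

lemma lift_closed: "t \<in> carrier MN \<Longrightarrow> lift_to P F t \<in> carrier P"
  using linear_hom_closed[OF lift_linear] .

lemma bilinear_comp: "\<phi> \<in> linear_hom K P P' \<Longrightarrow> bilinear K M N P' (\<lambda>m n. \<phi> (F m n))"
  by (rule bilinearI; rule linear_hom_comp[where M = P])
     (rule bilinear_left[OF F] bilinear_right[OF F], assumption+)+

lemma lift_comp:
  assumes "\<phi> \<in> linear_hom K P P'" "module K P'" "t \<in> carrier MN"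
  shows "\<phi> (lift_to P F t) = lift_to P' (\<lambda>m n. \<phi> (F m n)) t"
proof -
  interpret c: ground_pair K M N by unfold_locales
  show ?thesis
    using assms(3)
  proof (induction rule: ground_induct)
    case (pure m n)
    have "lift_to P' (\<lambda>m n. \<phi> (F m n)) (tp m n) = \<phi> (F m n)"
      using bal.tensor_lift_pure[OF module.axioms(2)[OF assms(2), THEN abelian_group.a_comm_group]
          bilinear_balanced_map[OF bilinear_comp[OF assms(1)]] pure]
      unfolding ground_bp .
    then show ?case using pure lift_pure by simp
  next
    case (add t u)
    have "(\<lambda>t. lift_to P' (\<lambda>m n. \<phi> (F m n)) t) \<in> linear_hom K MN P'"
      by (rule bal.lift_linear_hom[OF tensor_structure assms(2) bilinear_balanced_map[OF bilinear_comp[OF assms(1)]]])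
         (rule linear_hom_smult[OF bilinear_left[OF bilinear_comp[OF assms(1)]]])
    then show ?case
      using add by (simp add: linear_hom_add linear_hom_add[OF lift_linear] linear_hom_add[OF assms(1)] lift_closed)
  qed
qed

end

lemma lift_pure_self: "t \<in> carrier MN \<Longrightarrow> lift_to MN tp t = t"
  by (rule linear_ext[OF lift_linear[OF tensor_module pure_bilinear] linear_hom_ident])
     (simp_all add: lift_pure[OF tensor_module pure_bilinear])

text \<open>
  Used to expand \<open>\<phi>(\<delta>(b))\<close> as a sum over the terms \<open>b\<^sub>0 \<otimes> b\<^sub>1\<close> of \<open>\<delta>(b)\<close>.
\<close>

lemma lift_unique:
  assumes "module K P" "\<phi> \<in> linear_hom K MN P" "t \<in> carrier MN"
  shows "\<phi> t = lift_to P (\<lambda>m n. \<phi> (tp m n)) t"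
  using lift_comp[OF tensor_module pure_bilinear assms(2,1,3)] lift_pure_self[OF assms(3)] by simp

lemma lift_cong:
  assumes "module K P" "bilinear K M N P F" "t \<in> carrier MN"
    and eq: "\<And>m n. \<lbrakk>m \<in> carrier M; n \<in> carrier N\<rbrakk> \<Longrightarrow> F m n = G m n"
  shows "lift_to P F t = lift_to P G t"
proof -
  have G: "bilinear K M N P G"
    using bilinear_cong[OF assms(2) M.module_axioms N.module_axioms eq] by blast
  show ?thesis
    by (rule linear_ext[OF lift_linear[OF assms(1,2)] lift_linear[OF assms(1) G] _ assms(3)])
       (simp add: lift_pure[OF assms(1,2)] lift_pure[OF assms(1) G] eq)
qed

lemma lift_param_linear:
  assumes P: "module K P" and L: "module K L"
    and "\<And>m n. \<lbrakk>m \<in> carrier M; n \<in> carrier N\<rbrakk> \<Longrightarrow> (\<lambda>x. F x m n) \<in> linear_hom K L P"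
    and F: "\<And>x. x \<in> carrier L \<Longrightarrow> bilinear K M N P (F x)"
    and "t \<in> carrier MN"
  shows "(\<lambda>x. lift_to P (F x) t) \<in> linear_hom K L P"
proof -
  interpret P: module K P by fact
  interpret L: module K L by fact
  have c: "lift_to P (F x) t \<in> carrier P"
    if "x \<in> carrier L" "t \<in> carrier MN" for x t
    using lift_closed[OF P F] that .
  have d: "lift_to P (F x) (t \<oplus>\<^bsub>MN\<^esub> u) =
     lift_to P (F x) t \<oplus>\<^bsub>P\<^esub> lift_to P (F x) u"
    if "x \<in> carrier L" "t \<in> carrier MN" "u \<in> carrier MN" for x t u
    using linear_hom_add[OF lift_linear[OF P F]] that .
  have 1: "lift_to P (F (x \<oplus>\<^bsub>L\<^esub> y)) t =
     lift_to P (F x) t \<oplus>\<^bsub>P\<^esub> lift_to P (F y) t"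
    if "x \<in> carrier L" "y \<in> carrier L" for x y
    using assms(5)
  proof (induction rule: ground_induct)
    case (pure m n)
    then show ?case using that linear_hom_add[OF assms(3)] by (simp add: lift_pure[OF P F])
  next
    case (add t u)
    then show ?case using that by (simp add: d c P.a_ac)
  qed
  have 2: "lift_to P (F (k \<odot>\<^bsub>L\<^esub> x)) t = k \<odot>\<^bsub>P\<^esub> lift_to P (F x) t"
    if "k \<in> carrier K" "x \<in> carrier L" for x k
    using assms(5)
  proof (induction rule: ground_induct)
    case (pure m n)
    then show ?case using that linear_hom_smult[OF assms(3)] by (simp add: lift_pure[OF P F])
  next
    case (add t u)
    then show ?case using that by (simp add: d c P.smult_r_distr)
  qed
  show ?thesis
    by (rule linear_homI) (use 1 2 c assms(5) in auto)
qed

end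

lemma ground_pairI: "\<lbrakk>module K M; module K N\<rbrakk> \<Longrightarrow> ground_pair K M N"
  by (simp add: ground_pair_def)

lemmas lift_tensor_pure = ground_pair.lift_pure[OF ground_pairI]

section \<open>Linearity of composite expressions\<close>

lemma linear_pure_left:
  assumes "f \<in> linear_hom K L M" "module K M" "module K N" "n \<in> carrier N"
  shows "(\<lambda>x. pure_tensor K M N (f x) n) \<in> linear_hom K L (tensor K M N)"
  by (rule linear_hom_comp[OF assms(1) bilinear_left[OF ground_pair.pure_bilinear[OF ground_pairI[OF assms(2,3)]] assms(4)]])

lemma linear_pure_right:
  assumes "f \<in> linear_hom K L N" "module K M" "module K N" "m \<in> carrier M"
  shows "(\<lambda>x. pure_tensor K M N m (f x)) \<in> linear_hom K L (tensor K M N)"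
  by (rule linear_hom_comp[OF assms(1) bilinear_right[OF ground_pair.pure_bilinear[OF ground_pairI[OF assms(2,3)]] assms(4)]])

lemma linear_lift_arg:
  assumes "f \<in> linear_hom K L (tensor K M N)" "module K M" "module K N" "module K P" "bilinear K M N P F"
  shows "(\<lambda>x. lift_to P F (f x)) \<in> linear_hom K L P"
  by (rule linear_hom_comp[OF assms(1) ground_pair.lift_linear[OF ground_pairI[OF assms(2,3)] assms(4,5)]])

lemma linear_lift_fun:
  assumes t: "t \<in> carrier (tensor K M N)" and "module K M" "module K N" "module K P" "module K L"
    and "\<And>m n. \<lbrakk>m \<in> carrier M; n \<in> carrier N\<rbrakk> \<Longrightarrow> (\<lambda>x. F x m n) \<in> linear_hom K L P"
    and "\<And>x. x \<in> carrier L \<Longrightarrow> bilinear K M N P (F x)"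
  shows "(\<lambda>x. lift_to P (\<lambda>m n. F x m n) t) \<in> linear_hom K L P"
  by (rule ground_pair.lift_param_linear[OF ground_pairI[OF assms(2,3)] assms(4,5)]) (use assms in auto)

lemma algebra_mult_bilinear:
  assumes "unital_algebra K A"
  shows "bilinear K A A A (\<lambda>x y. x \<otimes>\<^bsub>A\<^esub> y)"
proof -
  interpret A: unital_algebra K A by fact
  show ?thesis
    by (intro bilinearI linear_homI)
       (auto simp: A.l_distr A.r_distr A.smult_mult_left A.smult_mult_right)
qed

lemma linear_mult_left:
  assumes "f \<in> linear_hom K L A" "unital_algebra K A" "a \<in> carrier A"
  shows "(\<lambda>x. f x \<otimes>\<^bsub>A\<^esub> a) \<in> linear_hom K L A"
  by (rule linear_hom_comp[OF assms(1) bilinear_left[OF algebra_mult_bilinear[OF assms(2)] assms(3)]])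

lemma linear_mult_right:
  assumes "f \<in> linear_hom K L A" "unital_algebra K A" "a \<in> carrier A"
  shows "(\<lambda>x. a \<otimes>\<^bsub>A\<^esub> f x) \<in> linear_hom K L A"
  by (rule linear_hom_comp[OF assms(1) bilinear_right[OF algebra_mult_bilinear[OF assms(2)] assms(3)]])

lemma linear_smult_const:
  assumes "f \<in> linear_hom K L M" "module K M" "c \<in> carrier K"
  shows "(\<lambda>x. c \<odot>\<^bsub>M\<^esub> f x) \<in> linear_hom K L M"
proof -
  interpret M: module K M by fact
  note [simp] = linear_hom_closed[OF assms(1)]
  show ?thesis
    by (rule linear_homI)
       (use assms(3) in \<open>auto simp: linear_hom_add[OF assms(1)] linear_hom_smult[OF assms(1)] M.smult_r_distr
         M.R.m_comm simp flip: M.smult_assoc1\<close>)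
qed

text \<open>
  An expression is linear in a variable that occurs in it once, below linear operations only. These rules follow the
  variable down to its occurrence, so that linearity is read off from the shape of the expression.
\<close>

lemmas linear_intros =
  bilinearI linear_hom_ident linear_pure_left linear_pure_right linear_mult_left linear_mult_right
  linear_smult_const linear_lift_arg linear_lift_fun

lemma tensor_module: "\<lbrakk>module K M; module K N\<rbrakk> \<Longrightarrow> module K (tensor K M N)"
  using ground_pair.tensor_module[OF ground_pairI] .

lemma pure_closed:
  "\<lbrakk>module K M; module K N; m \<in> carrier M; n \<in> carrier N\<rbrakk> \<Longrightarrow> pure_tensor K M N m n \<in> carrier (tensor K M N)"
  using ground_pair.pure_tensor_closed[OF ground_pairI] .

lemma tensor_map_linear:
  assumes "module K M" "module K N" "module K M'" "module K N'"
    and "f \<in> linear_hom K M M'" "g \<in> linear_hom K N N'"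
  shows "tensor_map K M' N' f g \<in> linear_hom K (tensor K M N) (tensor K M' N')"
proof -
  have "(\<lambda>t. tensor_map K M' N' f g t) \<in> linear_hom K (tensor K M N) (tensor K M' N')"
    unfolding tensor_map_def
    by (rule linear_intros assms tensor_module linear_hom_closed[OF assms(5)] linear_hom_closed[OF assms(6)]
        | assumption)+
  then show ?thesis by simp
qed

lemma tensor_map_pure:
  assumes "module K M" "module K N" "module K M'" "module K N'"
    and "f \<in> linear_hom K M M'" "g \<in> linear_hom K N N'" "m \<in> carrier M" "n \<in> carrier N"
  shows "tensor_map K M' N' f g (pure_tensor K M N m n) = pure_tensor K M' N' (f m) (g n)"
  unfolding tensor_map_def
  by (rule lift_tensor_pure linear_intros assms tensor_module linear_hom_closed[OF assms(5)]
        linear_hom_closed[OF assms(6)] | assumption)+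

section \<open>The tensor product of two algebras\<close>

locale algebra_pair = A: unital_algebra K A + B: unital_algebra K B
  for K :: "('k, 'w) ring_scheme" and A :: "('k, 'a, 'x) module_scheme" and B :: "('k, 'b, 'y) module_scheme"
begin

abbreviation AB where "AB \<equiv> tensor K A B"
abbreviation pt where "pt \<equiv> pure_tensor K A B"

lemma mods: "module K A" "module K B" "module K AB"
  using A.module_axioms B.module_axioms tensor_module by blast+

lemma algs: "unital_algebra K A" "unital_algebra K B"
  by (rule A.unital_algebra_axioms B.unital_algebra_axioms)+

sublocale ground_pair K A B
  by (rule ground_pairI[OF mods(1,2)])

lemma pt_mult_bilinear:
  assumes "a \<in> carrier A" "b \<in> carrier B"
  shows "bilinear K A B AB (\<lambda>a' b'. pt (a \<otimes>\<^bsub>A\<^esub> a') (b \<otimes>\<^bsub>B\<^esub> b'))"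
  by (rule linear_intros mods algs assms A.m_closed B.m_closed | assumption)+

lemma tensor_mult_bilinear: "bilinear K AB AB AB (\<lambda>t u. t \<otimes>\<^bsub>AB\<^esub> u)"
  unfolding tensor_mult
  by (rule linear_intros mods algs A.m_closed B.m_closed | assumption)+

lemma tensor_mult_pure:
  assumes "a \<in> carrier A" "b \<in> carrier B" "a' \<in> carrier A" "b' \<in> carrier B"
  shows "pt a b \<otimes>\<^bsub>AB\<^esub> pt a' b' = pt (a \<otimes>\<^bsub>A\<^esub> a') (b \<otimes>\<^bsub>B\<^esub> b')"
proof -
  have "pt a b \<otimes>\<^bsub>AB\<^esub> pt a' b' =
     lift_to AB (\<lambda>m' n'. pt (a \<otimes>\<^bsub>A\<^esub> m') (b \<otimes>\<^bsub>B\<^esub> n')) (pt a' b')"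
    unfolding tensor_mult
    by (rule lift_pure mods assms linear_intros algs A.m_closed B.m_closed pure_tensor_closed | assumption)+
  also have "\<dots> = pt (a \<otimes>\<^bsub>A\<^esub> a') (b \<otimes>\<^bsub>B\<^esub> b')"
    by (intro lift_pure mods assms pt_mult_bilinear)
  finally show ?thesis .
qed

text \<open>
  Associativity is checked on pure tensors, for one factor at a time.
\<close>

lemma tensor_algebra: "unital_algebra K AB"
proof -
  interpret AB: module K AB by (rule mods)
  have one: "\<one>\<^bsub>AB\<^esub> = pt \<one>\<^bsub>A\<^esub> \<one>\<^bsub>B\<^esub>" by (rule tensor_simps)
  note bl = tensor_mult_bilinear
  note cl = bilinear_closed[OF bl] and la = linear_hom_add[OF bilinear_left[OF bl]]
    and ra = linear_hom_add[OF bilinear_right[OF bl]] and ls = linear_hom_smult[OF bilinear_left[OF bl]]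
    and rs = linear_hom_smult[OF bilinear_right[OF bl]]
  have assoc1: "(pt a b \<otimes>\<^bsub>AB\<^esub> pt a' b') \<otimes>\<^bsub>AB\<^esub> v = pt a b \<otimes>\<^bsub>AB\<^esub> (pt a' b' \<otimes>\<^bsub>AB\<^esub> v)"
    if "a \<in> carrier A" "b \<in> carrier B" "a' \<in> carrier A" "b' \<in> carrier B" "v \<in> carrier AB" for a b a' b' v
    using that(5)
  proof (induction rule: ground_induct)
    case (pure m n)
    then show ?case using that by (simp add: tensor_mult_pure A.m_assoc B.m_assoc)
  next
    case (add t u)
    then show ?case using that by (simp add: ra cl pure_tensor_closed)
  qed
  have assoc2: "(pt a b \<otimes>\<^bsub>AB\<^esub> u) \<otimes>\<^bsub>AB\<^esub> v = pt a b \<otimes>\<^bsub>AB\<^esub> (u \<otimes>\<^bsub>AB\<^esub> v)"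
    if "a \<in> carrier A" "b \<in> carrier B" "u \<in> carrier AB" "v \<in> carrier AB" for a b u v
    using that(3)
  proof (induction rule: ground_induct)
    case (pure m n)
    then show ?case using that assoc1 by simp
  next
    case (add t u)
    then show ?case using that by (simp add: ra la cl pure_tensor_closed)
  qed
  have assoc: "(t \<otimes>\<^bsub>AB\<^esub> u) \<otimes>\<^bsub>AB\<^esub> v = t \<otimes>\<^bsub>AB\<^esub> (u \<otimes>\<^bsub>AB\<^esub> v)"
    if "t \<in> carrier AB" "u \<in> carrier AB" "v \<in> carrier AB" for t u v
    using that(1)
  proof (induction rule: ground_induct)
    case (pure m n)
    then show ?case using that assoc2 by simp
  next
    case (add t w)
    then show ?case using that by (simp add: la cl)
  qed
  have l1: "\<one>\<^bsub>AB\<^esub> \<otimes>\<^bsub>AB\<^esub> t = t" if "t \<in> carrier AB" for t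
    unfolding one using that
    by (induction rule: ground_induct) (simp_all add: tensor_mult_pure ra cl pure_tensor_closed)
  have r1: "t \<otimes>\<^bsub>AB\<^esub> \<one>\<^bsub>AB\<^esub> = t" if "t \<in> carrier AB" for t
    unfolding one using that
    by (induction rule: ground_induct) (simp_all add: tensor_mult_pure la cl pure_tensor_closed)
  have "ring AB"
    by (intro ringI monoidI) (use AB.abelian_group_axioms assoc l1 r1 cl la ra in \<open>auto simp: one pure_tensor_closed\<close>)
  then show ?thesis
    unfolding unital_algebra_def unital_algebra_axioms_def
    using mods(3) ls rs by auto
qed

end

lemma algebra_pairI: "\<lbrakk>unital_algebra K A; unital_algebra K B\<rbrakk> \<Longrightarrow> algebra_pair K A B"
  by (simp add: algebra_pair_def)

section \<open>Linear algebra over a field\<close>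

lemma submodule_diff:
  fixes V (structure)
  assumes "module K V" "submodule U K V" "x \<in> U" "y \<in> U"
  shows "x \<ominus> y \<in> U"
  using module.submoduleE(3,5)[OF assms(1,2)] assms(3,4) by (simp add: a_minus_def)

lemma submodule_zero:
  fixes V (structure)
  assumes "module K V" "submodule U K V"
  shows "\<zero> \<in> U"
  using assms(2) subgroup.one_closed[of U "add_monoid V"] by (simp add: submodule_def)

lemma diff_zero_iff:
  fixes V (structure)
  assumes "module K V" "x \<in> carrier V" "y \<in> carrier V"
  shows "x \<ominus> y = \<zero> \<longleftrightarrow> x = y"
proof -
  interpret V: module K V by fact
  show ?thesis
  proof
    assume "x \<ominus> y = \<zero>"
    then have "(x \<oplus> \<ominus> y) \<oplus> y = y" using assms by (simp add: a_minus_def)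
    then show "x = y" using assms by (simp add: V.a_assoc V.l_neg)
  qed (use assms in \<open>simp add: a_minus_def V.r_neg\<close>)
qed

text \<open>
  A submodule \<open>W\<close> that is maximal among those meeting \<open>U\<close> only in \<open>0\<close> is a complement. If \<open>v\<close> were outside \<open>U + W\<close>,
  then \<open>W + K v\<close> would still meet \<open>U\<close> only in \<open>0\<close>: a relation \<open>u = w + c v\<close> with \<open>c \<noteq> 0\<close> can be divided by \<open>c\<close> and
  solved for \<open>v\<close>.
\<close>

lemma exists_complement:
  fixes V (structure)
  assumes "field K" "module K V" "submodule U K V"
  obtains W where "submodule W K V" "W \<inter> U = {\<zero>}"
    "\<And>v. v \<in> carrier V \<Longrightarrow> \<exists>u\<in>U. \<exists>w\<in>W. v = u \<oplus> w"
proof -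
  interpret field K by fact
  interpret V: module K V by fact
  note E = V.submoduleE
  have U0: "\<zero> \<in> U" by (rule submodule_zero[OF assms(2,3)])
  define \<W> where "\<W> = {W. submodule W K V \<and> W \<inter> U = {\<zero>}}"
  have "\<exists>W\<in>\<W>. \<forall>S\<in>\<W>. W \<subseteq> S \<longrightarrow> S = W"
  proof (rule subset_Zorn_nonempty)
    have "submodule {\<zero>} K V"
      by (rule V.submoduleI) auto
    then show "\<W> \<noteq> {}" unfolding \<W>_def using U0 by auto
  next
    fix \<C> assume ne: "\<C> \<noteq> {}" and chain: "subset.chain \<W> \<C>"
    have sub: "submodule S K V" "S \<inter> U = {\<zero>}" if "S \<in> \<C>" for S
      using chain that unfolding subset.chain_def \<W>_def by auto
    have add: "x \<oplus> y \<in> \<Union>\<C>" if "x \<in> \<Union>\<C>" "y \<in> \<Union>\<C>" for x y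
    proof -
      obtain S Y where SY: "S \<in> \<C>" "x \<in> S" "Y \<in> \<C>" "y \<in> Y" using \<open>x \<in> \<Union>\<C>\<close> \<open>y \<in> \<Union>\<C>\<close> by auto
      then have "S \<subseteq> Y \<or> Y \<subseteq> S" using chain unfolding subset.chain_def by blast
      then show ?thesis using SY E(5)[OF sub(1)] by blast
    qed
    have "submodule (\<Union>\<C>) K V"
    proof (rule V.submoduleI)
      show "\<Union>\<C> \<subseteq> carrier V" using E(1)[OF sub(1)] by blast
      show "\<zero> \<in> \<Union>\<C>" using ne sub(2) by blast
      show "\<ominus> a \<in> \<Union>\<C>" if "a \<in> \<Union>\<C>" for a using that E(3)[OF sub(1)] by blast
      show "c \<odot> a \<in> \<Union>\<C>" if "c \<in> carrier K" "a \<in> \<Union>\<C>" for a c using that E(4)[OF sub(1)] by blast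
    qed (rule add)
    then show "\<Union>\<C> \<in> \<W>" unfolding \<W>_def using sub(2) ne by blast
  qed
  then obtain W where WW: "W \<in> \<W>" and max': "\<forall>S\<in>\<W>. W \<subseteq> S \<longrightarrow> S = W"
    by (rule bexE)
  have W: "submodule W K V" "W \<inter> U = {\<zero>}"
    using WW unfolding \<W>_def by simp_all
  have max: "S = W" if "submodule S K V" "S \<inter> U = {\<zero>}" "W \<subseteq> S" for S
    using max' that unfolding \<W>_def by simp
  have Uc: "u \<in> carrier V" if "u \<in> U" for u using E(1)[OF assms(3)] that by blast
  have Wc: "w \<in> carrier V" if "w \<in> W" for w using E(1)[OF W(1)] that by blast
  have W0: "\<zero> \<in> W" by (rule submodule_zero[OF assms(2) W(1)])
  have "\<exists>u\<in>U. \<exists>w\<in>W. v = u \<oplus> w" if v: "v \<in> carrier V" for v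
  proof (rule ccontr)
    assume no: "\<not> ?thesis"
    define S where "S = {w \<oplus> c \<odot> v | w c. w \<in> W \<and> c \<in> carrier K}"
    have SI: "w \<oplus> c \<odot> v \<in> S" if "w \<in> W" "c \<in> carrier K" for w c
      unfolding S_def using that by blast
    have "submodule S K V"
    proof (rule V.submoduleI)
      show "S \<subseteq> carrier V" unfolding S_def using Wc v by auto
      show "\<zero> \<in> S" using SI[OF W0 zero_closed] v by simp
    next
      fix a assume "a \<in> S"
      then obtain w c where a: "w \<in> W" "c \<in> carrier K" "a = w \<oplus> c \<odot> v" unfolding S_def by blast
      have "\<ominus> a = \<ominus> w \<oplus> (\<ominus>\<^bsub>K\<^esub> c) \<odot> v"
        using a Wc v by (simp add: V.smult_l_minus V.minus_add)
      then show "\<ominus> a \<in> S" using SI[OF E(3)[OF W(1) a(1)], of "\<ominus>\<^bsub>K\<^esub> c"] a by simp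
      fix d assume d: "d \<in> carrier K"
      have "d \<odot> a = d \<odot> w \<oplus> (d \<otimes>\<^bsub>K\<^esub> c) \<odot> v"
        using a Wc v d by (simp add: V.smult_r_distr V.smult_assoc1)
      then show "d \<odot> a \<in> S" using SI[OF E(4)[OF W(1) d a(1)], of "d \<otimes>\<^bsub>K\<^esub> c"] a d by simp
    next
      fix a b assume "a \<in> S" "b \<in> S"
      then obtain w c w' c' where a: "w \<in> W" "c \<in> carrier K" "a = w \<oplus> c \<odot> v"
        and b: "w' \<in> W" "c' \<in> carrier K" "b = w' \<oplus> c' \<odot> v" unfolding S_def by blast
      have "a \<oplus> b = (w \<oplus> w') \<oplus> (c \<oplus>\<^bsub>K\<^esub> c') \<odot> v"
        using a b Wc v by (simp add: V.smult_l_distr V.a_ac)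
      then show "a \<oplus> b \<in> S" using SI[OF E(5)[OF W(1) a(1) b(1)], of "c \<oplus>\<^bsub>K\<^esub> c'"] a b by simp
    qed
    moreover have "S \<inter> U = {\<zero>}"
    proof -
      have "x = \<zero>" if x: "x \<in> S" "x \<in> U" for x
      proof -
        obtain w c where a: "w \<in> W" "c \<in> carrier K" "x = w \<oplus> c \<odot> v" using x(1) unfolding S_def by blast
        show ?thesis
        proof (cases "c = \<zero>\<^bsub>K\<^esub>")
          case True
          then have "x = w" using a v Wc by simp
          then show ?thesis using W(2) a(1) x(2) by blast
        next
          case False
          then have ci: "inv\<^bsub>K\<^esub> c \<in> carrier K" "inv\<^bsub>K\<^esub> c \<otimes>\<^bsub>K\<^esub> c = \<one>\<^bsub>K\<^esub>"
            using a(2) by (auto simp: field_Units)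
          have eq: "c \<odot> v = x \<oplus> \<ominus> w"
            using a v Wc by (simp add: V.a_ac V.r_neg1 V.r_neg2 V.r_neg)
          have "inv\<^bsub>K\<^esub> c \<odot> (c \<odot> v) = inv\<^bsub>K\<^esub> c \<odot> x \<oplus> inv\<^bsub>K\<^esub> c \<odot> (\<ominus> w)"
            unfolding eq by (rule V.smult_r_distr) (use ci(1) Wc[OF a(1)] Uc[OF x(2)] in auto)
          then have "v = inv\<^bsub>K\<^esub> c \<odot> x \<oplus> inv\<^bsub>K\<^esub> c \<odot> (\<ominus> w)"
            using ci a v by (simp flip: V.smult_assoc1)
          then have False
            using no E(4)[OF assms(3) ci(1) x(2)] E(4)[OF W(1) ci(1) E(3)[OF W(1) a(1)]] by blast
          then show ?thesis ..
        qed
      qed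
      moreover have "\<zero> \<in> S" using SI[OF W0 zero_closed] v by simp
      ultimately show ?thesis using U0 by blast
    qed
    moreover have "W \<subseteq> S"
    proof
      fix w assume "w \<in> W"
      then show "w \<in> S" using SI[OF _ zero_closed, of w] v Wc by simp
    qed
    ultimately have "S = W" using max by blast
    moreover have "v \<in> S" using SI[OF W0 one_closed] v by simp
    ultimately have "v \<in> W" by simp
    then show False using no U0 v by (metis V.l_zero)
  qed
  then show thesis using that W by blast
qed

lemma exists_projection:
  fixes V (structure)
  assumes "field K" "module K V" "submodule U K V"
  obtains p where "p \<in> linear_hom K V V" "\<And>v. v \<in> carrier V \<Longrightarrow> p v \<in> U" "\<And>u. u \<in> U \<Longrightarrow> p u = u"
proof -
  interpret V: module K V by fact
  note E = V.submoduleE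
  obtain W where W: "submodule W K V" "W \<inter> U = {\<zero>}"
    and dec: "\<And>v. v \<in> carrier V \<Longrightarrow> \<exists>u\<in>U. \<exists>w\<in>W. v = u \<oplus> w"
    using exists_complement[OF assms] by blast
  have Uc: "u \<in> carrier V" if "u \<in> U" for u using E(1)[OF assms(3)] that by blast
  have Wc: "w \<in> carrier V" if "w \<in> W" for w using E(1)[OF W(1)] that by blast
  define p where "p v = (SOME u. u \<in> U \<and> (\<exists>w\<in>W. v = u \<oplus> w))" for v
  have p: "p (u \<oplus> w) = u" if u: "u \<in> U" and w: "w \<in> W" for u w
  proof -
    have "\<exists>u'. u' \<in> U \<and> (\<exists>w'\<in>W. u \<oplus> w = u' \<oplus> w')" using u w by blast
    from someI_ex[OF this] obtain w' where w': "p (u \<oplus> w) \<in> U" "w' \<in> W"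
      "u \<oplus> w = p (u \<oplus> w) \<oplus> w'" unfolding p_def by blast
    define u' where "u' = p (u \<oplus> w)"
    have c: "u \<in> carrier V" "u' \<in> carrier V" "w \<in> carrier V" "w' \<in> carrier V"
      using Uc Wc u w w' by (auto simp: u'_def)
    have eq: "u \<oplus> w = u' \<oplus> w'" using w' by (simp add: u'_def)
    have "u' \<ominus> u = w \<ominus> w'"
    proof -
      have "u' = (u \<oplus> w) \<oplus> \<ominus> w'" using c by (simp add: eq V.a_assoc V.r_neg)
      then have "u' \<ominus> u = (u \<oplus> (w \<oplus> \<ominus> w')) \<oplus> \<ominus> u" using c by (simp add: a_minus_def V.a_assoc)
      also have "\<dots> = (w \<oplus> \<ominus> w') \<oplus> (u \<oplus> \<ominus> u)" using c by (simp add: V.a_ac)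
      also have "\<dots> = w \<ominus> w'" using c by (simp add: V.r_neg a_minus_def)
      finally show ?thesis .
    qed
    then have "u' \<ominus> u \<in> W \<inter> U"
      using submodule_diff[OF assms(2,3) w'(1)[folded u'_def] u] submodule_diff[OF assms(2) W(1) w w'(2)] by simp
    then have "u' \<ominus> u = \<zero>" using W(2) by blast
    then show ?thesis using c diff_zero_iff[OF assms(2) c(2,1)] unfolding u'_def by simp
  qed
  show thesis
  proof
    show "p \<in> linear_hom K V V"
    proof (rule linear_homI)
      fix v assume "v \<in> carrier V"
      then obtain u w where v: "v = u \<oplus> w" "u \<in> U" "w \<in> W" using dec by blast
      show "p v \<in> carrier V" unfolding v(1) p[OF v(2,3)] by (rule Uc[OF v(2)])
      fix c assume c: "c \<in> carrier K"
      have "c \<odot> v = c \<odot> u \<oplus> c \<odot> w" using v c Uc Wc by (simp add: V.smult_r_distr)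
      then show "p (c \<odot> v) = c \<odot> p v"
        using p[OF E(4)[OF assms(3) c v(2)] E(4)[OF W(1) c v(3)]] p[OF v(2,3)] v(1) by simp
    next
      fix v v' assume vc: "v \<in> carrier V" "v' \<in> carrier V"
      obtain u w where v: "v = u \<oplus> w" "u \<in> U" "w \<in> W" using dec[OF vc(1)] by blast
      obtain u' w' where v': "v' = u' \<oplus> w'" "u' \<in> U" "w' \<in> W" using dec[OF vc(2)] by blast
      have "v \<oplus> v' = (u \<oplus> u') \<oplus> (w \<oplus> w')" using v v' Uc Wc by (simp add: V.a_ac)
      then show "p (v \<oplus> v') = p v \<oplus> p v'"
        using p[OF E(5)[OF assms(3) v(2) v'(2)] E(5)[OF W(1) v(3) v'(3)]] p[OF v(2,3)] p[OF v'(2,3)] v(1) v'(1) by simp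
    qed
    show "p v \<in> U" if "v \<in> carrier V" for v
    proof -
      obtain u w where v: "v = u \<oplus> w" "u \<in> U" "w \<in> W" using dec \<open>v \<in> carrier V\<close> by blast
      show ?thesis unfolding v(1) p[OF v(2,3)] by (rule v(2))
    qed
    show "p u = u" if "u \<in> U" for u
      using p[OF that submodule_zero[OF assms(2) W(1)]] Uc[OF that] by simp
  qed
qed

lemma linear_kernel_submodule:
  assumes "module K N" "module K P" "g \<in> linear_hom K N P"
  shows "submodule {n \<in> carrier N. g n = \<zero>\<^bsub>P\<^esub>} K N"
proof -
  interpret N: module K N by fact
  interpret P: module K P by fact
  show ?thesis
    by (rule N.submoduleI)
       (auto simp: linear_hom_zero[OF assms] linear_hom_inv[OF assms] linear_hom_add[OF assms(3)]
         linear_hom_smult[OF assms(3)])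
qed

lemma linear_image_submodule:
  assumes "module K N" "module K P" "g \<in> linear_hom K N P"
  shows "submodule (g ` carrier N) K P"
proof -
  interpret N: module K N by fact
  interpret P: module K P by fact
  show ?thesis
  proof (rule P.submoduleI)
    show "\<zero>\<^bsub>P\<^esub> \<in> g ` carrier N" using linear_hom_zero[OF assms] by (metis N.zero_closed imageI)
  qed (auto simp: linear_hom_closed[OF assms(3)] simp flip: linear_hom_inv[OF assms] linear_hom_add[OF assms(3)]
         linear_hom_smult[OF assms(3)])
qed

text \<open>
  A section of \<open>g\<close> up to its kernel. For \<open>y\<close> in \<open>P\<close>, project \<open>y\<close> to the image of \<open>g\<close>, choose a preimage \<open>n\<close>, and
  subtract from it its component \<open>p n\<close> in the kernel; then the choice of \<open>n\<close> does not matter. Being linear, \<open>q\<close> can be tensored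
  with the identity, which is how exactness of the tensor product is obtained below.
\<close>

lemma exists_linear_quasi_inverse:
  assumes "field K" "module K N" "module K P" and g: "g \<in> linear_hom K N P"
  obtains q where "q \<in> linear_hom K P N" "\<And>n. n \<in> carrier N \<Longrightarrow> g (n \<ominus>\<^bsub>N\<^esub> q (g n)) = \<zero>\<^bsub>P\<^esub>"
proof -
  interpret N: module K N by fact
  interpret P: module K P by fact
  define U where "U = {n \<in> carrier N. g n = \<zero>\<^bsub>P\<^esub>}"
  obtain p where p: "p \<in> linear_hom K N N" "\<And>n. n \<in> carrier N \<Longrightarrow> p n \<in> U" "\<And>u. u \<in> U \<Longrightarrow> p u = u"
    using exists_projection[OF assms(1,2) linear_kernel_submodule[OF assms(2-4)]] unfolding U_def by blast
  obtain r where r: "r \<in> linear_hom K P P" "\<And>y. y \<in> carrier P \<Longrightarrow> r y \<in> g ` carrier N"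
    "\<And>y. y \<in> g ` carrier N \<Longrightarrow> r y = y"
    using exists_projection[OF assms(1,3) linear_image_submodule[OF assms(2-4)]] by blast
  define s where "s n = n \<ominus>\<^bsub>N\<^esub> p n" for n
  have s: "s \<in> linear_hom K N N"
    using linear_hom_pointwise_diff[OF assms(2) linear_hom_ident p(1)] unfolding s_def .
  have s_eq: "s n = s n'" if "n \<in> carrier N" "n' \<in> carrier N" "g n = g n'" for n n'
  proof -
    have "g (n \<ominus>\<^bsub>N\<^esub> n') = \<zero>\<^bsub>P\<^esub>"
      using linear_hom_diff[OF assms(2-4)] that linear_hom_closed[OF g] by (simp add: P.r_neg a_minus_def)
    then have "n \<ominus>\<^bsub>N\<^esub> n' \<in> U" unfolding U_def using that by simp
    then have "s (n \<ominus>\<^bsub>N\<^esub> n') = \<zero>\<^bsub>N\<^esub>" unfolding s_def using p(3) that by (simp add: N.r_neg a_minus_def)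
    then have "s n \<ominus>\<^bsub>N\<^esub> s n' = \<zero>\<^bsub>N\<^esub>" using linear_hom_diff[OF assms(2,2) s] that by simp
    then show ?thesis using diff_zero_iff[OF assms(2), of "s n" "s n'"] linear_hom_closed[OF s] that by simp
  qed
  define q where "q y = s (SOME n. n \<in> carrier N \<and> g n = r y)" for y
  have q: "q y = s n" if "y \<in> carrier P" "n \<in> carrier N" "g n = r y" for y n
  proof -
    have "\<exists>n. n \<in> carrier N \<and> g n = r y" using that by blast
    from someI_ex[OF this] have "(SOME n. n \<in> carrier N \<and> g n = r y) \<in> carrier N \<and>
      g (SOME n. n \<in> carrier N \<and> g n = r y) = r y" .
    then show ?thesis unfolding q_def by (intro s_eq) (use that in auto)
  qed
  have ex: "\<exists>n\<in>carrier N. g n = r y" if "y \<in> carrier P" for y using r(2)[OF that] by force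
  show thesis
  proof
    show "q \<in> linear_hom K P N"
    proof (rule linear_homI)
      fix y assume y: "y \<in> carrier P"
      then obtain n where n: "n \<in> carrier N" "g n = r y" using ex by blast
      show "q y \<in> carrier N" using q[OF y n] linear_hom_closed[OF s n(1)] by simp
      fix c assume c: "c \<in> carrier K"
      have "g (c \<odot>\<^bsub>N\<^esub> n) = r (c \<odot>\<^bsub>P\<^esub> y)" using c y n linear_hom_smult[OF g] linear_hom_smult[OF r(1)] by simp
      then show "q (c \<odot>\<^bsub>P\<^esub> y) = c \<odot>\<^bsub>N\<^esub> q y"
        using q[of "c \<odot>\<^bsub>P\<^esub> y" "c \<odot>\<^bsub>N\<^esub> n"] q[OF y n] c y n linear_hom_smult[OF s] by simp
    next
      fix y z assume y: "y \<in> carrier P" and z: "z \<in> carrier P"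
      obtain n where n: "n \<in> carrier N" "g n = r y" using ex y by blast
      obtain m where m: "m \<in> carrier N" "g m = r z" using ex z by blast
      have "g (n \<oplus>\<^bsub>N\<^esub> m) = r (y \<oplus>\<^bsub>P\<^esub> z)" using y z n m linear_hom_add[OF g] linear_hom_add[OF r(1)] by simp
      then show "q (y \<oplus>\<^bsub>P\<^esub> z) = q y \<oplus>\<^bsub>N\<^esub> q z"
        using q[of "y \<oplus>\<^bsub>P\<^esub> z" "n \<oplus>\<^bsub>N\<^esub> m"] q[OF y n] q[OF z m] y z n m linear_hom_add[OF s] by simp
    qed
    show "g (n \<ominus>\<^bsub>N\<^esub> q (g n)) = \<zero>\<^bsub>P\<^esub>" if n: "n \<in> carrier N" for n
    proof -
      have "q (g n) = s n" using q[of "g n" n] r(3) n linear_hom_closed[OF g] by simp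
      moreover have pc: "p n \<in> carrier N" "g (p n) = \<zero>\<^bsub>P\<^esub>" using p(2)[OF n] by (auto simp: U_def)
      moreover have "n \<ominus>\<^bsub>N\<^esub> (n \<ominus>\<^bsub>N\<^esub> p n) = p n"
        using n pc by (simp add: a_minus_def N.minus_add N.r_neg2)
      ultimately show ?thesis by (simp add: s_def)
    qed
  qed
qed

section \<open>Subspaces of tensor products\<close>

lemma group_hom_generate:
  assumes "group_hom G G' f" "Z \<subseteq> carrier G" "subgroup W G'" "\<And>x. x \<in> Z \<Longrightarrow> f x \<in> W" "y \<in> generate G Z"
  shows "f y \<in> W"
proof -
  interpret f: group_hom G G' f by fact
  have c: "generate G Z \<subseteq> carrier G" using f.G.generate_incl[OF assms(2)] .
  show ?thesis
    using assms(5)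
  proof (induction rule: generate.induct)
    case one
    then show ?case using subgroup.one_closed[OF assms(3)] by simp
  next
    case (inv h)
    then show ?case using subgroup.m_inv_closed[OF assms(3)] assms(2,4) by (simp add: subset_iff)
  next
    case (eng h1 h2)
    then show ?case using subgroup.m_closed[OF assms(3)] c by (simp add: subset_iff)
  qed (rule assms(4))
qed

context ground_pair
begin

context
  fixes U V assumes U: "U \<subseteq> carrier M" and V: "V \<subseteq> carrier N"
begin

lemma subtensor_subgroup: "subgroup (subtensor K M N U V) (add_monoid MN)"
proof -
  interpret T: module K MN by (rule tensor_module)
  show ?thesis
    unfolding subtensor_def using U V
    by (intro group.generate_is_subgroup T.a_group) (auto intro: pure_tensor_closed)
qed

lemma subtensor_pure: "\<lbrakk>u \<in> U; v \<in> V\<rbrakk> \<Longrightarrow> tp u v \<in> subtensor K M N U V"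
  unfolding subtensor_def by (rule generate.incl) blast

lemma subtensor_closed: "t \<in> subtensor K M N U V \<Longrightarrow> t \<in> carrier MN"
  using subgroup.mem_carrier[OF subtensor_subgroup] by simp

lemma subtensor_zero: "\<zero>\<^bsub>MN\<^esub> \<in> subtensor K M N U V"
  using subgroup.one_closed[OF subtensor_subgroup] by simp

lemma subtensor_add:
  "\<lbrakk>t \<in> subtensor K M N U V; u \<in> subtensor K M N U V\<rbrakk> \<Longrightarrow> t \<oplus>\<^bsub>MN\<^esub> u \<in> subtensor K M N U V"
  using subgroup.m_closed[OF subtensor_subgroup] by simp

lemma subtensor_inv: "t \<in> subtensor K M N U V \<Longrightarrow> \<ominus>\<^bsub>MN\<^esub> t \<in> subtensor K M N U V"
  using subgroup.m_inv_closed[OF subtensor_subgroup] by (simp add: a_inv_def)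

lemma subtensor_linear_image:
  assumes "module K P" "f \<in> linear_hom K MN P" "subgroup W (add_monoid P)"
    and "\<And>u v. \<lbrakk>u \<in> U; v \<in> V\<rbrakk> \<Longrightarrow> f (tp u v) \<in> W" "t \<in> subtensor K M N U V"
  shows "f t \<in> W"
proof (rule group_hom_generate[OF linear_hom_group_hom[OF tensor_module assms(1,2)] _ assms(3) _ assms(5)[unfolded subtensor_def]])
  show "{tp u v |u v. u \<in> U \<and> v \<in> V} \<subseteq> carrier (add_monoid MN)"
    using U V pure_tensor_closed by auto
qed (use assms(4) in blast)

lemma subtensor_linear_ext:
  assumes P: "module K P" and f: "f \<in> linear_hom K MN P" and g: "g \<in> linear_hom K MN P"
    and eq: "\<And>u v. \<lbrakk>u \<in> U; v \<in> V\<rbrakk> \<Longrightarrow> f (tp u v) = g (tp u v)"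
    and t: "t \<in> subtensor K M N U V"
  shows "f t = g t"
proof -
  interpret P: module K P by fact
  note c = linear_hom_closed[OF f] linear_hom_closed[OF g]
  have "f t \<ominus>\<^bsub>P\<^esub> g t \<in> {\<zero>\<^bsub>P\<^esub>}"
  proof (rule subtensor_linear_image[OF P linear_hom_pointwise_diff[OF P f g] _ _ t])
    show "subgroup {\<zero>\<^bsub>P\<^esub>} (add_monoid P)"
      using group.triv_subgroup[OF P.a_group] by simp
    show "f (tp u v) \<ominus>\<^bsub>P\<^esub> g (tp u v) \<in> {\<zero>\<^bsub>P\<^esub>}" if "u \<in> U" "v \<in> V" for u v
      using eq[OF that] diff_zero_iff[OF P] c pure_tensor_closed U V that by (simp add: subset_iff)
  qed
  then show ?thesis
    using diff_zero_iff[OF P] c subtensor_closed[OF t] by simp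
qed

end

lemma tensor_map_comp:
  assumes "module K P" "module K P'" "g \<in> linear_hom K N P" "q \<in> linear_hom K P P'" "t \<in> carrier MN"
  shows "tensor_map K M P' (\<lambda>x. x) q (tensor_map K M P (\<lambda>x. x) g t) = tensor_map K M P' (\<lambda>x. x) (\<lambda>n. q (g n)) t"
proof -
  have gq: "(\<lambda>n. q (g n)) \<in> linear_hom K N P'" by (rule linear_hom_comp[OF assms(3,4)])
  note l = tensor_map_linear[OF _ _ _ _ linear_hom_ident] and p = tensor_map_pure[OF _ _ _ _ linear_hom_ident]
  have mods: "module K M" "module K N" by unfold_locales
  show ?thesis
    by (rule linear_ext[OF linear_hom_comp[OF l[OF mods mods(1) assms(1,3)] l[OF mods(1) assms(1) mods(1) assms(2,4)]]
          l[OF mods mods(1) assms(2) gq] _ assms(5)])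
       (use mods assms gq in \<open>simp add: p linear_hom_closed\<close>)
qed

lemma tensor_map_subtensor:
  assumes P: "module K P" and g: "g \<in> linear_hom K N P"
    and t: "t \<in> subtensor K M N (carrier M) {n \<in> carrier N. g n = \<zero>\<^bsub>P\<^esub>}"
  shows "tensor_map K M P (\<lambda>x. x) g t = \<zero>\<^bsub>tensor K M P\<^esub>"
proof -
  have mods: "module K M" "module K N" by unfold_locales
  interpret MP: ground_pair K M P by (rule ground_pairI) fact+
  interpret T: module K "tensor K M P" by (rule MP.tensor_module)
  have sub: "{n \<in> carrier N. g n = \<zero>\<^bsub>P\<^esub>} \<subseteq> carrier N" by blast
  have "tensor_map K M P (\<lambda>x. x) g t \<in> {\<zero>\<^bsub>tensor K M P\<^esub>}"
  proof (rule subtensor_linear_image[OF order_refl sub MP.tensor_module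
        tensor_map_linear[OF mods mods(1) P linear_hom_ident g] _ _ t])
    show "subgroup {\<zero>\<^bsub>tensor K M P\<^esub>} (add_monoid (tensor K M P))"
      using group.triv_subgroup[OF T.a_group] by simp
    show "tensor_map K M P (\<lambda>x. x) g (tp u v) \<in> {\<zero>\<^bsub>tensor K M P\<^esub>}"
      if "u \<in> carrier M" "v \<in> {n \<in> carrier N. g n = \<zero>\<^bsub>P\<^esub>}" for u v
      using that tensor_map_pure[OF mods mods(1) P linear_hom_ident g]
        linear_hom_zero[OF P MP.tensor_module bilinear_right[OF MP.pure_bilinear that(1)]] by simp
  qed
  then show ?thesis by simp
qed

text \<open>
  Exactness of \<open>M \<otimes> _\<close> over a field. With a quasi-inverse \<open>q\<close> of \<open>g\<close>, the difference \<open>t - (id \<otimes> q g)(t)\<close> lies in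
  \<open>M \<otimes> ker g\<close> for every \<open>t\<close>, and its second term vanishes if \<open>(id \<otimes> g)(t) = 0\<close>.
\<close>

lemma tensor_map_kernel:
  assumes "field K" and P: "module K P" and g: "g \<in> linear_hom K N P" and t: "t \<in> carrier MN"
  shows "tensor_map K M P (\<lambda>x. x) g t = \<zero>\<^bsub>tensor K M P\<^esub> \<longleftrightarrow>
     t \<in> subtensor K M N (carrier M) {n \<in> carrier N. g n = \<zero>\<^bsub>P\<^esub>}" (is "_ \<longleftrightarrow> t \<in> ?S")
proof
  assume 0: "tensor_map K M P (\<lambda>x. x) g t = \<zero>\<^bsub>tensor K M P\<^esub>"
  have mods: "module K M" "module K N" by unfold_locales
  interpret MP: ground_pair K M P by (rule ground_pairI) fact+
  interpret T: module K MN by (rule tensor_module)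
  have sub: "{n \<in> carrier N. g n = \<zero>\<^bsub>P\<^esub>} \<subseteq> carrier N" by blast
  obtain q where q: "q \<in> linear_hom K P N" "\<And>n. n \<in> carrier N \<Longrightarrow> g (n \<ominus>\<^bsub>N\<^esub> q (g n)) = \<zero>\<^bsub>P\<^esub>"
    using exists_linear_quasi_inverse[OF assms(1) mods(2) P g] by blast
  note qg = linear_hom_comp[OF g q(1)]
  let ?e = "tensor_map K M N (\<lambda>x. x) (\<lambda>n. q (g n))"
  note e = tensor_map_linear[OF mods mods linear_hom_ident qg]
  have cl: "?e t \<in> carrier MN" if "t \<in> carrier MN" for t
    using linear_hom_closed[OF e that] .
  have "t \<ominus>\<^bsub>MN\<^esub> ?e t \<in> ?S"
    using t
  proof (induction rule: ground_induct)
    case (pure m n)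
    have c: "q (g n) \<in> carrier N" using linear_hom_closed[OF qg pure(2)] .
    have "tp m n \<ominus>\<^bsub>MN\<^esub> ?e (tp m n) = tp m (n \<ominus>\<^bsub>N\<^esub> q (g n))"
      using tensor_map_pure[OF mods mods linear_hom_ident qg pure]
        linear_hom_diff[OF mods(2) tensor_module bilinear_right[OF pure_bilinear pure(1)] pure(2) c] by simp
    then show ?case
      using subtensor_pure[OF order_refl sub pure(1), of "n \<ominus>\<^bsub>N\<^esub> q (g n)"] q(2) pure c by simp
  next
    case (add t u)
    have "(t \<oplus>\<^bsub>MN\<^esub> u) \<ominus>\<^bsub>MN\<^esub> ?e (t \<oplus>\<^bsub>MN\<^esub> u) =
       (t \<ominus>\<^bsub>MN\<^esub> ?e t) \<oplus>\<^bsub>MN\<^esub> (u \<ominus>\<^bsub>MN\<^esub> ?e u)"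
      using add(1,2) cl by (simp add: linear_hom_add[OF e] a_minus_def T.minus_add T.a_ac)
    then show ?case using subtensor_add[OF order_refl sub add(3,4)] by simp
  qed
  moreover have "?e t = \<zero>\<^bsub>MN\<^esub>"
    using tensor_map_comp[OF P mods(2) g q(1) t] 0
      linear_hom_zero[OF MP.tensor_module tensor_module tensor_map_linear[OF mods(1) P mods linear_hom_ident q(1)]]
    by simp
  moreover have "t \<ominus>\<^bsub>MN\<^esub> \<zero>\<^bsub>MN\<^esub> = t"
    using t T.M.l_zero[OF T.M.a_inv_closed[OF T.M.zero_closed], symmetric] T.M.r_neg[OF T.M.zero_closed]
    by (metis T.M.r_zero a_minus_def)
  ultimately show "t \<in> ?S" by simp
next
  assume "t \<in> ?S"
  then show "tensor_map K M P (\<lambda>x. x) g t = \<zero>\<^bsub>tensor K M P\<^esub>"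
    by (rule tensor_map_subtensor[OF P g])
qed

end

context algebra_pair
begin

lemma subtensor_right_ideal:
  assumes J: "J \<subseteq> carrier B" "\<And>x b. \<lbrakk>x \<in> J; b \<in> carrier B\<rbrakk> \<Longrightarrow> x \<otimes>\<^bsub>B\<^esub> b \<in> J"
    and t: "t \<in> subtensor K A B (carrier A) J" and u: "u \<in> carrier AB"
  shows "t \<otimes>\<^bsub>AB\<^esub> u \<in> subtensor K A B (carrier A) J" (is "_ \<in> ?N")
proof (rule subtensor_linear_image[OF order_refl J(1) mods(3) bilinear_left[OF tensor_mult_bilinear u]
      subtensor_subgroup[OF order_refl J(1)] _ t])
  interpret AB: unital_algebra K AB by (rule tensor_algebra)
  show "pt a x \<otimes>\<^bsub>AB\<^esub> u \<in> ?N" if ax: "a \<in> carrier A" "x \<in> J" for a x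
    using u
  proof (induction rule: ground_induct)
    case (pure m n)
    then show ?case using ax J by (simp add: tensor_mult_pure subtensor_pure[OF order_refl J(1)] subset_iff)
  next
    case (add t u)
    then show ?case
      using ax J(1) by (simp add: AB.r_distr subtensor_add[OF order_refl J(1)] pure_tensor_closed subset_iff)
  qed
qed

end

text \<open>
  Choose a linear functional \<open>f\<close> with \<open>f(a) = 1\<close> and apply \<open>x \<otimes> n \<mapsto> f(x) n\<close>.
\<close>

lemma pure_tensor_eq_zero:
  assumes "field K" "module K M" "module K N" and a: "a \<in> carrier M" "a \<noteq> \<zero>\<^bsub>M\<^esub>" and n: "n \<in> carrier N"
    and eq: "pure_tensor K M N a n = \<zero>\<^bsub>tensor K M N\<^esub>"
  shows "n = \<zero>\<^bsub>N\<^esub>"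
proof -
  interpret field K by fact
  interpret M: module K M by fact
  interpret N: module K N by fact
  interpret MN: ground_pair K M N by (rule ground_pairI) fact+
  let ?U = "{c \<odot>\<^bsub>M\<^esub> a | c. c \<in> carrier K}"
  have U: "submodule ?U K M"
  proof (rule M.submoduleI)
    show "?U \<subseteq> carrier M" using a by auto
    have "\<zero>\<^bsub>M\<^esub> = \<zero>\<^bsub>K\<^esub> \<odot>\<^bsub>M\<^esub> a" using a by simp
    then show "\<zero>\<^bsub>M\<^esub> \<in> ?U" by blast
    fix x assume "x \<in> ?U"
    then obtain c where c: "c \<in> carrier K" "x = c \<odot>\<^bsub>M\<^esub> a" by blast
    then have "\<ominus>\<^bsub>M\<^esub> x = (\<ominus>\<^bsub>K\<^esub> c) \<odot>\<^bsub>M\<^esub> a" using a by (simp add: M.smult_l_minus)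
    then show "\<ominus>\<^bsub>M\<^esub> x \<in> ?U" using c by blast
    fix d assume d: "d \<in> carrier K"
    then have "d \<odot>\<^bsub>M\<^esub> x = (d \<otimes>\<^bsub>K\<^esub> c) \<odot>\<^bsub>M\<^esub> a" using a c by (simp add: M.smult_assoc1)
    then show "d \<odot>\<^bsub>M\<^esub> x \<in> ?U" using c d by blast
  next
    fix x y assume "x \<in> ?U" "y \<in> ?U"
    then obtain c d where "c \<in> carrier K" "x = c \<odot>\<^bsub>M\<^esub> a" "d \<in> carrier K" "y = d \<odot>\<^bsub>M\<^esub> a" by blast
    then have "x \<oplus>\<^bsub>M\<^esub> y = (c \<oplus>\<^bsub>K\<^esub> d) \<odot>\<^bsub>M\<^esub> a" "c \<oplus>\<^bsub>K\<^esub> d \<in> carrier K" using a by (simp_all add: M.smult_l_distr)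
    then show "x \<oplus>\<^bsub>M\<^esub> y \<in> ?U" by blast
  qed
  obtain p where p: "p \<in> linear_hom K M M" "\<And>v. v \<in> carrier M \<Longrightarrow> p v \<in> ?U" "\<And>u. u \<in> ?U \<Longrightarrow> p u = u"
    using exists_projection[OF assms(1,2) U] by blast
  have inj: "c = d" if "c \<in> carrier K" "d \<in> carrier K" "c \<odot>\<^bsub>M\<^esub> a = d \<odot>\<^bsub>M\<^esub> a" for c d
  proof (rule ccontr)
    assume "c \<noteq> d"
    define e where "e = c \<ominus>\<^bsub>K\<^esub> d"
    have e: "e \<in> carrier K" "e \<noteq> \<zero>\<^bsub>K\<^esub>" using that \<open>c \<noteq> d\<close> by (auto simp: e_def)
    have "e \<odot>\<^bsub>M\<^esub> a = \<zero>\<^bsub>M\<^esub>"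
      using that a by (simp add: e_def a_minus_def M.smult_l_distr M.smult_l_minus M.r_neg)
    moreover have "inv\<^bsub>K\<^esub> e \<in> carrier K" "inv\<^bsub>K\<^esub> e \<otimes>\<^bsub>K\<^esub> e = \<one>\<^bsub>K\<^esub>"
      using e by (auto simp: field_Units)
    ultimately show False
      using M.smult_assoc1[of "inv\<^bsub>K\<^esub> e" e a] e a by simp
  qed
  define f where "f x = (THE c. c \<in> carrier K \<and> p x = c \<odot>\<^bsub>M\<^esub> a)" for x
  have f_eq: "f x = c" if "c \<in> carrier K" "p x = c \<odot>\<^bsub>M\<^esub> a" for x c
    unfolding f_def using that inj by (intro the_equality) auto
  have f: "f x \<in> carrier K" "p x = f x \<odot>\<^bsub>M\<^esub> a" if x: "x \<in> carrier M" for x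
  proof -
    obtain c where "c \<in> carrier K" "p x = c \<odot>\<^bsub>M\<^esub> a" using p(2)[OF x] by blast
    then show "f x \<in> carrier K" "p x = f x \<odot>\<^bsub>M\<^esub> a" using f_eq by auto
  qed
  have f_add: "f (x \<oplus>\<^bsub>M\<^esub> y) = f x \<oplus>\<^bsub>K\<^esub> f y" if "x \<in> carrier M" "y \<in> carrier M" for x y
  proof (rule f_eq)
    show "p (x \<oplus>\<^bsub>M\<^esub> y) = (f x \<oplus>\<^bsub>K\<^esub> f y) \<odot>\<^bsub>M\<^esub> a"
      unfolding linear_hom_add[OF p(1) that] f(2)[OF that(1)] f(2)[OF that(2)]
      using that f(1) a by (simp add: M.smult_l_distr)
  qed (use that f in simp)
  have f_smult: "f (c \<odot>\<^bsub>M\<^esub> x) = c \<otimes>\<^bsub>K\<^esub> f x" if "c \<in> carrier K" "x \<in> carrier M" for c x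
  proof (rule f_eq)
    show "p (c \<odot>\<^bsub>M\<^esub> x) = (c \<otimes>\<^bsub>K\<^esub> f x) \<odot>\<^bsub>M\<^esub> a"
      unfolding linear_hom_smult[OF p(1) that] f(2)[OF that(2)] using that f(1) a by (simp add: M.smult_assoc1)
  qed (use that f in simp)
  have "p a = \<one>\<^bsub>K\<^esub> \<odot>\<^bsub>M\<^esub> a"
  proof -
    have "a = \<one>\<^bsub>K\<^esub> \<odot>\<^bsub>M\<^esub> a" using a by simp
    then have "a \<in> ?U" by blast
    then show ?thesis using p(3) a by simp
  qed
  then have fa: "f a = \<one>\<^bsub>K\<^esub>" using f_eq by simp
  have b: "bilinear K M N N (\<lambda>x n. f x \<odot>\<^bsub>N\<^esub> n)"
    by (intro bilinearI linear_homI)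
       (use f(1) in \<open>auto simp: f_add f_smult N.smult_l_distr N.smult_r_distr N.smult_assoc1 m_comm
          simp flip: N.smult_assoc1\<close>)
  have "n = lift_to N (\<lambda>x n. f x \<odot>\<^bsub>N\<^esub> n) (pure_tensor K M N a n)"
    using a n by (simp add: MN.lift_pure[OF assms(3) b] fa)
  also have "\<dots> = \<zero>\<^bsub>N\<^esub>"
    unfolding eq by (rule linear_hom_zero[OF MN.tensor_module assms(3) MN.lift_linear[OF assms(3) b]])
  finally show ?thesis .
qed

section \<open>Quotients by submodules\<close>

context
  fixes K :: "('k, 'w) ring_scheme" and H :: "('k, 'h, 'x) module_scheme" and I
  assumes H: "module K H" and I: "submodule I K H"
begin

interpretation H: module K H by (rule H)

lemma submodule_abelian_subgroup: "abelian_subgroup I H"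
  using I H.abelian_group_axioms
  by (intro abelian_subgroupI3) (auto simp: additive_subgroup_def submodule_def)

interpretation I: abelian_subgroup I H by (rule submodule_abelian_subgroup)

lemma quot_proj_eq:
  assumes "x \<in> carrier H" "y \<in> carrier H"
  shows "quot_proj H I x = quot_proj H I y \<longleftrightarrow> x \<ominus>\<^bsub>H\<^esub> y \<in> I"
proof -
  have "quot_proj H I x = quot_proj H I y \<longleftrightarrow> x \<in> I +>\<^bsub>H\<^esub> y"
    unfolding quot_proj_def
    using assms I.a_repr_independence'[of x y] I.a_rcos_self[of x] by blast
  also have "\<dots> \<longleftrightarrow> x \<oplus>\<^bsub>H\<^esub> \<ominus>\<^bsub>H\<^esub> y \<in> I"
    using I.a_rcos_module[OF assms(2,1)] .
  finally show ?thesis by (simp add: a_minus_def)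
qed

lemma quot_simps:
  "carrier (quot_module H I) = quot_proj H I ` carrier H"
  "\<zero>\<^bsub>quot_module H I\<^esub> = I"
  by (auto simp: quot_module_def quot_proj_def A_RCOSETS_def RCOSETS_def a_r_coset_def)

lemma quot_add:
  assumes "x \<in> carrier H" "y \<in> carrier H"
  shows "quot_proj H I x \<oplus>\<^bsub>quot_module H I\<^esub> quot_proj H I y = quot_proj H I (x \<oplus>\<^bsub>H\<^esub> y)"
  using I.a_rcos_sum[OF assms] by (simp add: quot_module_def quot_proj_def)

lemma quot_smult:
  assumes "c \<in> carrier K" "x \<in> carrier H"
  shows "c \<odot>\<^bsub>quot_module H I\<^esub> quot_proj H I x = quot_proj H I (c \<odot>\<^bsub>H\<^esub> x)"
proof -
  have "I +>\<^bsub>H\<^esub> (c \<odot>\<^bsub>H\<^esub> y) = I +>\<^bsub>H\<^esub> (c \<odot>\<^bsub>H\<^esub> x)" if y: "y \<in> I +>\<^bsub>H\<^esub> x" for y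
  proof -
    have yc: "y \<in> carrier H" using y I.a_elemrcos_carrier assms(2) by blast
    have "y \<oplus>\<^bsub>H\<^esub> \<ominus>\<^bsub>H\<^esub> x \<in> I" using I.a_rcos_module[OF assms(2) yc] y by blast
    then have "c \<odot>\<^bsub>H\<^esub> (y \<oplus>\<^bsub>H\<^esub> \<ominus>\<^bsub>H\<^esub> x) \<in> I" using H.submoduleE(4)[OF I] assms(1) by blast
    then have "c \<odot>\<^bsub>H\<^esub> y \<ominus>\<^bsub>H\<^esub> c \<odot>\<^bsub>H\<^esub> x \<in> I"
      using assms yc by (simp add: H.smult_r_distr H.smult_r_minus a_minus_def)
    then show ?thesis using quot_proj_eq assms yc by (simp add: quot_proj_def)
  qed
  moreover have "x \<in> I +>\<^bsub>H\<^esub> x" using I.a_rcos_self assms(2) .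
  ultimately have "(\<Union>y\<in>I +>\<^bsub>H\<^esub> x. I +>\<^bsub>H\<^esub> (c \<odot>\<^bsub>H\<^esub> y)) = I +>\<^bsub>H\<^esub> (c \<odot>\<^bsub>H\<^esub> x)"
    by blast
  then show ?thesis by (simp add: quot_module_def quot_proj_def)
qed

lemma quot_module: "module K (quot_module H I)"
proof -
  let ?Q = "quot_module H I" and ?p = "quot_proj H I"
  have "comm_group (add_monoid H Mod I)"
    using H.a_comm_group I by (intro comm_group.abelian_FactGroup) (auto simp: submodule_def)
  then have "comm_group (add_monoid ?Q)"
    by (rule comm_group_same_operations)
       (simp_all add: quot_module_def FactGroup_def A_RCOSETS_def set_add_def fun_eq_iff)
  then interpret Q: abelian_group ?Q by (rule abelian_group_of_add_monoid)
  show ?thesis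
    by (rule moduleI)
       (auto simp: quot_simps quot_smult quot_add H.R.cring_axioms Q.abelian_group_axioms
         H.smult_l_distr H.smult_r_distr H.smult_assoc1)
qed

lemma quot_proj_linear: "quot_proj H I \<in> linear_hom K H (quot_module H I)"
  by (rule linear_homI) (auto simp: quot_simps quot_add quot_smult)

lemma quot_proj_zero_iff:
  assumes "h \<in> carrier H"
  shows "quot_proj H I h = \<zero>\<^bsub>quot_module H I\<^esub> \<longleftrightarrow> h \<in> I"
proof -
  have "\<zero>\<^bsub>quot_module H I\<^esub> = quot_proj H I \<zero>\<^bsub>H\<^esub>"
    using linear_hom_zero[OF H quot_module quot_proj_linear] by simp
  then have "quot_proj H I h = \<zero>\<^bsub>quot_module H I\<^esub> \<longleftrightarrow> h \<ominus>\<^bsub>H\<^esub> \<zero>\<^bsub>H\<^esub> \<in> I"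
    using quot_proj_eq[OF assms, of "\<zero>\<^bsub>H\<^esub>"] by simp
  also have "h \<ominus>\<^bsub>H\<^esub> \<zero>\<^bsub>H\<^esub> = h"
    using linear_hom_diff[OF H H linear_hom_ident, of h "\<zero>\<^bsub>H\<^esub>"] assms
    by (metis H.M.a_inv_closed H.M.l_zero H.M.r_neg H.M.r_zero H.M.zero_closed a_minus_def)
  finally show ?thesis .
qed

lemma quot_kernel: "{h \<in> carrier H. quot_proj H I h = \<zero>\<^bsub>quot_module H I\<^esub>} = I"
  using quot_proj_zero_iff H.submoduleE(1)[OF I] by blast

end

lemma right_ideal_submodule:
  assumes "unital_algebra K H" "additive_subgroup I H"
    and "\<And>x h. \<lbrakk>x \<in> I; h \<in> carrier H\<rbrakk> \<Longrightarrow> x \<otimes>\<^bsub>H\<^esub> h \<in> I"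
  shows "submodule I K H"
proof -
  interpret H: unital_algebra K H by fact
  interpret I: additive_subgroup I H by fact
  have "c \<odot>\<^bsub>H\<^esub> x \<in> I" if "c \<in> carrier K" "x \<in> I" for c x
  proof -
    have "x \<otimes>\<^bsub>H\<^esub> (c \<odot>\<^bsub>H\<^esub> \<one>\<^bsub>H\<^esub>) = c \<odot>\<^bsub>H\<^esub> x"
      using that I.a_Hcarr by (simp add: H.smult_mult_right)
    then show ?thesis using assms(3)[OF that(2), of "c \<odot>\<^bsub>H\<^esub> \<one>\<^bsub>H\<^esub>"] that by simp
  qed
  then show ?thesis
    using I.a_subgroup by (simp add: submodule_def submodule_axioms_def)
qed

section \<open>Sums over coproducts and coactions\<close>

context hopf_algebra
begin

abbreviation mult_H (infixl "\<cdot>" 70) where "x \<cdot> y \<equiv> x \<otimes>\<^bsub>H\<^esub> y"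
abbreviation HH where "HH \<equiv> tensor K H H"

lemma H_alg: "unital_algebra K H" by (rule H.unital_algebra_axioms)
lemma H_mod: "module K H" by (rule H.module_axioms)
lemma HH_mod: "module K HH" by (rule tensor_module[OF H_mod H_mod])

sublocale HH: algebra_pair K H H
  by (rule algebra_pairI[OF H_alg H_alg])

lemma comult_linear: "\<Delta> \<in> linear_hom K H HH"
  and comult_ring_hom: "\<Delta> \<in> ring_hom H HH"
  using comult_hom unfolding algebra_hom_def by auto

lemma comult_closed: "h \<in> carrier H \<Longrightarrow> \<Delta> h \<in> carrier HH"
  using linear_hom_closed[OF comult_linear] .

lemma antipode_closed: "h \<in> carrier H \<Longrightarrow> antipode h \<in> carrier H"
  using linear_hom_closed[OF antipode_linear] .

lemma counit_closed: "h \<in> carrier H \<Longrightarrow> \<epsilon> h \<in> carrier K"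
  using counit_hom unfolding ring_hom_def by auto

lemma counit_smult_linear:
  assumes "f \<in> linear_hom K L H" "module K P" "p \<in> carrier P"
  shows "(\<lambda>x. \<epsilon> (f x) \<odot>\<^bsub>P\<^esub> p) \<in> linear_hom K L P"
proof -
  interpret P: module K P by fact
  note [simp] = linear_hom_closed[OF assms(1)]
  have add: "\<epsilon> (x \<oplus>\<^bsub>H\<^esub> y) = \<epsilon> x \<oplus>\<^bsub>K\<^esub> \<epsilon> y" if "x \<in> carrier H" "y \<in> carrier H" for x y
    using counit_hom that unfolding ring_hom_def by auto
  show ?thesis
    by (rule linear_homI)
       (use assms(3) in \<open>simp_all add: linear_hom_add[OF assms(1)] linear_hom_smult[OF assms(1)]
          add counit_linear counit_closed P.smult_l_distr P.smult_assoc1\<close>)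
qed

lemmas hopf_linear_intros =
  linear_hom_comp[OF _ comult_linear] linear_hom_comp[OF _ antipode_linear]
  counit_smult_linear linear_intros

lemmas hopf_closed =
  H_alg H_mod HH_mod HH.tensor_algebra H.m_closed H.one_closed comult_closed antipode_closed counit_closed
  HH.pure_tensor_closed

lemmas hopf_rules = hopf_linear_intros hopf_closed

abbreviation Sw where "Sw t F \<equiv> lift_to H F t"

end

context right_comodule_algebra
begin

abbreviation AH where "AH \<equiv> tensor K A H"

lemma A_alg: "unital_algebra K A" by (rule A.unital_algebra_axioms)
lemma A_mod: "module K A" by (rule A.module_axioms)
lemma AH_mod: "module K AH" by (rule tensor_module[OF A_mod H_mod])

sublocale AH: algebra_pair K A H
  by (rule algebra_pairI[OF A_alg H_alg])

lemma coaction_linear: "\<delta> \<in> linear_hom K A AH"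
  and coaction_ring_hom: "\<delta> \<in> ring_hom A AH"
  using coaction_hom unfolding algebra_hom_def by auto

lemma coaction_closed: "a \<in> carrier A \<Longrightarrow> \<delta> a \<in> carrier AH"
  using linear_hom_closed[OF coaction_linear] .

lemmas comod_linear_intros = linear_hom_comp[OF _ coaction_linear] hopf_linear_intros

lemmas comod_closed = A_alg A_mod AH_mod AH.tensor_algebra A.m_closed A.one_closed coaction_closed
  AH.pure_tensor_closed hopf_closed tensor_module

text \<open>
  Coassociativity as Sweedler notation uses it: a trilinear \<open>F\<close> has the same value on \<open>a\<^sub>0 \<otimes> a\<^sub>1 \<otimes> a\<^sub>2\<close> whichever
  factor of \<open>\<delta>(a)\<close> is expanded. It follows by applying to the axiom the linear map on \<open>A \<otimes> (H \<otimes> H)\<close> that \<open>F\<close> induces.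
\<close>

lemma coassoc_trilinear:
  assumes P: "module K P"
    and F: "\<And>x. x \<in> carrier A \<Longrightarrow> bilinear K H H P (\<lambda>g k. F x g k)"
      "\<And>g k. \<lbrakk>g \<in> carrier H; k \<in> carrier H\<rbrakk> \<Longrightarrow> (\<lambda>x. F x g k) \<in> linear_hom K A P"
    and a: "a \<in> carrier A"
  shows "lift_to P (\<lambda>x h. lift_to P (\<lambda>y g. F y g h) (\<delta> x)) (\<delta> a) =
         lift_to P (\<lambda>x h. lift_to P (\<lambda>g k. F x g k) (\<Delta> h)) (\<delta> a)"
proof -
  interpret AHH: ground_pair K A HH by (rule ground_pairI) (rule A_mod HH_mod)+
  interpret AHH': ground_pair K AH H by (rule ground_pairI) (rule AH_mod H_mod)+
  let ?L = "lift_to P (\<lambda>x w. lift_to P (\<lambda>g k. F x g k) w)"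
  let ?as = "tensor_assoc K A H H"
  note r = comod_linear_intros comod_closed P F
  have F': "bilinear K A H P (\<lambda>x g. F x g k)" if "k \<in> carrier H" for k
    by (rule bilinearI F bilinear_left[OF F(1)] that | assumption)+
  have bL: "bilinear K A HH P (\<lambda>x w. lift_to P (\<lambda>g k. F x g k) w)"
    by (rule r | assumption)+
  have L: "?L \<in> linear_hom K (tensor K A HH) P"
    by (rule AHH.lift_linear[OF P bL])
  have ba: "bilinear K A H (tensor K A HH) (\<lambda>m n. pure_tensor K A HH m (pure_tensor K H H n p))"
    if "p \<in> carrier H" for p
    by (rule r that | assumption)+
  have bas: "bilinear K AH H (tensor K A HH) (\<lambda>x p. lift_to (tensor K A HH)
      (\<lambda>m n. pure_tensor K A HH m (pure_tensor K H H n p)) x)"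
    by (rule r | assumption)+
  \<comment> \<open>Both sides of the axiom are composites of linear maps, so it suffices to evaluate them on pure tensors.\<close>
  have as: "?as \<in> linear_hom K (tensor K AH H) (tensor K A HH)"
    unfolding tensor_assoc_def Let_def by (rule AHH'.lift_linear[OF AHH.tensor_module bas])
  have m1: "tensor_map K AH H \<delta> (\<lambda>h. h) \<in> linear_hom K AH (tensor K AH H)"
    by (rule tensor_map_linear[OF A_mod H_mod AH_mod H_mod coaction_linear linear_hom_ident])
  have m2: "tensor_map K A HH (\<lambda>h. h) \<Delta> \<in> linear_hom K AH (tensor K A HH)"
    by (rule tensor_map_linear[OF A_mod H_mod A_mod HH_mod linear_hom_ident comult_linear])
  have as_pure: "?as (pure_tensor K AH H t p) = lift_to (tensor K A HH)
      (\<lambda>m n. pure_tensor K A HH m (pure_tensor K H H n p)) t"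
    if "t \<in> carrier AH" "p \<in> carrier H" for t p
    unfolding tensor_assoc_def Let_def by (rule AHH'.lift_pure[OF AHH.tensor_module bas that])
  have 1: "?L (?as (tensor_map K AH H \<delta> (\<lambda>h. h) (\<delta> a))) =
    lift_to P (\<lambda>x h. lift_to P (\<lambda>y g. F y g h) (\<delta> x)) (\<delta> a)"
  proof (rule AH.linear_ext[OF linear_hom_comp[OF m1 linear_hom_comp[OF as L]] AH.lift_linear[OF P] _ coaction_closed[OF a]])
    show b: "bilinear K A H P (\<lambda>x h. lift_to P (\<lambda>y g. F y g h) (\<delta> x))"
      by (rule r F' bilinear_right[OF F(1)] | assumption)+
    fix x h assume x: "x \<in> carrier A" and h: "h \<in> carrier H"
    have "?L (?as (tensor_map K AH H \<delta> (\<lambda>h. h) (pure_tensor K A H x h))) = ?L (?as (pure_tensor K AH H (\<delta> x) h))"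
      using tensor_map_pure[OF A_mod H_mod AH_mod H_mod coaction_linear linear_hom_ident x h] by simp
    also have "\<dots> = lift_to P (\<lambda>m n. ?L (pure_tensor K A HH m (pure_tensor K H H n h))) (\<delta> x)"
      unfolding as_pure[OF coaction_closed[OF x] h]
      by (rule AH.lift_comp[OF AHH.tensor_module ba[OF h] L P coaction_closed[OF x]])
    also have "\<dots> = lift_to P (\<lambda>y g. F y g h) (\<delta> x)"
    proof (rule AH.lift_cong[OF P AH.bilinear_comp[OF AHH.tensor_module ba[OF h] L] coaction_closed[OF x]])
      fix m n assume "m \<in> carrier A" "n \<in> carrier H"
      then show "?L (pure_tensor K A HH m (pure_tensor K H H n h)) = F m n h"
        using h by (simp add: AHH.lift_pure[OF P bL] HH.lift_pure[OF P F(1)] HH.pure_tensor_closed)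
    qed
    also have "\<dots> = lift_to P (\<lambda>x h. lift_to P (\<lambda>y g. F y g h) (\<delta> x)) (pure_tensor K A H x h)"
      by (rule AH.lift_pure[OF P b x h, symmetric])
    finally show "?L (?as (tensor_map K AH H \<delta> (\<lambda>h. h) (pure_tensor K A H x h))) = \<dots>" .
  qed
  have 2: "?L (tensor_map K A HH (\<lambda>h. h) \<Delta> (\<delta> a)) =
    lift_to P (\<lambda>x h. lift_to P (\<lambda>g k. F x g k) (\<Delta> h)) (\<delta> a)"
  proof (rule AH.linear_ext[OF linear_hom_comp[OF m2 L] AH.lift_linear[OF P] _ coaction_closed[OF a]])
    show b: "bilinear K A H P (\<lambda>x h. lift_to P (\<lambda>g k. F x g k) (\<Delta> h))"
      by (rule r | assumption)+
    fix x h assume x: "x \<in> carrier A" and h: "h \<in> carrier H"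
    show "?L (tensor_map K A HH (\<lambda>h. h) \<Delta> (pure_tensor K A H x h)) =
      lift_to P (\<lambda>x h. lift_to P (\<lambda>g k. F x g k) (\<Delta> h)) (pure_tensor K A H x h)"
      using x h tensor_map_pure[OF A_mod H_mod A_mod HH_mod linear_hom_ident comult_linear x h]
      by (simp add: AH.lift_pure[OF P b] AHH.lift_pure[OF P bL] comult_closed)
  qed
  show ?thesis using 1 2 coaction_coassoc[OF a] by simp
qed

end

text \<open>
  Since \<open>H\<close> is a comodule algebra over itself, the results about \<open>\<delta>\<close> and \<open>A\<^sup>c\<^sup>o\<^sup>Q\<close> also apply to \<open>\<Delta>\<close> and \<open>H\<^sup>c\<^sup>o\<^sup>Q\<close>.
\<close>

lemma (in hopf_algebra) regular_comodule_algebra: "right_comodule_algebra K H \<Delta> \<epsilon> antipode H \<Delta>"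
  unfolding right_comodule_algebra_def right_comodule_algebra_axioms_def
  by (intro conjI allI impI hopf_algebra_axioms H_alg comult_hom coassoc counit_right)

section \<open>Coinvariants of a quotient by a right ideal coideal\<close>

context right_comodule_algebra
begin

sublocale AHa: unital_algebra K AH by (rule AH.tensor_algebra)

abbreviation em where "em a \<equiv> pure_tensor K A H a \<one>\<^bsub>H\<^esub>"

lemma em_closed: "a \<in> carrier A \<Longrightarrow> em a \<in> carrier AH"
  by (simp add: AH.pure_tensor_closed)

lemma em_linear: "(\<lambda>a. em a) \<in> linear_hom K A AH"
  by (rule comod_linear_intros comod_closed)+

lemma em_mult: "\<lbrakk>a \<in> carrier A; b \<in> carrier A\<rbrakk> \<Longrightarrow> em (a \<otimes>\<^bsub>A\<^esub> b) = em a \<otimes>\<^bsub>AH\<^esub> em b"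
  by (simp add: AH.tensor_mult_pure)

lemma coaction_mult: "\<lbrakk>a \<in> carrier A; b \<in> carrier A\<rbrakk> \<Longrightarrow> \<delta> (a \<otimes>\<^bsub>A\<^esub> b) = \<delta> a \<otimes>\<^bsub>AH\<^esub> \<delta> b"
  using ring_hom_mult[OF coaction_ring_hom] .

lemma coaction_one: "\<delta> \<one>\<^bsub>A\<^esub> = em \<one>\<^bsub>A\<^esub>"
  using ring_hom_one[OF coaction_ring_hom] by (simp add: tensor_simps)

text \<open>\<open>(a \<otimes> 1) \<delta>(b)\<close> is the value of the canonical map at \<open>a \<otimes> b\<close>.\<close>

abbreviation canon where "canon a b \<equiv> em a \<otimes>\<^bsub>AH\<^esub> \<delta> b"

lemma canon_closed: "\<lbrakk>a \<in> carrier A; b \<in> carrier A\<rbrakk> \<Longrightarrow> canon a b \<in> carrier AH"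
  by (simp add: em_closed coaction_closed)

lemma tensor_map_em_mult:
  assumes N: "module K N" and p: "p \<in> linear_hom K H N" and a: "a \<in> carrier A" and t: "t \<in> carrier AH"
  shows "tensor_map K A N (\<lambda>x. a \<otimes>\<^bsub>A\<^esub> x) p t = tensor_map K A N (\<lambda>x. x) p (em a \<otimes>\<^bsub>AH\<^esub> t)"
proof -
  have la: "(\<lambda>x. a \<otimes>\<^bsub>A\<^esub> x) \<in> linear_hom K A A" by (rule comod_linear_intros comod_closed a)+
  have le: "(\<lambda>t. em a \<otimes>\<^bsub>AH\<^esub> t) \<in> linear_hom K AH AH" by (rule comod_linear_intros comod_closed a)+
  show ?thesis
    by (rule AH.linear_ext[OF tensor_map_linear[OF A_mod H_mod A_mod N la p]
        linear_hom_comp[OF le tensor_map_linear[OF A_mod H_mod A_mod N linear_hom_ident p]] _ t])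
       (use a in \<open>simp add: tensor_map_pure[OF A_mod H_mod A_mod N la p] AH.tensor_mult_pure
         tensor_map_pure[OF A_mod H_mod A_mod N linear_hom_ident p]\<close>)
qed

lemma tensor_map_ident: "t \<in> carrier AH \<Longrightarrow> tensor_map K A H (\<lambda>x. x) (\<lambda>x. x) t = t"
  by (rule AH.linear_ext[OF tensor_map_linear[OF A_mod H_mod A_mod H_mod linear_hom_ident linear_hom_ident] linear_hom_ident])
     (simp add: tensor_map_pure[OF A_mod H_mod A_mod H_mod linear_hom_ident linear_hom_ident])

lemma coinvariants_subset: "coinvariants K H A \<delta> \<subseteq> carrier A"
  by (auto simp: coinvariants_def)

text \<open>
  A formal sum in \<open>FA\<close> represents a tensor over each subalgebra \<open>S\<close> of \<open>A\<close>, namely \<open>0\<close> if it lies in \<open>KerS S\<close>. Computing with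
  formal sums makes maps defined on tensor products over different subalgebras comparable.
\<close>

abbreviation FA where "FA \<equiv> free_Abelian_group (carrier A \<times> carrier A)"
abbreviation canon_sum where "canon_sum x \<equiv> frag_lift (add_monoid AH) canon x"
abbreviation KerS where "KerS S \<equiv> balanced_kernel S (\<lambda>a s. a \<otimes>\<^bsub>A\<^esub> s) (\<lambda>s a. s \<otimes>\<^bsub>A\<^esub> a) A A"

lemma over_pair: "S \<subseteq> carrier A \<Longrightarrow> balanced_pair S (\<lambda>a s. a \<otimes>\<^bsub>A\<^esub> s) (\<lambda>s a. s \<otimes>\<^bsub>A\<^esub> a) A A"
  by unfold_locales auto

lemma canon_sum_closed: "x \<in> carrier FA \<Longrightarrow> canon_sum x \<in> carrier AH"
  using hom_in_carrier[OF frag_lift_hom[where S = "carrier A \<times> carrier A" and F = canon, OF module_comm_group[OF AH_mod]]]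
    canon_closed by auto

lemma tensor_over_carrier:
  assumes "S \<subseteq> carrier A"
  shows "carrier (tensor_over A S) = (\<lambda>x. KerS S #>\<^bsub>FA\<^esub> x) ` carrier FA"
  unfolding tensor_over_def using balanced_pair.BT_carrier[OF over_pair[OF assms]] .

text \<open>
  The equation to be assumed of \<open>\<phi>\<close> says that it does not distinguish \<open>s \<otimes> 1\<close> from \<open>\<delta>(s)\<close> for \<open>s\<close> in \<open>S\<close>.
\<close>

lemma balanced_canon_comp:
  assumes N: "module K N" and S: "S \<subseteq> carrier A" and \<phi>: "\<phi> \<in> linear_hom K AH N"
    and eq: "\<And>a b s. \<lbrakk>a \<in> carrier A; b \<in> carrier A; s \<in> S\<rbrakk> \<Longrightarrow>
        \<phi> (em a \<otimes>\<^bsub>AH\<^esub> (em s \<otimes>\<^bsub>AH\<^esub> \<delta> b)) = \<phi> (em a \<otimes>\<^bsub>AH\<^esub> (\<delta> s \<otimes>\<^bsub>AH\<^esub> \<delta> b))"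
  shows "balanced_map S (\<lambda>a s. a \<otimes>\<^bsub>A\<^esub> s) (\<lambda>s a. s \<otimes>\<^bsub>A\<^esub> a) A A (add_monoid N) (\<lambda>a b. \<phi> (canon a b))"
proof -
  have b: "bilinear K A A AH canon"
    by (rule comod_linear_intros comod_closed | assumption)+
  have "bilinear K A A N (\<lambda>a b. \<phi> (canon a b))"
    by (rule ground_pair.bilinear_comp[OF ground_pairI[OF A_mod A_mod] AH_mod b \<phi>])
  from bilinear_balanced_map[OF this] have "balanced_map (carrier K) (\<lambda>m c. c \<odot>\<^bsub>A\<^esub> m) (\<lambda>c n. c \<odot>\<^bsub>A\<^esub> n) A A (add_monoid N) (\<lambda>a b. \<phi> (canon a b))" .
  moreover have "\<phi> (canon (a \<otimes>\<^bsub>A\<^esub> s) b) = \<phi> (canon a (s \<otimes>\<^bsub>A\<^esub> b))"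
    if "a \<in> carrier A" "b \<in> carrier A" "s \<in> S" for a b s
  proof -
    have s: "s \<in> carrier A" using that S by blast
    show ?thesis
      using that s eq[OF that] by (simp add: em_mult coaction_mult AHa.m_assoc em_closed coaction_closed)
  qed
  ultimately show ?thesis unfolding balanced_map_def by simp
qed

lemma canonical_coset:
  assumes N: "module K N" and S: "S \<subseteq> carrier A" and p: "p \<in> linear_hom K H N"
    and eq: "\<And>a b s. \<lbrakk>a \<in> carrier A; b \<in> carrier A; s \<in> S\<rbrakk> \<Longrightarrow>
        tensor_map K A N (\<lambda>x. x) p (em a \<otimes>\<^bsub>AH\<^esub> (em s \<otimes>\<^bsub>AH\<^esub> \<delta> b)) =
        tensor_map K A N (\<lambda>x. x) p (em a \<otimes>\<^bsub>AH\<^esub> (\<delta> s \<otimes>\<^bsub>AH\<^esub> \<delta> b))"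
  shows "canonical_map K A \<delta> N p \<in> hom (tensor_over A S) (add_monoid (tensor K A N))"
    and "x \<in> carrier FA \<Longrightarrow> canonical_map K A \<delta> N p (KerS S #>\<^bsub>FA\<^esub> x) = tensor_map K A N (\<lambda>x. x) p (canon_sum x)"
proof -
  let ?m = "tensor_map K A N (\<lambda>x. x) p"
  note AN = tensor_module[OF A_mod N]
  have m: "?m \<in> linear_hom K AH (tensor K A N)"
    by (rule tensor_map_linear[OF A_mod H_mod A_mod N linear_hom_ident p])
  interpret S: balanced_pair S "\<lambda>a s. a \<otimes>\<^bsub>A\<^esub> s" "\<lambda>s a. s \<otimes>\<^bsub>A\<^esub> a" A A by (rule over_pair[OF S])
  have b: "balanced_map S (\<lambda>a s. a \<otimes>\<^bsub>A\<^esub> s) (\<lambda>s a. s \<otimes>\<^bsub>A\<^esub> a) A A (add_monoid (tensor K A N)) (\<lambda>a b. ?m (canon a b))"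
    by (rule balanced_canon_comp[OF AN S m eq])
  have eq': "tensor_map K A N (\<lambda>x. a \<otimes>\<^bsub>A\<^esub> x) p (\<delta> b) = ?m (canon a b)"
    if "a \<in> carrier A" "b \<in> carrier A" for a b
    by (rule tensor_map_em_mult[OF N p that(1) coaction_closed[OF that(2)]])
  have b': "balanced_map S (\<lambda>a s. a \<otimes>\<^bsub>A\<^esub> s) (\<lambda>s a. s \<otimes>\<^bsub>A\<^esub> a) A A (add_monoid (tensor K A N))
      (\<lambda>a b. tensor_map K A N (\<lambda>x. a \<otimes>\<^bsub>A\<^esub> x) p (\<delta> b))"
    using b S unfolding balanced_map_def by (simp add: eq' subset_iff)
  show "canonical_map K A \<delta> N p \<in> hom (tensor_over A S) (add_monoid (tensor K A N))"
    unfolding canonical_map_def tensor_over_def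
    by (rule S.tensor_lift_hom[OF module_comm_group[OF AN] b'])
  assume x: "x \<in> carrier FA"
  have "canonical_map K A \<delta> N p (KerS S #>\<^bsub>FA\<^esub> x) =
    frag_lift (add_monoid (tensor K A N)) (\<lambda>a b. tensor_map K A N (\<lambda>x. a \<otimes>\<^bsub>A\<^esub> x) p (\<delta> b)) x"
    unfolding canonical_map_def by (rule S.tensor_lift_coset[OF module_comm_group[OF AN] b' x])
  also have "\<dots> = frag_lift (add_monoid (tensor K A N)) (\<lambda>a b. ?m (canon a b)) x"
    by (rule frag_lift_cong[OF module_comm_group[OF AN], where S = "carrier A \<times> carrier A"])
       (use x eq' linear_hom_closed[OF m canon_closed] in auto)
  also have "\<dots> = ?m (canon_sum x)"
    by (rule frag_lift_comp[symmetric, where S = "carrier A \<times> carrier A"])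
       (use x m AN AH_mod canon_closed in \<open>auto intro: module_comm_group simp: linear_hom_def\<close>)
  finally show "canonical_map K A \<delta> N p (KerS S #>\<^bsub>FA\<^esub> x) = ?m (canon_sum x)" .
qed

lemma galois_canon_sum_surj:
  assumes "hopf_galois K H A \<delta> (coinvariants K H A \<delta>)" "t \<in> carrier AH"
  obtains x where "x \<in> carrier FA" "canon_sum x = t"
proof -
  let ?B = "coinvariants K H A \<delta>"
  have "em a \<otimes>\<^bsub>AH\<^esub> (em s \<otimes>\<^bsub>AH\<^esub> \<delta> b) = em a \<otimes>\<^bsub>AH\<^esub> (\<delta> s \<otimes>\<^bsub>AH\<^esub> \<delta> b)" if "s \<in> ?B" for a b s
    using that by (simp add: coinvariants_def)
  then have c: "canonical_map K A \<delta> H (\<lambda>h. h) (KerS ?B #>\<^bsub>FA\<^esub> x) = canon_sum x" if "x \<in> carrier FA" for x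
    using canonical_coset(2)[OF H_mod coinvariants_subset linear_hom_ident _ that] tensor_map_ident[OF canon_sum_closed[OF that]]
    by simp
  have "t \<in> canonical_map K A \<delta> H (\<lambda>h. h) ` carrier (tensor_over A ?B)"
    using assms by (simp add: hopf_galois_def bij_betw_def)
  then show thesis
    unfolding tensor_over_carrier[OF coinvariants_subset] using that c by auto
qed

text \<open>
  By the Galois property the elements \<open>(a \<otimes> 1) \<delta>(b)\<close> generate \<open>A \<otimes> H\<close>.
\<close>

lemma galois_hom_ext:
  assumes galois: "hopf_galois K H A \<delta> (coinvariants K H A \<delta>)" and G: "comm_group G"
    and f: "f \<in> hom (add_monoid AH) G" and g: "g \<in> hom (add_monoid AH) G"
    and eq: "\<And>a b. \<lbrakk>a \<in> carrier A; b \<in> carrier A\<rbrakk> \<Longrightarrow> f (canon a b) = g (canon a b)"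
    and t: "t \<in> carrier AH"
  shows "f t = g t"
proof -
  obtain x where x: "x \<in> carrier FA" "canon_sum x = t" using galois_canon_sum_surj[OF galois t] .
  note c = frag_lift_comp[where S = "carrier A \<times> carrier A" and F = canon and x = x, OF module_comm_group[OF AH_mod] G]
  have "f t = frag_lift G (\<lambda>a b. f (canon a b)) x"
    unfolding x(2)[symmetric] by (rule c[OF f]) (use x(1) canon_closed in auto)
  also have "\<dots> = frag_lift G (\<lambda>a b. g (canon a b)) x"
    by (rule frag_lift_cong[OF G, where S = "carrier A \<times> carrier A"])
       (use x(1) eq hom_in_carrier[OF g] canon_closed in auto)
  also have "\<dots> = g t"
    unfolding x(2)[symmetric] by (rule c[OF g, symmetric]) (use x(1) canon_closed in auto)
  finally show ?thesis .
qed

end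

locale quotient_comodule_algebra = right_comodule_algebra K H \<Delta> \<epsilon> antipode A \<delta>
  for K :: "('k, 'w) ring_scheme" and H :: "('k, 'h, 'x) module_scheme"
    and \<Delta> :: "'h \<Rightarrow> ('h \<times> 'h \<Rightarrow>\<^sub>0 int) set" and \<epsilon> :: "'h \<Rightarrow> 'k" and antipode :: "'h \<Rightarrow> 'h"
    and A :: "('k, 'a, 'y) module_scheme" and \<delta> :: "'a \<Rightarrow> ('a \<times> 'h \<Rightarrow>\<^sub>0 int) set" +
  fixes I :: "'h set"
  assumes ideal_coideal: "right_ideal_coideal K H \<Delta> \<epsilon> I"
begin

abbreviation Q where "Q \<equiv> quot_module H I"
abbreviation \<pi> where "\<pi> \<equiv> quot_proj H I"
abbreviation AQ where "AQ \<equiv> tensor K A Q"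
abbreviation S where "S \<equiv> quot_coinvariants K H A \<delta> I"
abbreviation NI where "NI \<equiv> subtensor K A H (carrier A) I"
abbreviation id_proj where "id_proj \<equiv> tensor_map K A Q (\<lambda>x. x) \<pi>"

lemma I_right: "\<lbrakk>x \<in> I; h \<in> carrier H\<rbrakk> \<Longrightarrow> x \<cdot> h \<in> I"
  using ideal_coideal unfolding right_ideal_coideal_def by blast+

lemma I_submodule: "submodule I K H"
  using ideal_coideal unfolding right_ideal_coideal_def
  by (intro right_ideal_submodule[OF H_alg]) auto

lemma I_subset: "I \<subseteq> carrier H"
  using module.submoduleE(1)[OF H_mod I_submodule] .

lemma Q_mod: "module K Q" by (rule quot_module[OF H_mod I_submodule])
lemma proj_linear: "\<pi> \<in> linear_hom K H Q" by (rule quot_proj_linear[OF H_mod I_submodule])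
lemma AQ_mod: "module K AQ" by (rule tensor_module[OF A_mod Q_mod])
lemma id_proj_linear: "id_proj \<in> linear_hom K AH AQ"
  by (rule tensor_map_linear[OF A_mod H_mod A_mod Q_mod linear_hom_ident proj_linear])
lemma id_proj_pure: "\<lbrakk>a \<in> carrier A; h \<in> carrier H\<rbrakk> \<Longrightarrow> id_proj (pure_tensor K A H a h) = pure_tensor K A Q a (\<pi> h)"
  by (rule tensor_map_pure[OF A_mod H_mod A_mod Q_mod linear_hom_ident proj_linear])

lemma id_proj_zero_iff: "t \<in> carrier AH \<Longrightarrow> id_proj t = \<zero>\<^bsub>AQ\<^esub> \<longleftrightarrow> t \<in> NI"
  using AH.tensor_map_kernel[OF field_axioms Q_mod proj_linear] unfolding quot_kernel[OF H_mod I_submodule] .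

lemma id_proj_eq_iff:
  assumes "t \<in> carrier AH" "u \<in> carrier AH"
  shows "id_proj t = id_proj u \<longleftrightarrow> t \<ominus>\<^bsub>AH\<^esub> u \<in> NI"
  using id_proj_zero_iff[of "t \<ominus>\<^bsub>AH\<^esub> u"] linear_hom_diff[OF AH_mod AQ_mod id_proj_linear assms]
    diff_zero_iff[OF AQ_mod, of "id_proj t" "id_proj u"] linear_hom_closed[OF id_proj_linear] assms by simp

lemma id_proj_surj: "t \<in> carrier AQ \<Longrightarrow> \<exists>u\<in>carrier AH. id_proj u = t"
proof (induction rule: ground_pair.ground_induct[OF ground_pairI[OF A_mod Q_mod], consumes 1])
  case (1 m n)
  then obtain h where "h \<in> carrier H" "n = \<pi> h" by (auto simp: quot_simps[OF H_mod I_submodule])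
  then show ?case using 1 id_proj_pure AH.pure_tensor_closed by blast
next
  case (2 t u)
  then show ?case using linear_hom_add[OF id_proj_linear] by (metis AHa.a_closed)
qed

lemmas NI_add = AH.subtensor_add[OF order_refl I_subset]
  and NI_pure = AH.subtensor_pure[OF order_refl I_subset]
  and NI_inv = AH.subtensor_inv[OF order_refl I_subset]
  and NI_zero = AH.subtensor_zero[OF order_refl I_subset]

lemma NI_right: "\<lbrakk>t \<in> NI; u \<in> carrier AH\<rbrakk> \<Longrightarrow> t \<otimes>\<^bsub>AH\<^esub> u \<in> NI"
  by (rule AH.subtensor_right_ideal[OF I_subset I_right])

lemma NI_left:
  assumes t: "t \<in> NI" and b: "b \<in> carrier A"
  shows "em b \<otimes>\<^bsub>AH\<^esub> t \<in> NI"
  by (rule AH.subtensor_linear_image[OF order_refl I_subset AH_mod bilinear_right[OF AH.tensor_mult_bilinear em_closed[OF b]]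
        AH.subtensor_subgroup[OF order_refl I_subset] _ t])
     (use b I_subset in \<open>simp add: AH.tensor_mult_pure NI_pure subset_iff\<close>)

text \<open>
  This form, in which \<open>Q\<close> no longer occurs, is the one used below: by exactness the kernel of \<open>id \<otimes> \<pi>\<close> is \<open>A \<otimes> I\<close>.
\<close>

lemma coinv_iff: "a \<in> S \<longleftrightarrow> a \<in> carrier A \<and> \<delta> a \<ominus>\<^bsub>AH\<^esub> em a \<in> NI"
  unfolding quot_coinvariants_def
  using id_proj_eq_iff[OF coaction_closed em_closed] id_proj_pure[OF _ H.one_closed] by auto

lemma S_subset: "S \<subseteq> carrier A"
  by (auto simp: quot_coinvariants_def)

lemma coinvariants_le: "coinvariants K H A \<delta> \<subseteq> S"
  by (auto simp: coinvariants_def quot_coinvariants_def id_proj_pure)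

lemma S_sub_algebra: "S \<in> carrier (Sub_Alg K A (coinvariants K H A \<delta>))"
proof -
  have E: "\<delta> (a \<oplus>\<^bsub>A\<^esub> b) \<ominus>\<^bsub>AH\<^esub> em (a \<oplus>\<^bsub>A\<^esub> b) = (\<delta> a \<ominus>\<^bsub>AH\<^esub> em a) \<oplus>\<^bsub>AH\<^esub> (\<delta> b \<ominus>\<^bsub>AH\<^esub> em b)"
    if "a \<in> carrier A" "b \<in> carrier A" for a b
    using that em_closed coaction_closed
    by (simp add: linear_hom_add[OF coaction_linear] linear_hom_add[OF em_linear] a_minus_def AHa.minus_add AHa.a_ac)
  have add: "a \<oplus>\<^bsub>A\<^esub> b \<in> S" if "a \<in> S" "b \<in> S" for a b
    using that E NI_add by (simp add: coinv_iff)
  have smult: "c \<odot>\<^bsub>A\<^esub> a \<in> S" if "c \<in> carrier K" "a \<in> S" for a c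
  proof -
    have a: "a \<in> carrier A" "id_proj (\<delta> a) = id_proj (em a)" using that by (auto simp: quot_coinvariants_def id_proj_pure)
    have "id_proj (\<delta> (c \<odot>\<^bsub>A\<^esub> a)) = c \<odot>\<^bsub>AQ\<^esub> id_proj (\<delta> a)"
      using a that coaction_closed by (simp add: linear_hom_smult[OF coaction_linear] linear_hom_smult[OF id_proj_linear])
    also have "\<dots> = id_proj (em (c \<odot>\<^bsub>A\<^esub> a))"
      using a that em_closed by (simp add: linear_hom_smult[OF em_linear] linear_hom_smult[OF id_proj_linear])
    finally show ?thesis using a that by (simp add: quot_coinvariants_def id_proj_pure)
  qed
  have inv: "\<ominus>\<^bsub>A\<^esub> a \<in> S" if "a \<in> S" for a
  proof -
    have a: "a \<in> carrier A" using that S_subset by blast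
    have "(\<ominus>\<^bsub>K\<^esub> \<one>\<^bsub>K\<^esub>) \<odot>\<^bsub>A\<^esub> a = \<ominus>\<^bsub>A\<^esub> a" using a by (simp add: A.smult_l_minus)
    then show ?thesis using smult[OF _ that, of "\<ominus>\<^bsub>K\<^esub> \<one>\<^bsub>K\<^esub>"] by simp
  qed
  have mult: "a \<otimes>\<^bsub>A\<^esub> b \<in> S" if "a \<in> S" "b \<in> S" for a b
  proof -
    have ab: "a \<in> carrier A" "b \<in> carrier A" using that S_subset by auto
    note [simp] = em_closed[OF ab(1)] em_closed[OF ab(2)] coaction_closed[OF ab(1)] coaction_closed[OF ab(2)]
    \<comment> \<open>The factor \<open>\<delta>(b)\<close> stands on the right, where the right ideal \<open>I\<close> can absorb it.\<close>
    have "\<delta> (a \<otimes>\<^bsub>A\<^esub> b) \<ominus>\<^bsub>AH\<^esub> em (a \<otimes>\<^bsub>A\<^esub> b) =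
      (\<delta> a \<ominus>\<^bsub>AH\<^esub> em a) \<otimes>\<^bsub>AH\<^esub> \<delta> b \<oplus>\<^bsub>AH\<^esub> em a \<otimes>\<^bsub>AH\<^esub> (\<delta> b \<ominus>\<^bsub>AH\<^esub> em b)"
      using ab by (simp add: coaction_mult em_mult a_minus_def AHa.l_distr AHa.r_distr AHa.l_minus AHa.r_minus
          AHa.a_assoc AHa.r_neg1)
    also have "\<dots> \<in> NI"
      using that ab by (intro NI_add NI_right NI_left) (auto simp: coinv_iff)
    finally show ?thesis using ab by (simp add: coinv_iff)
  qed
  have one: "\<one>\<^bsub>A\<^esub> \<in> S"
    by (simp add: coinv_iff coaction_one NI_zero em_closed a_minus_def AHa.r_neg)
  have "subring S A"
    by (rule A.subringI) (use S_subset one inv mult add in auto)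
  then show ?thesis unfolding Sub_Alg_def using smult coinvariants_le by simp
qed

text \<open>
  The canonical map of \<open>Q\<close> is defined on the tensor product over any set \<open>T\<close> of coinvariants, because
  \<open>\<delta>(s) - s \<otimes> 1\<close> lies in \<open>A \<otimes> I\<close>, which absorbs \<open>a \<otimes> 1\<close> on the left and \<open>\<delta>(b)\<close> on the right.
\<close>

lemma canonical_quot:
  assumes T: "T \<subseteq> S"
  shows "canonical_map K A \<delta> Q \<pi> \<in> hom (tensor_over A T) (add_monoid AQ)"
    and "x \<in> carrier FA \<Longrightarrow> canonical_map K A \<delta> Q \<pi> (KerS T #>\<^bsub>FA\<^esub> x) = id_proj (canon_sum x)"
proof -
  have Tc: "T \<subseteq> carrier A" using T S_subset by blast
  have eq: "id_proj (em a \<otimes>\<^bsub>AH\<^esub> (em s \<otimes>\<^bsub>AH\<^esub> \<delta> b)) = id_proj (em a \<otimes>\<^bsub>AH\<^esub> (\<delta> s \<otimes>\<^bsub>AH\<^esub> \<delta> b))"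
    if "a \<in> carrier A" "b \<in> carrier A" "s \<in> T" for a b s
  proof -
    have s: "s \<in> carrier A" "\<delta> s \<ominus>\<^bsub>AH\<^esub> em s \<in> NI" using that T coinv_iff by auto
    note [simp] = em_closed[OF that(1)] em_closed[OF s(1)] coaction_closed[OF that(2)] coaction_closed[OF s(1)]
    have "em a \<otimes>\<^bsub>AH\<^esub> (\<delta> s \<otimes>\<^bsub>AH\<^esub> \<delta> b) \<ominus>\<^bsub>AH\<^esub> em a \<otimes>\<^bsub>AH\<^esub> (em s \<otimes>\<^bsub>AH\<^esub> \<delta> b) =
       em a \<otimes>\<^bsub>AH\<^esub> ((\<delta> s \<ominus>\<^bsub>AH\<^esub> em s) \<otimes>\<^bsub>AH\<^esub> \<delta> b)"
      by (simp add: a_minus_def AHa.l_distr AHa.r_distr AHa.l_minus AHa.r_minus)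
    also have "\<dots> \<in> NI" using that s by (intro NI_left NI_right) auto
    finally show ?thesis by (subst eq_commute, subst id_proj_eq_iff) auto
  qed
  show "canonical_map K A \<delta> Q \<pi> \<in> hom (tensor_over A T) (add_monoid AQ)"
    by (rule canonical_coset(1)[OF Q_mod Tc proj_linear eq])
  show "canonical_map K A \<delta> Q \<pi> (KerS T #>\<^bsub>FA\<^esub> x) = id_proj (canon_sum x)" if "x \<in> carrier FA"
    by (rule canonical_coset(2)[OF Q_mod Tc proj_linear eq that])
qed

lemma KerS_canon_sum:
  assumes "T \<subseteq> S" "x \<in> KerS T"
  shows "canon_sum x \<in> NI"
proof -
  have Tc: "T \<subseteq> carrier A" using assms S_subset by blast
  interpret T: balanced_pair T "\<lambda>a s. a \<otimes>\<^bsub>A\<^esub> s" "\<lambda>s a. s \<otimes>\<^bsub>A\<^esub> a" A A by (rule over_pair[OF Tc])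
  have x: "x \<in> carrier FA" using subgroup.mem_carrier[OF T.Ker_subgroup assms(2)] .
  interpret c: group_hom "tensor_over A T" "add_monoid AQ" "canonical_map K A \<delta> Q \<pi>"
    using canonical_quot(1)[OF assms(1)] T.BT_comm_group module_comm_group[OF AQ_mod]
    by (simp add: group_hom_def group_hom_axioms_def tensor_over_def comm_group_def)
  have "KerS T #>\<^bsub>FA\<^esub> x = \<one>\<^bsub>tensor_over A T\<^esub>"
    unfolding tensor_over_def using T.coset_eq_one_iff[OF x] assms(2) by simp
  then have "id_proj (canon_sum x) = \<zero>\<^bsub>AQ\<^esub>"
    using canonical_quot(2)[OF assms(1) x] c.hom_one by simp
  then show ?thesis using id_proj_zero_iff[OF canon_sum_closed[OF x]] by simp
qed

text \<open>
  Surjectivity is automatic: \<open>can\<^sub>Q\<close> is induced by the surjective Galois map followed by \<open>id \<otimes> \<pi>\<close>.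
\<close>

lemma canonical_bij_iff:
  assumes galois: "hopf_galois K H A \<delta> (coinvariants K H A \<delta>)"
  shows "bij_betw (canonical_map K A \<delta> Q \<pi>) (carrier (tensor_over A S)) (carrier AQ) \<longleftrightarrow>
     (\<forall>x\<in>carrier FA. canon_sum x \<in> NI \<longrightarrow> x \<in> KerS S)"
proof -
  interpret T: balanced_pair S "\<lambda>a s. a \<otimes>\<^bsub>A\<^esub> s" "\<lambda>s a. s \<otimes>\<^bsub>A\<^esub> a" A A by (rule over_pair[OF S_subset])
  let ?c = "canonical_map K A \<delta> Q \<pi>"
  interpret c: group_hom "tensor_over A S" "add_monoid AQ" ?c
    using canonical_quot(1)[OF order_refl] T.BT_comm_group module_comm_group[OF AQ_mod]
    by (simp add: group_hom_def group_hom_axioms_def tensor_over_def comm_group_def)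
  have "carrier AQ \<subseteq> ?c ` carrier (tensor_over A S)"
  proof
    fix t assume "t \<in> carrier AQ"
    then obtain u where u: "u \<in> carrier AH" "id_proj u = t" using id_proj_surj by blast
    obtain x where x: "x \<in> carrier FA" "canon_sum x = u" using galois_canon_sum_surj[OF galois u(1)] .
    then show "t \<in> ?c ` carrier (tensor_over A S)"
      unfolding tensor_over_carrier[OF S_subset] using canonical_quot(2)[OF order_refl x(1)] u by auto
  qed
  then have surj: "?c ` carrier (tensor_over A S) = carrier AQ"
    using c.hom_closed by auto
  have "inj_on ?c (carrier (tensor_over A S)) \<longleftrightarrow>
     (\<forall>t\<in>carrier (tensor_over A S). ?c t = \<zero>\<^bsub>AQ\<^esub> \<longrightarrow> t = \<one>\<^bsub>tensor_over A S\<^esub>)"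
    using c.inj_on_one_iff by auto
  also have "\<dots> \<longleftrightarrow> (\<forall>x\<in>carrier FA. id_proj (canon_sum x) = \<zero>\<^bsub>AQ\<^esub> \<longrightarrow> x \<in> KerS S)"
    unfolding tensor_over_carrier[OF S_subset]
    using canonical_quot(2)[OF order_refl] T.coset_eq_one_iff by (simp add: tensor_over_def)
  also have "\<dots> \<longleftrightarrow> (\<forall>x\<in>carrier FA. canon_sum x \<in> NI \<longrightarrow> x \<in> KerS S)"
    using id_proj_zero_iff[OF canon_sum_closed] by blast
  finally show ?thesis unfolding bij_betw_def surj by simp
qed

end

section \<open>The tensor product over a subalgebra as a module\<close>

text \<open>
  A scalar acts on the left factor. With this structure sums over coproducts may take values in the tensor product
  over a subalgebra.
\<close>

definition tensor_over_module ::
  "('k, 'w) ring_scheme \<Rightarrow> ('k, 'a, 'x) module_scheme \<Rightarrow> 'a set \<Rightarrow> ('k, ('a \<times> 'a \<Rightarrow>\<^sub>0 int) set) module" where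
  "tensor_over_module K A S =
     \<lparr>carrier = carrier (tensor_over A S), monoid.mult = undefined, one = undefined,
      ring.zero = \<one>\<^bsub>tensor_over A S\<^esub>, ring.add = (\<otimes>\<^bsub>tensor_over A S\<^esub>),
      smult = (\<lambda>c. tensor_lift (tensor_over A S) (\<lambda>a b. pure_tensor_over A S (c \<odot>\<^bsub>A\<^esub> a) b))\<rparr>"

context
  fixes K :: "('k, 'w) ring_scheme" and A :: "('k, 'a, 'x) module_scheme" and S
  assumes A: "unital_algebra K A" and S: "S \<subseteq> carrier A"
begin

interpretation A: unital_algebra K A by (rule A)

interpretation bal: balanced_module_pair K S "\<lambda>a s. a \<otimes>\<^bsub>A\<^esub> s" "\<lambda>s a. s \<otimes>\<^bsub>A\<^esub> a" A A
  by unfold_locales (use S in \<open>auto simp: A.smult_mult_left\<close>)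

lemma tensor_over_module_structure:
  "carrier (tensor_over_module K A S) = carrier bal.BT"
  "(\<oplus>\<^bsub>tensor_over_module K A S\<^esub>) = (\<otimes>\<^bsub>bal.BT\<^esub>)"
  "\<zero>\<^bsub>tensor_over_module K A S\<^esub> = \<one>\<^bsub>bal.BT\<^esub>"
  "c \<odot>\<^bsub>tensor_over_module K A S\<^esub> t = tensor_lift bal.BT (\<lambda>m n. bal.bp (c \<odot>\<^bsub>A\<^esub> m) n) t"
  by (simp_all add: tensor_over_module_def tensor_over_def pure_tensor_over_def)

lemma tensor_over_module: "module K (tensor_over_module K A S)"
  by (rule bal.module_structure) (rule tensor_over_module_structure)+

lemma pure_tensor_over_balanced:
  assumes "a \<in> carrier A" "b \<in> carrier A" "s \<in> S"
  shows "pure_tensor_over A S (a \<otimes>\<^bsub>A\<^esub> s) b = pure_tensor_over A S a (s \<otimes>\<^bsub>A\<^esub> b)"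
  using bal.pure_balanced assms unfolding balanced_map_def pure_tensor_over_def by blast

text \<open>
  Linearity in the right factor holds because the scalars, which belong to \<open>S\<close>, may cross the tensor sign.
\<close>

lemma pure_tensor_over_bilinear:
  assumes scal: "\<And>c. c \<in> carrier K \<Longrightarrow> c \<odot>\<^bsub>A\<^esub> \<one>\<^bsub>A\<^esub> \<in> S"
  shows "bilinear K A A (tensor_over_module K A S) (pure_tensor_over A S)"
proof -
  let ?T = "tensor_over_module K A S" and ?p = "pure_tensor_over A S"
  have p: "?p = bal.bp" by (simp add: pure_tensor_over_def fun_eq_iff)
  note b = bal.pure_balanced[unfolded balanced_map_def, folded tensor_over_module_structure, folded p]
  have s: "?p (c \<odot>\<^bsub>A\<^esub> m) n = c \<odot>\<^bsub>?T\<^esub> ?p m n"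
    if "c \<in> carrier K" "m \<in> carrier A" "n \<in> carrier A" for c m n
    using bal.smult_pure[OF tensor_over_module_structure that] by (simp add: p)
  moreover have "?p m (c \<odot>\<^bsub>A\<^esub> n) = c \<odot>\<^bsub>?T\<^esub> ?p m n"
    if "c \<in> carrier K" "m \<in> carrier A" "n \<in> carrier A" for c m n
    using s[OF that] pure_tensor_over_balanced[OF that(2,3) scal[OF that(1)]] that
    by (simp add: A.smult_mult_left A.smult_mult_right)
  moreover have "?p (m \<oplus>\<^bsub>A\<^esub> m') n = ?p m n \<oplus>\<^bsub>?T\<^esub> ?p m' n"
    if "m \<in> carrier A" "m' \<in> carrier A" "n \<in> carrier A" for m m' n
    using that b by simp
  moreover have "?p m (n \<oplus>\<^bsub>A\<^esub> n') = ?p m n \<oplus>\<^bsub>?T\<^esub> ?p m n'"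
    if "m \<in> carrier A" "n \<in> carrier A" "n' \<in> carrier A" for m n n'
    using that b by simp
  moreover have "?p m n \<in> carrier ?T"
    if "m \<in> carrier A" "n \<in> carrier A" for m n
    using that b by simp
  ultimately show ?thesis
    by (intro bilinearI linear_homI)
qed

lemma tensor_over_lift_same:
  "tensor_lift (tensor_over A S) F = lift_to (tensor_over_module K A S) F"
  by (rule tensor_lift_same_operations) (simp_all add: tensor_over_module_def)

lemma tensor_over_hom:
  assumes G: "comm_group G" and F: "balanced_map S (\<lambda>a s. a \<otimes>\<^bsub>A\<^esub> s) (\<lambda>s a. s \<otimes>\<^bsub>A\<^esub> a) A A G F"
  shows "tensor_lift G F \<in> hom (add_monoid (tensor_over_module K A S)) G"
    and "\<lbrakk>a \<in> carrier A; b \<in> carrier A\<rbrakk> \<Longrightarrow> tensor_lift G F (pure_tensor_over A S a b) = F a b"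
  using bal.tensor_lift_hom[OF G F] bal.tensor_lift_pure[OF G F]
  by (simp_all add: hom_def tensor_over_module_structure pure_tensor_over_def)

end

section \<open>Coinvariants and the coaction\<close>

context quotient_comodule_algebra
begin

lemma regular_quotient: "quotient_comodule_algebra K H \<Delta> \<epsilon> antipode H \<Delta> I"
  unfolding quotient_comodule_algebra_def quotient_comodule_algebra_axioms_def
  using regular_comodule_algebra ideal_coideal by simp

abbreviation Kc where "Kc \<equiv> quot_coinvariants K H H \<Delta> I"
abbreviation RK where "RK \<equiv> subtensor K A H (carrier A) Kc"

lemma Kc_subset: "Kc \<subseteq> carrier H"
  by (rule quotient_comodule_algebra.S_subset[OF regular_quotient])

lemma Kc_submodule: "submodule Kc K H"
  and Kc_one: "\<one>\<^bsub>H\<^esub> \<in> Kc"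
proof -
  have *: "subring Kc H" "\<forall>c\<in>carrier K. \<forall>s\<in>Kc. c \<odot>\<^bsub>H\<^esub> s \<in> Kc"
    using quotient_comodule_algebra.S_sub_algebra[OF regular_quotient] by (simp_all add: Sub_Alg_def)
  show "\<one>\<^bsub>H\<^esub> \<in> Kc" using subringE(3)[OF *(1)] .
  show "submodule Kc K H"
    by (rule H.submoduleI) (use * subringE[OF *(1)] in auto)
qed

text \<open>Applying \<open>\<epsilon> \<otimes> id\<close> to \<open>k\<^sub>1 \<otimes> \<pi>(k\<^sub>2) = k \<otimes> \<pi>(1)\<close> gives \<open>\<pi>(k) = \<epsilon>(k) \<pi>(1)\<close>.\<close>

lemma Kc_counit:
  assumes k: "k \<in> Kc"
  shows "\<epsilon> k \<odot>\<^bsub>H\<^esub> \<one>\<^bsub>H\<^esub> \<ominus>\<^bsub>H\<^esub> k \<in> I"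
proof -
  let ?c = "\<lambda>t. lift_to H (\<lambda>h1 h2. \<epsilon> h1 \<odot>\<^bsub>H\<^esub> h2) t"
  have kc: "k \<in> carrier H" using k Kc_subset by blast
  have b: "bilinear K H H H (\<lambda>h1 h2. \<epsilon> h1 \<odot>\<^bsub>H\<^esub> h2)" by (rule hopf_rules | assumption)+
  note c = HH.lift_linear[OF H_mod b]
  have mem: "?c t \<in> I" if t: "t \<in> subtensor K H H (carrier H) I" for t
  proof (rule HH.subtensor_linear_image[OF order_refl I_subset H_mod c _ _ t])
    show "subgroup I (add_monoid H)" using I_submodule by (simp add: submodule_def)
    show "?c (pure_tensor K H H u v) \<in> I" if "u \<in> carrier H" "v \<in> I" for u v
      using that I_subset H.submoduleE(4)[OF I_submodule counit_closed[OF that(1)] that(2)]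
      by (simp add: HH.lift_pure[OF H_mod b] subset_iff)
  qed
  have "\<Delta> k \<ominus>\<^bsub>HH\<^esub> pure_tensor K H H k \<one>\<^bsub>H\<^esub> \<in> subtensor K H H (carrier H) I"
    using k quotient_comodule_algebra.coinv_iff[OF regular_quotient] by blast
  from mem[OF this] have "k \<ominus>\<^bsub>H\<^esub> \<epsilon> k \<odot>\<^bsub>H\<^esub> \<one>\<^bsub>H\<^esub> \<in> I"
    using kc linear_hom_diff[OF HH_mod H_mod c comult_closed[OF kc] HH.pure_tensor_closed[OF kc H.one_closed]]
    by (simp add: HH.lift_pure[OF H_mod b] counit_left)
  from H.submoduleE(3)[OF I_submodule this] show ?thesis
    using kc counit_closed[OF kc] by (simp add: a_minus_def H.minus_add H.a_comm)
qed

text \<open>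
  By definition \<open>H\<^sup>c\<^sup>o\<^sup>Q\<close> is the kernel of \<open>f(h) = h\<^sub>1 \<otimes> \<pi>(h\<^sub>2) - h \<otimes> \<pi>(1)\<close>, so by exactness \<open>A \<otimes> H\<^sup>c\<^sup>o\<^sup>Q\<close> is the kernel
  of \<open>id \<otimes> f\<close>, and \<open>id \<otimes> f\<close> vanishes at \<open>\<delta>(a)\<close> by coassociativity.
\<close>

lemma coaction_coinvariants:
  assumes a: "a \<in> S"
  shows "\<delta> a \<in> RK"
proof -
  let ?HQ = "tensor K H Q"
  let ?f1 = "\<lambda>h. tensor_map K H Q (\<lambda>x. x) \<pi> (\<Delta> h)"
  let ?f2 = "\<lambda>h. pure_tensor K H Q h (\<pi> \<one>\<^bsub>H\<^esub>)"
  let ?f = "\<lambda>h. ?f1 h \<ominus>\<^bsub>?HQ\<^esub> ?f2 h"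
  let ?AHQ = "tensor K A ?HQ"
  have ac: "a \<in> carrier A" using a S_subset by blast
  have HQ: "module K ?HQ" by (rule tensor_module[OF H_mod Q_mod])
  interpret AHQ: ground_pair K A ?HQ by (rule ground_pairI[OF A_mod HQ])
  interpret AQg: ground_pair K A Q by (rule ground_pairI[OF A_mod Q_mod])
  have p1: "\<pi> \<one>\<^bsub>H\<^esub> \<in> carrier Q" by (rule linear_hom_closed[OF proj_linear H.one_closed])
  note com_rules = linear_hom_comp[OF _ proj_linear] comod_linear_intros comod_closed pure_closed Q_mod linear_hom_closed[OF proj_linear]
  have bm: "bilinear K H H ?HQ (\<lambda>h k. pure_tensor K H Q h (\<pi> k))"
    by (rule com_rules | assumption)+
  have f1: "?f1 \<in> linear_hom K H ?HQ"
    by (rule linear_hom_comp[OF comult_linear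
        tensor_map_linear[OF H_mod H_mod H_mod Q_mod linear_hom_ident proj_linear]])
  have f2: "?f2 \<in> linear_hom K H ?HQ"
    by (rule com_rules p1 | assumption)+
  have f: "?f \<in> linear_hom K H ?HQ"
    by (rule linear_hom_pointwise_diff[OF HQ f1 f2])
  have ker: "{h \<in> carrier H. ?f h = \<zero>\<^bsub>?HQ\<^esub>} = Kc"
    using diff_zero_iff[OF HQ linear_hom_closed[OF f1] linear_hom_closed[OF f2]]
    by (auto simp: quot_coinvariants_def)
  have bL: "bilinear K A Q ?AHQ (\<lambda>x q. lift_to ?AHQ
      (\<lambda>y g. pure_tensor K A ?HQ y (pure_tensor K H Q g q)) (\<delta> x))"
    by (rule com_rules HQ | assumption)+
  let ?L = "lift_to ?AHQ (\<lambda>x q. lift_to ?AHQ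
      (\<lambda>y g. pure_tensor K A ?HQ y (pure_tensor K H Q g q)) (\<delta> x))"
  have L: "?L \<in> linear_hom K AQ ?AHQ" by (rule AQg.lift_linear[OF AHQ.tensor_module bL])
  let ?F = "\<lambda>x g k. pure_tensor K A ?HQ x (pure_tensor K H Q g (\<pi> k))"
  let ?m = "\<lambda>f. tensor_map K A ?HQ (\<lambda>x. x) f"
  have m: "?m g \<in> linear_hom K AH ?AHQ" if "g \<in> linear_hom K H ?HQ" for g
    by (rule tensor_map_linear[OF A_mod H_mod A_mod HQ linear_hom_ident that])
  have mp: "?m g (pure_tensor K A H x h) = pure_tensor K A ?HQ x (g h)"
    if "g \<in> linear_hom K H ?HQ" "x \<in> carrier A" "h \<in> carrier H" for g x h
    by (rule tensor_map_pure[OF A_mod H_mod A_mod HQ linear_hom_ident that])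
  have bF: "bilinear K H H ?AHQ (\<lambda>g k. ?F x g k)" if "x \<in> carrier A" for x
    by (rule com_rules HQ that | assumption)+
  have b1: "bilinear K A H ?AHQ (\<lambda>x h. lift_to ?AHQ (\<lambda>g k. ?F x g k) (\<Delta> h))"
    by (rule com_rules HQ | assumption)+
  have b2: "bilinear K A H ?AHQ (\<lambda>x h. lift_to ?AHQ (\<lambda>y g. ?F y g h) (\<delta> x))"
    by (rule com_rules HQ | assumption)+
  \<comment> \<open>In Sweedler notation: \<open>a\<^sub>0 \<otimes> a\<^sub>1 \<otimes> \<pi>(a\<^sub>2) = (\<delta> \<otimes> id)(a\<^sub>0 \<otimes> \<pi>(a\<^sub>1)) = (\<delta> \<otimes> id)(a \<otimes> \<pi>(1)) = a\<^sub>0 \<otimes> a\<^sub>1 \<otimes> \<pi>(1)\<close>.\<close>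
  have "?m ?f1 (\<delta> a) = lift_to ?AHQ (\<lambda>x h. lift_to ?AHQ (\<lambda>g k. ?F x g k) (\<Delta> h)) (\<delta> a)"
  proof (rule AH.linear_ext[OF m[OF f1] AH.lift_linear[OF AHQ.tensor_module b1] _ coaction_closed[OF ac]])
    fix x h assume x: "x \<in> carrier A" and h: "h \<in> carrier H"
    have "pure_tensor K A ?HQ x (?f1 h) = lift_to ?AHQ (\<lambda>g k. ?F x g k) (\<Delta> h)"
      unfolding tensor_map_def
      by (rule HH.lift_comp[where \<phi> = "\<lambda>w. pure_tensor K A ?HQ x w", OF HQ bm _ AHQ.tensor_module comult_closed[OF h]])
         (rule com_rules HQ x)+
    then show "?m ?f1 (pure_tensor K A H x h) =
      lift_to ?AHQ (\<lambda>x h. lift_to ?AHQ (\<lambda>g k. ?F x g k) (\<Delta> h)) (pure_tensor K A H x h)"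
      using x h by (simp add: mp[OF f1] AH.lift_pure[OF AHQ.tensor_module b1])
  qed
  also have "\<dots> = lift_to ?AHQ (\<lambda>x h. lift_to ?AHQ (\<lambda>y g. ?F y g h) (\<delta> x)) (\<delta> a)"
    by (rule coassoc_trilinear[symmetric, where F = ?F]) (rule com_rules HQ ac | assumption)+
  also have "\<dots> = ?L (id_proj (\<delta> a))"
  proof (rule AH.linear_ext[OF AH.lift_linear[OF AHQ.tensor_module b2] linear_hom_comp[OF id_proj_linear L] _ coaction_closed[OF ac]])
    fix x h assume x: "x \<in> carrier A" and h: "h \<in> carrier H"
    then show "lift_to ?AHQ (\<lambda>x h. lift_to ?AHQ (\<lambda>y g. ?F y g h) (\<delta> x)) (pure_tensor K A H x h)
      = ?L (id_proj (pure_tensor K A H x h))"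
      by (simp add: AH.lift_pure[OF AHQ.tensor_module b2] id_proj_pure AQg.lift_pure[OF AHQ.tensor_module bL]
          linear_hom_closed[OF proj_linear])
  qed
  also have "id_proj (\<delta> a) = pure_tensor K A Q a (\<pi> \<one>\<^bsub>H\<^esub>)"
    using a by (simp add: quot_coinvariants_def)
  also have "?L (pure_tensor K A Q a (\<pi> \<one>\<^bsub>H\<^esub>)) =
    lift_to ?AHQ (\<lambda>y g. pure_tensor K A ?HQ y (pure_tensor K H Q g (\<pi> \<one>\<^bsub>H\<^esub>))) (\<delta> a)"
    by (rule AQg.lift_pure[OF AHQ.tensor_module bL ac p1])
  also have "\<dots> = ?m ?f2 (\<delta> a)"
    unfolding tensor_map_def ..
  finally have eq: "?m ?f1 (\<delta> a) = ?m ?f2 (\<delta> a)" .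
  have "?m ?f (\<delta> a) = ?m ?f1 (\<delta> a) \<ominus>\<^bsub>?AHQ\<^esub> ?m ?f2 (\<delta> a)"
  proof (rule AH.linear_ext[OF m[OF f] linear_hom_pointwise_diff[OF AHQ.tensor_module m[OF f1] m[OF f2]] _ coaction_closed[OF ac]])
    fix x h assume x: "x \<in> carrier A" and h: "h \<in> carrier H"
    show "?m ?f (pure_tensor K A H x h) = ?m ?f1 (pure_tensor K A H x h) \<ominus>\<^bsub>?AHQ\<^esub> ?m ?f2 (pure_tensor K A H x h)"
      unfolding mp[OF f x h] mp[OF f1 x h] mp[OF f2 x h]
      by (rule linear_hom_diff[OF HQ AHQ.tensor_module bilinear_right[OF AHQ.pure_bilinear x]
            linear_hom_closed[OF f1 h] linear_hom_closed[OF f2 h]])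
  qed
  also have "\<dots> = \<zero>\<^bsub>?AHQ\<^esub>"
    using diff_zero_iff[OF AHQ.tensor_module] eq linear_hom_closed[OF m coaction_closed[OF ac]] f1 f2 by simp
  finally show ?thesis
    using AH.tensor_map_kernel[OF field_axioms HQ f coaction_closed[OF ac]] unfolding ker by simp
qed

end

section \<open>The map \<open>\<delta> \<otimes> \<delta>\<close>\<close>

context quotient_comodule_algebra
begin

abbreviation TM where "TM \<equiv> tensor_over_module K AH RK"
abbreviation pT where "pT \<equiv> pure_tensor_over AH RK"
abbreviation coact_sum where "coact_sum x \<equiv> frag_lift (add_monoid TM) (\<lambda>a b. pT (\<delta> a) (\<delta> b)) x"

lemmas RK_pure = AH.subtensor_pure[OF order_refl Kc_subset]
  and RK_closed = AH.subtensor_closed[OF order_refl Kc_subset]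

lemma RK_subset: "RK \<subseteq> carrier AH"
  using RK_closed by blast

lemma em_RK: "a \<in> carrier A \<Longrightarrow> em a \<in> RK"
  by (rule RK_pure[OF _ Kc_one])

lemma TM_mod: "module K TM"
  by (rule tensor_over_module[OF AH.tensor_algebra RK_subset])

lemma pT_bilinear: "bilinear K AH AH TM pT"
proof (rule pure_tensor_over_bilinear[OF AH.tensor_algebra RK_subset])
  fix c assume c: "c \<in> carrier K"
  have "c \<odot>\<^bsub>AH\<^esub> \<one>\<^bsub>AH\<^esub> = em (c \<odot>\<^bsub>A\<^esub> \<one>\<^bsub>A\<^esub>)"
    using linear_hom_smult[OF em_linear c A.one_closed] by (simp add: tensor_simps)
  then show "c \<odot>\<^bsub>AH\<^esub> \<one>\<^bsub>AH\<^esub> \<in> RK" using c em_RK by simp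
qed

lemmas pT_balanced = pure_tensor_over_balanced[OF AH.tensor_algebra RK_subset]
lemmas pT_closed = bilinear_closed[OF pT_bilinear]

text \<open>
  An element \<open>\<delta>(s)\<close> with \<open>s\<close> in \<open>S\<close> may cross the tensor sign because it lies in \<open>A \<otimes> H\<^sup>c\<^sup>o\<^sup>Q\<close>.
\<close>

lemma coact_sum_balanced:
  "balanced_map S (\<lambda>a s. a \<otimes>\<^bsub>A\<^esub> s) (\<lambda>s a. s \<otimes>\<^bsub>A\<^esub> a) A A (add_monoid TM) (\<lambda>a b. pT (\<delta> a) (\<delta> b))"
proof -
  have "bilinear K A A TM (\<lambda>a b. pT (\<delta> a) (\<delta> b))"
    by (rule bilinearI linear_hom_comp[OF coaction_linear bilinear_left[OF pT_bilinear]]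
        linear_hom_comp[OF coaction_linear bilinear_right[OF pT_bilinear]] coaction_closed | assumption)+
  from bilinear_balanced_map[OF this]
  show ?thesis
    using S_subset coaction_coinvariants unfolding balanced_map_def
    by (auto simp: coaction_mult pT_balanced coaction_closed subset_iff)
qed

lemma tensor_map_over_inj_iff:
  "inj_on (tensor_map_over AH RK \<delta> \<delta>) (carrier (tensor_over A S)) \<longleftrightarrow>
     (\<forall>x\<in>carrier FA. coact_sum x = \<zero>\<^bsub>TM\<^esub> \<longrightarrow> x \<in> KerS S)"
proof -
  interpret T: balanced_pair S "\<lambda>a s. a \<otimes>\<^bsub>A\<^esub> s" "\<lambda>s a. s \<otimes>\<^bsub>A\<^esub> a" A A by (rule over_pair[OF S_subset])
  have G: "comm_group (add_monoid TM)" by (rule module_comm_group[OF TM_mod])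
  let ?d = "tensor_map_over AH RK \<delta> \<delta>"
  have d: "?d = lift_to TM (\<lambda>a b. pT (\<delta> a) (\<delta> b))"
    unfolding tensor_map_over_def by (rule tensor_over_lift_same[OF AH.tensor_algebra RK_subset])
  interpret d: group_hom "tensor_over A S" "add_monoid TM" ?d
    using T.tensor_lift_hom[OF G coact_sum_balanced] T.BT_comm_group G
    by (simp add: group_hom_def group_hom_axioms_def tensor_over_def comm_group_def d)
  have c: "?d (KerS S #>\<^bsub>FA\<^esub> x) = coact_sum x" if "x \<in> carrier FA" for x
    unfolding d by (rule T.tensor_lift_coset[OF G coact_sum_balanced that])
  have "inj_on ?d (carrier (tensor_over A S)) \<longleftrightarrow>
     (\<forall>t\<in>carrier (tensor_over A S). ?d t = \<zero>\<^bsub>TM\<^esub> \<longrightarrow> t = \<one>\<^bsub>tensor_over A S\<^esub>)"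
    using d.inj_on_one_iff by auto
  also have "\<dots> \<longleftrightarrow> (\<forall>x\<in>carrier FA. coact_sum x = \<zero>\<^bsub>TM\<^esub> \<longrightarrow> x \<in> KerS S)"
    unfolding tensor_over_carrier[OF S_subset]
    using c T.coset_eq_one_iff by (simp add: tensor_over_def)
  finally show ?thesis .
qed

text \<open>\<open>id \<otimes> \<epsilon>\<close> retracts the coaction.\<close>

definition retract where
  "retract t = lift_to A (\<lambda>a h. \<epsilon> h \<odot>\<^bsub>A\<^esub> a) t"

lemma retract_bilinear: "bilinear K A H A (\<lambda>a h. \<epsilon> h \<odot>\<^bsub>A\<^esub> a)"
  by (rule comod_linear_intros comod_closed | assumption)+

lemma retract_linear: "(\<lambda>t. retract t) \<in> linear_hom K AH A"
  unfolding retract_def by (rule AH.lift_linear[OF A_mod retract_bilinear])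

lemma retract_pure: "\<lbrakk>a \<in> carrier A; h \<in> carrier H\<rbrakk> \<Longrightarrow> retract (pure_tensor K A H a h) = \<epsilon> h \<odot>\<^bsub>A\<^esub> a"
  unfolding retract_def by (rule AH.lift_pure[OF A_mod retract_bilinear])

lemma retract_coaction: "a \<in> carrier A \<Longrightarrow> retract (\<delta> a) = a"
  unfolding retract_def by (rule coaction_counit)

lemmas retract_closed = linear_hom_closed[OF retract_linear]

lemma retract_mult:
  assumes t: "t \<in> carrier AH" and u: "u \<in> carrier AH"
  shows "retract (t \<otimes>\<^bsub>AH\<^esub> u) = retract t \<otimes>\<^bsub>A\<^esub> retract u"
  using t
proof (induction rule: AH.ground_induct)
  case (pure a h)
  show ?case
    using u
  proof (induction rule: AH.ground_induct)
    case p: (pure b g)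
    have "\<epsilon> (h \<cdot> g) = \<epsilon> h \<otimes>\<^bsub>K\<^esub> \<epsilon> g" using ring_hom_mult[OF counit_hom] pure p by simp
    moreover have "\<epsilon> h \<odot>\<^bsub>A\<^esub> (\<epsilon> g \<odot>\<^bsub>A\<^esub> (a \<otimes>\<^bsub>A\<^esub> b)) = \<epsilon> g \<odot>\<^bsub>A\<^esub> (\<epsilon> h \<odot>\<^bsub>A\<^esub> (a \<otimes>\<^bsub>A\<^esub> b))"
      using pure p counit_closed m_comm[of "\<epsilon> h" "\<epsilon> g"] by (simp flip: A.smult_assoc1)
    ultimately show ?case
      using pure p counit_closed
      by (simp add: AH.tensor_mult_pure retract_pure A.smult_mult_left A.smult_mult_right A.smult_assoc1)
  next
    case (add t u)
    then show ?case
      using pure by (simp add: AHa.r_distr linear_hom_add[OF retract_linear] retract_closed A.r_distr AH.pure_tensor_closed)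
  qed
next
  case (add t v)
  then show ?case
    using u by (simp add: AHa.l_distr linear_hom_add[OF retract_linear] retract_closed A.l_distr)
qed

text \<open>
  A pure tensor \<open>a \<otimes> k\<close> differs from \<open>\<epsilon>(k) a \<otimes> 1\<close> by \<open>a \<otimes> (k - \<epsilon>(k) 1)\<close>. The lemma is applied with \<open>J = I\<close> and with the
  right ideal generated by the elements of \<open>H\<^sup>c\<^sup>o\<^sup>Q\<close> of counit \<open>0\<close>.
\<close>

lemma retract_RK:
  assumes J: "J \<subseteq> carrier H" and JK: "\<And>k. k \<in> Kc \<Longrightarrow> \<epsilon> k \<odot>\<^bsub>H\<^esub> \<one>\<^bsub>H\<^esub> \<ominus>\<^bsub>H\<^esub> k \<in> J" and r: "r \<in> RK"
  shows "em (retract r) \<ominus>\<^bsub>AH\<^esub> r \<in> subtensor K A H (carrier A) J" (is "_ \<in> ?N")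
proof -
  let ?g = "\<lambda>r. em (retract r) \<ominus>\<^bsub>AH\<^esub> r"
  have g: "?g \<in> linear_hom K AH AH"
    by (rule linear_hom_pointwise_diff[OF AH_mod linear_hom_comp[OF retract_linear em_linear] linear_hom_ident])
  show ?thesis
  proof (rule AH.subtensor_linear_image[OF order_refl Kc_subset AH_mod g AH.subtensor_subgroup[OF order_refl J] _ r])
    show "?g (pure_tensor K A H a k) \<in> ?N" if a: "a \<in> carrier A" and k: "k \<in> Kc" for a k
    proof -
      have kc: "k \<in> carrier H" using k Kc_subset by blast
      have "em (\<epsilon> k \<odot>\<^bsub>A\<^esub> a) = pure_tensor K A H a (\<epsilon> k \<odot>\<^bsub>H\<^esub> \<one>\<^bsub>H\<^esub>)"
        using a counit_closed[OF kc] linear_hom_smult[OF em_linear]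
          linear_hom_smult[OF bilinear_right[OF AH.pure_bilinear a]] by simp
      then have "?g (pure_tensor K A H a k) = pure_tensor K A H a (\<epsilon> k \<odot>\<^bsub>H\<^esub> \<one>\<^bsub>H\<^esub> \<ominus>\<^bsub>H\<^esub> k)"
        using a kc counit_closed[OF kc] linear_hom_diff[OF H_mod AH_mod bilinear_right[OF AH.pure_bilinear a]]
        by (simp add: retract_pure)
      then show ?thesis using AH.subtensor_pure[OF order_refl J a JK[OF k]] by simp
    qed
  qed
qed

text \<open>
  The canonical map of \<open>Q\<close> factors through \<open>\<delta> \<otimes> \<delta>\<close>, by way of
  \<open>t \<otimes> u \<mapsto> (id \<otimes> \<pi>) (((id \<otimes> \<epsilon>)(t) \<otimes> 1) u)\<close>. This is balanced over \<open>A \<otimes> H\<^sup>c\<^sup>o\<^sup>Q\<close>, because \<open>id \<otimes> \<epsilon>\<close> is multiplicative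
  and its value at \<open>r\<close> differs from \<open>r\<close> by an element of \<open>A \<otimes> I\<close>.
\<close>

lemma coact_sum_zero_canon_sum:
  assumes x: "x \<in> carrier FA" and 0: "coact_sum x = \<zero>\<^bsub>TM\<^esub>"
  shows "canon_sum x \<in> NI"
proof -
  let ?F = "\<lambda>t u. id_proj (em (retract t) \<otimes>\<^bsub>AH\<^esub> u)"
  have bF: "bilinear K AH AH AQ ?F"
  proof (rule bilinearI)
    show "(\<lambda>u. ?F t u) \<in> linear_hom K AH AQ" if "t \<in> carrier AH" for t
      by (rule linear_hom_comp[OF _ id_proj_linear], rule linear_mult_right[OF linear_hom_ident AH.tensor_algebra])
         (use that in \<open>simp add: em_closed retract_closed\<close>)
    show "(\<lambda>t. ?F t u) \<in> linear_hom K AH AQ" if "u \<in> carrier AH" for u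
      by (rule linear_hom_comp[OF linear_mult_left[OF linear_hom_comp[OF retract_linear em_linear] AH.tensor_algebra that] id_proj_linear])
  qed
  have "?F (t \<otimes>\<^bsub>AH\<^esub> r) u = ?F t (r \<otimes>\<^bsub>AH\<^esub> u)" if "t \<in> carrier AH" "u \<in> carrier AH" "r \<in> RK" for t r u
  proof -
    have r: "r \<in> carrier AH" using that RK_closed by blast
    have c: "em (retract t) \<in> carrier AH" "em (retract r) \<in> carrier AH"
      using that r by (auto simp: em_closed retract_closed)
    have "em (retract (t \<otimes>\<^bsub>AH\<^esub> r)) \<otimes>\<^bsub>AH\<^esub> u \<ominus>\<^bsub>AH\<^esub> em (retract t) \<otimes>\<^bsub>AH\<^esub> (r \<otimes>\<^bsub>AH\<^esub> u) =
      em (retract t) \<otimes>\<^bsub>AH\<^esub> ((em (retract r) \<ominus>\<^bsub>AH\<^esub> r) \<otimes>\<^bsub>AH\<^esub> u)"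
      using that r c by (simp add: retract_mult em_mult retract_closed a_minus_def AHa.l_distr AHa.r_distr
          AHa.l_minus AHa.r_minus AHa.m_assoc)
    also have "\<dots> \<in> NI"
      using that r by (intro NI_left NI_right retract_RK I_subset Kc_counit) (auto simp: retract_closed)
    finally show ?thesis
      using that r c by (subst id_proj_eq_iff) (auto simp: em_closed retract_closed)
  qed
  then have bal: "balanced_map RK (\<lambda>a s. a \<otimes>\<^bsub>AH\<^esub> s) (\<lambda>s a. s \<otimes>\<^bsub>AH\<^esub> a) AH AH (add_monoid AQ) ?F"
    using bilinear_balanced_map[OF bF] unfolding balanced_map_def by simp
  note h = tensor_over_hom[OF AH.tensor_algebra RK_subset module_comm_group[OF AQ_mod] bal]
  let ?\<Phi> = "lift_to AQ ?F"
  have "?\<Phi> (coact_sum x) = frag_lift (add_monoid AQ) (\<lambda>a b. ?\<Phi> (pT (\<delta> a) (\<delta> b))) x"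
    by (rule frag_lift_comp[where S = "carrier A \<times> carrier A"])
       (use x h TM_mod AQ_mod pT_closed coaction_closed in \<open>auto intro: module_comm_group\<close>)
  also have "\<dots> = frag_lift (add_monoid AQ) (\<lambda>a b. id_proj (canon a b)) x"
    by (rule frag_lift_cong[OF module_comm_group[OF AQ_mod], where S = "carrier A \<times> carrier A"])
       (use x in \<open>auto simp: h coaction_closed retract_coaction em_closed linear_hom_closed[OF id_proj_linear]\<close>)
  also have "\<dots> = id_proj (canon_sum x)"
    by (rule frag_lift_comp[symmetric, where S = "carrier A \<times> carrier A"])
       (use x AH_mod AQ_mod canon_closed id_proj_linear in \<open>auto intro: module_comm_group simp: linear_hom_def\<close>)
  finally have "id_proj (canon_sum x) = ?\<Phi> \<zero>\<^bsub>TM\<^esub>" using 0 by simp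
  also have "\<dots> = \<zero>\<^bsub>AQ\<^esub>"
    using group_hom.hom_one[of "add_monoid TM" "add_monoid AQ" ?\<Phi>] h(1) module_comm_group[OF TM_mod]
      module_comm_group[OF AQ_mod]
    by (simp add: group_hom_def group_hom_axioms_def comm_group_def)
  finally show ?thesis using id_proj_zero_iff[OF canon_sum_closed[OF x]] by simp
qed

section \<open>Recovering \<open>\<delta> \<otimes> \<delta>\<close> from the canonical map\<close>

abbreviation eh where "eh h \<equiv> pure_tensor K A H \<one>\<^bsub>A\<^esub> h"

lemma eh_closed: "h \<in> carrier H \<Longrightarrow> eh h \<in> carrier AH"
  by (simp add: AH.pure_tensor_closed)

lemma eh_mult: "\<lbrakk>g \<in> carrier H; h \<in> carrier H\<rbrakk> \<Longrightarrow> eh g \<otimes>\<^bsub>AH\<^esub> eh h = eh (g \<cdot> h)"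
  by (simp add: AH.tensor_mult_pure)

lemma em_eh: "\<lbrakk>a \<in> carrier A; h \<in> carrier H\<rbrakk> \<Longrightarrow> em a \<otimes>\<^bsub>AH\<^esub> eh h = pure_tensor K A H a h"
  by (simp add: AH.tensor_mult_pure)

lemma pT_left_linear: "\<lbrakk>f \<in> linear_hom K L AH; u \<in> carrier AH\<rbrakk> \<Longrightarrow> (\<lambda>x. pT (f x) u) \<in> linear_hom K L TM"
  by (rule linear_hom_comp[OF _ bilinear_left[OF pT_bilinear]])

lemma pT_right_linear: "\<lbrakk>f \<in> linear_hom K L AH; u \<in> carrier AH\<rbrakk> \<Longrightarrow> (\<lambda>x. pT u (f x)) \<in> linear_hom K L TM"
  by (rule linear_hom_comp[OF _ bilinear_right[OF pT_bilinear]])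

lemmas TM_rules = pT_left_linear pT_right_linear comod_linear_intros comod_closed TM_mod AHa.m_closed

text \<open>
  By coassociativity \<open>x\<^sub>0 \<otimes> x\<^sub>1 \<sigma>(x\<^sub>2) = x\<^sub>0 \<otimes> \<epsilon>(x\<^sub>1) 1 = x \<otimes> 1\<close>, where \<open>\<sigma>\<close> is the antipode.
\<close>

lemma coaction_antipode:
  assumes x: "x \<in> carrier A"
  shows "lift_to AH (\<lambda>y g. \<delta> y \<otimes>\<^bsub>AH\<^esub> eh (antipode g)) (\<delta> x) = em x"
proof -
  let ?l = "lift_to AH"
  have b: "bilinear K A H AH (\<lambda>y g. \<delta> y \<otimes>\<^bsub>AH\<^esub> eh (antipode g))" by (rule TM_rules | assumption)+
  have "?l (\<lambda>y g. \<delta> y \<otimes>\<^bsub>AH\<^esub> eh (antipode g)) (\<delta> x) =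
    ?l (\<lambda>y g. ?l (\<lambda>u v. pure_tensor K A H u (v \<cdot> antipode g)) (\<delta> y)) (\<delta> x)"
  proof (rule AH.lift_cong[OF AH_mod b coaction_closed[OF x]])
    fix y g assume y: "y \<in> carrier A" and g: "g \<in> carrier H"
    have m: "(\<lambda>t. t \<otimes>\<^bsub>AH\<^esub> eh (antipode g)) \<in> linear_hom K AH AH" by (rule TM_rules g)+
    have "\<delta> y \<otimes>\<^bsub>AH\<^esub> eh (antipode g) = ?l (\<lambda>u v. pure_tensor K A H u v \<otimes>\<^bsub>AH\<^esub> eh (antipode g)) (\<delta> y)"
      by (rule AH.lift_unique[OF AH_mod m coaction_closed[OF y]])
    also have "\<dots> = ?l (\<lambda>u v. pure_tensor K A H u (v \<cdot> antipode g)) (\<delta> y)"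
      by (rule AH.lift_cong[OF AH_mod AH.bilinear_comp[OF AH_mod AH.pure_bilinear m] coaction_closed[OF y]])
         (use g in \<open>simp add: AH.tensor_mult_pure antipode_closed\<close>)
    finally show "\<delta> y \<otimes>\<^bsub>AH\<^esub> eh (antipode g) = \<dots>" .
  qed
  also have "\<dots> = ?l (\<lambda>u h. ?l (\<lambda>v g. pure_tensor K A H u (v \<cdot> antipode g)) (\<Delta> h)) (\<delta> x)"
    by (rule coassoc_trilinear[where F = "\<lambda>u v g. pure_tensor K A H u (v \<cdot> antipode g)"])
       (rule TM_rules x | assumption)+
  also have "\<dots> = ?l (\<lambda>u h. em (\<epsilon> h \<odot>\<^bsub>A\<^esub> u)) (\<delta> x)"
  proof (rule AH.lift_cong[OF AH_mod _ coaction_closed[OF x]])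
    show "bilinear K A H AH (\<lambda>u h. ?l (\<lambda>v g. pure_tensor K A H u (v \<cdot> antipode g)) (\<Delta> h))"
      by (rule TM_rules | assumption)+
    fix u h assume u: "u \<in> carrier A" and h: "h \<in> carrier H"
    have "?l (\<lambda>v g. pure_tensor K A H u (v \<cdot> antipode g)) (\<Delta> h) =
      pure_tensor K A H u (Sw (\<Delta> h) (\<lambda>v g. v \<cdot> antipode g))"
      by (rule HH.lift_comp[symmetric, where \<phi> = "\<lambda>w. pure_tensor K A H u w"]) (rule TM_rules u h | assumption)+
    then show "?l (\<lambda>v g. pure_tensor K A H u (v \<cdot> antipode g)) (\<Delta> h) = em (\<epsilon> h \<odot>\<^bsub>A\<^esub> u)"
      using u h counit_closed linear_hom_smult[OF em_linear] linear_hom_smult[OF bilinear_right[OF AH.pure_bilinear u]]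
      by (simp add: antipode_right)
  qed
  also have "\<dots> = em (retract (\<delta> x))"
    unfolding retract_def
    by (rule AH.lift_comp[OF A_mod retract_bilinear em_linear AH_mod coaction_closed[OF x], symmetric])
  finally show ?thesis by (simp only: retract_coaction[OF x])
qed

abbreviation xi where
  "xi a h \<equiv> lift_to TM (\<lambda>h1 h2. pT (\<delta> a \<otimes>\<^bsub>AH\<^esub> eh (antipode h1)) (eh h2)) (\<Delta> h)"

lemma xi_bilinear: "bilinear K A H TM xi"
  by (rule TM_rules | assumption)+

abbreviation Xi where "Xi \<equiv> lift_to TM xi"

lemma Xi_linear: "Xi \<in> linear_hom K AH TM"
  by (rule AH.lift_linear[OF TM_mod xi_bilinear])

text \<open>
  In Sweedler notation \<open>\<Xi>((a \<otimes> 1) \<delta>(b))\<close> is \<open>\<delta>(a) \<delta>(b\<^sub>0) (1 \<otimes> \<sigma>(b\<^sub>1)) \<otimes> (1 \<otimes> b\<^sub>2) = \<delta>(a) (b\<^sub>0 \<otimes> 1) \<otimes> (1 \<otimes> b\<^sub>1)\<close>, where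
  \<open>\<sigma>\<close> is the antipode; and \<open>b\<^sub>0 \<otimes> 1\<close> may cross the tensor sign, which gives \<open>\<delta>(a) \<otimes> \<delta>(b)\<close>.
\<close>

lemma Xi_canon:
  assumes a: "a \<in> carrier A" and b: "b \<in> carrier A"
  shows "Xi (canon a b) = pT (\<delta> a) (\<delta> b)"
proof -
  let ?l = "lift_to TM"
  let ?G = "\<lambda>y g k. pT (\<delta> (a \<otimes>\<^bsub>A\<^esub> y) \<otimes>\<^bsub>AH\<^esub> eh (antipode g)) (eh k)"
  have m: "(\<lambda>t. em a \<otimes>\<^bsub>AH\<^esub> t) \<in> linear_hom K AH AH" by (rule TM_rules a)+
  have "Xi (canon a b) = ?l (\<lambda>y h. Xi (em a \<otimes>\<^bsub>AH\<^esub> pure_tensor K A H y h)) (\<delta> b)"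
    by (rule AH.lift_unique[OF TM_mod linear_hom_comp[OF m Xi_linear] coaction_closed[OF b]])
  also have "\<dots> = ?l (\<lambda>y h. ?l (\<lambda>g k. ?G y g k) (\<Delta> h)) (\<delta> b)"
    by (rule AH.lift_cong[OF TM_mod AH.bilinear_comp[OF AH_mod AH.pure_bilinear linear_hom_comp[OF m Xi_linear]]
          coaction_closed[OF b]])
       (use a in \<open>simp add: AH.tensor_mult_pure AH.lift_pure[OF TM_mod xi_bilinear]\<close>)
  also have "\<dots> = ?l (\<lambda>x h. ?l (\<lambda>y g. ?G y g h) (\<delta> x)) (\<delta> b)"
    by (rule coassoc_trilinear[symmetric, where F = ?G]) (rule TM_rules a b | assumption)+
  also have "\<dots> = ?l (\<lambda>x h. pT (\<delta> a) (pure_tensor K A H x h)) (\<delta> b)"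
  proof (rule AH.lift_cong[OF TM_mod _ coaction_closed[OF b]])
    show "bilinear K A H TM (\<lambda>x h. ?l (\<lambda>y g. ?G y g h) (\<delta> x))" by (rule TM_rules a | assumption)+
    fix x h assume x: "x \<in> carrier A" and h: "h \<in> carrier H"
    have \<phi>: "(\<lambda>w. pT (\<delta> a \<otimes>\<^bsub>AH\<^esub> w) (eh h)) \<in> linear_hom K AH TM" by (rule TM_rules a h)+
    have "?l (\<lambda>y g. ?G y g h) (\<delta> x) = ?l (\<lambda>y g. pT (\<delta> a \<otimes>\<^bsub>AH\<^esub> (\<delta> y \<otimes>\<^bsub>AH\<^esub> eh (antipode g))) (eh h)) (\<delta> x)"
    proof (rule AH.lift_cong[OF TM_mod _ coaction_closed[OF x]])
      show "bilinear K A H TM (\<lambda>y g. ?G y g h)" by (rule TM_rules a h | assumption)+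
    qed (use a in \<open>simp add: coaction_mult AHa.m_assoc coaction_closed eh_closed antipode_closed\<close>)
    also have "\<dots> = pT (\<delta> a \<otimes>\<^bsub>AH\<^esub> lift_to AH (\<lambda>y g. \<delta> y \<otimes>\<^bsub>AH\<^esub> eh (antipode g)) (\<delta> x)) (eh h)"
      by (rule AH.lift_comp[OF AH_mod _ \<phi> TM_mod coaction_closed[OF x], symmetric]) (rule TM_rules | assumption)+
    also have "\<dots> = pT (\<delta> a \<otimes>\<^bsub>AH\<^esub> em x) (eh h)"
      by (simp only: coaction_antipode[OF x])
    also have "\<dots> = pT (\<delta> a) (em x \<otimes>\<^bsub>AH\<^esub> eh h)"
      by (rule pT_balanced[OF coaction_closed[OF a] eh_closed[OF h] em_RK[OF x]])
    finally show "?l (\<lambda>y g. ?G y g h) (\<delta> x) = pT (\<delta> a) (pure_tensor K A H x h)"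
      by (simp only: em_eh[OF x h])
  qed
  also have "\<dots> = pT (\<delta> a) (\<delta> b)"
    by (rule AH.lift_unique[OF TM_mod bilinear_right[OF pT_bilinear coaction_closed[OF a]] coaction_closed[OF b], symmetric])
  finally show ?thesis .
qed

lemma Xi_canon_sum:
  assumes "x \<in> carrier FA"
  shows "Xi (canon_sum x) = coact_sum x"
proof -
  have "Xi (canon_sum x) = frag_lift (add_monoid TM) (\<lambda>a b. Xi (canon a b)) x"
    by (rule frag_lift_comp[where S = "carrier A \<times> carrier A"])
       (use assms AH_mod TM_mod canon_closed Xi_linear in \<open>auto intro: module_comm_group simp: linear_hom_def\<close>)
  also have "\<dots> = coact_sum x"
    by (rule frag_lift_cong[OF module_comm_group[OF TM_mod], where S = "carrier A \<times> carrier A"])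
       (use assms in \<open>auto simp: Xi_canon pT_closed coaction_closed\<close>)
  finally show ?thesis .
qed

text \<open>This is \<open>(H\<^sup>c\<^sup>o\<^sup>Q)\<^sup>+ H\<close>, where \<open>+\<close> denotes the kernel of the counit.\<close>

definition coinv_ideal where
  "coinv_ideal = generate (add_monoid H) {k \<cdot> g | k g. k \<in> Kc \<and> \<epsilon> k = \<zero>\<^bsub>K\<^esub> \<and> g \<in> carrier H}"

text \<open>
  The map \<open>\<Xi>\<close> turns multiplication by \<open>a \<otimes> 1\<close> on the left and by \<open>\<delta>(c)\<close> on the right into multiplication of the left
  factor by \<open>\<delta>(a)\<close> and of the right factor by \<open>\<delta>(c)\<close>: by \<open>Xi_canon\<close> this is true on the elements \<open>(a' \<otimes> 1) \<delta>(b)\<close>, which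
  generate \<open>A \<otimes> H\<close>. Hence the kernel of \<open>\<Xi>\<close> is stable under both multiplications.
\<close>

lemma Xi_two_sided:
  assumes galois: "hopf_galois K H A \<delta> (coinvariants K H A \<delta>)"
    and a: "a \<in> carrier A" and c: "c \<in> carrier A" and t: "t \<in> carrier AH" and 0: "Xi t = \<zero>\<^bsub>TM\<^esub>"
  shows "Xi (em a \<otimes>\<^bsub>AH\<^esub> (t \<otimes>\<^bsub>AH\<^esub> \<delta> c)) = \<zero>\<^bsub>TM\<^esub>"
proof -
  note [simp] = em_closed coaction_closed a c
  have G: "comm_group (add_monoid TM)" by (rule module_comm_group[OF TM_mod])
  let ?F = "\<lambda>t u. pT (\<delta> a \<otimes>\<^bsub>AH\<^esub> t) (u \<otimes>\<^bsub>AH\<^esub> \<delta> c)"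
  have bF: "bilinear K AH AH TM ?F" by (rule TM_rules a c | assumption)+
  have "?F (t \<otimes>\<^bsub>AH\<^esub> r) u = ?F t (r \<otimes>\<^bsub>AH\<^esub> u)" if "t \<in> carrier AH" "u \<in> carrier AH" "r \<in> RK" for t r u
    using that RK_closed[OF that(3)] pT_balanced[of "\<delta> a \<otimes>\<^bsub>AH\<^esub> t" "u \<otimes>\<^bsub>AH\<^esub> \<delta> c" r]
    by (simp add: AHa.m_assoc)
  then have bal: "balanced_map RK (\<lambda>a s. a \<otimes>\<^bsub>AH\<^esub> s) (\<lambda>s a. s \<otimes>\<^bsub>AH\<^esub> a) AH AH (add_monoid TM) ?F"
    using bilinear_balanced_map[OF bF] unfolding balanced_map_def by simp
  note h = tensor_over_hom[OF AH.tensor_algebra RK_subset G bal]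
  let ?\<Lambda> = "lift_to TM ?F"
  have "(\<lambda>t. em a \<otimes>\<^bsub>AH\<^esub> (t \<otimes>\<^bsub>AH\<^esub> \<delta> c)) \<in> linear_hom K AH AH" by (rule TM_rules a c)+
  from linear_hom_comp[OF this Xi_linear]
  have f: "(\<lambda>t. Xi (em a \<otimes>\<^bsub>AH\<^esub> (t \<otimes>\<^bsub>AH\<^esub> \<delta> c))) \<in> hom (add_monoid AH) (add_monoid TM)"
    by (simp add: linear_hom_def)
  have "Xi \<in> hom (add_monoid AH) (add_monoid TM)" using Xi_linear by (simp add: linear_hom_def)
  then have g: "(\<lambda>t. ?\<Lambda> (Xi t)) \<in> hom (add_monoid AH) (add_monoid TM)"
    using h(1) by (auto simp: hom_def Pi_iff)
  have "Xi (em a \<otimes>\<^bsub>AH\<^esub> (t \<otimes>\<^bsub>AH\<^esub> \<delta> c)) = ?\<Lambda> (Xi t)"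
  proof (rule galois_hom_ext[OF galois G f g _ t])
    fix a' b assume ab: "a' \<in> carrier A" "b \<in> carrier A"
    have eq: "em a \<otimes>\<^bsub>AH\<^esub> (canon a' b \<otimes>\<^bsub>AH\<^esub> \<delta> c) = canon (a \<otimes>\<^bsub>A\<^esub> a') (b \<otimes>\<^bsub>A\<^esub> c)"
      using ab by (simp add: em_mult coaction_mult AHa.m_assoc)
    have "Xi (em a \<otimes>\<^bsub>AH\<^esub> (canon a' b \<otimes>\<^bsub>AH\<^esub> \<delta> c)) = pT (\<delta> (a \<otimes>\<^bsub>A\<^esub> a')) (\<delta> (b \<otimes>\<^bsub>A\<^esub> c))"
      unfolding eq by (rule Xi_canon) (use ab in simp_all)
    also have "\<dots> = ?\<Lambda> (pT (\<delta> a') (\<delta> b))"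
      using ab by (simp add: h(2) coaction_mult)
    finally show "Xi (em a \<otimes>\<^bsub>AH\<^esub> (canon a' b \<otimes>\<^bsub>AH\<^esub> \<delta> c)) = ?\<Lambda> (Xi (canon a' b))"
      by (simp only: Xi_canon[OF ab])
  qed
  also have "\<dots> = \<zero>\<^bsub>TM\<^esub>"
    unfolding 0 using group_hom.hom_one[of "add_monoid TM" "add_monoid TM" ?\<Lambda>] h(1) G
    by (simp add: group_hom_def group_hom_axioms_def comm_group_def)
  finally show ?thesis .
qed

text \<open>
  As \<open>\<Delta>(k)\<close> lies in \<open>H \<otimes> H\<^sup>c\<^sup>o\<^sup>Q\<close>, the factor \<open>1 \<otimes> k\<^sub>2\<close> of \<open>\<Xi>(1 \<otimes> k)\<close> crosses the tensor sign, and \<open>\<sigma>(k\<^sub>1) k\<^sub>2\<close> sums to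
  \<open>\<epsilon>(k) 1 = 0\<close> for the antipode \<open>\<sigma>\<close>.
\<close>

lemma Xi_augmentation:
  assumes k: "k \<in> Kc" and k0: "\<epsilon> k = \<zero>\<^bsub>K\<^esub>"
  shows "Xi (eh k) = \<zero>\<^bsub>TM\<^esub>"
proof -
  let ?l = "lift_to TM"
  let ?L = "\<lambda>w. pT (eh w) (eh \<one>\<^bsub>H\<^esub>)"
  have kc: "k \<in> carrier H" using k Kc_subset by blast
  note one = A.one_closed H.one_closed
  have b1: "bilinear K H H TM (\<lambda>h1 h2. pT (\<delta> \<one>\<^bsub>A\<^esub> \<otimes>\<^bsub>AH\<^esub> eh (antipode h1)) (eh h2))"
    by (rule TM_rules one | assumption)+
  have bS: "bilinear K H H H (\<lambda>h1 h2. antipode h1 \<cdot> h2)" by (rule TM_rules | assumption)+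
  have L: "?L \<in> linear_hom K H TM" by (rule TM_rules one)+
  note b2 = HH.bilinear_comp[OF H_mod bS L]
  have "Xi (eh k) = ?l (\<lambda>h1 h2. pT (\<delta> \<one>\<^bsub>A\<^esub> \<otimes>\<^bsub>AH\<^esub> eh (antipode h1)) (eh h2)) (\<Delta> k)"
    by (rule AH.lift_pure[OF TM_mod xi_bilinear A.one_closed kc])
  also have "\<dots> = ?l (\<lambda>h1 h2. ?L (antipode h1 \<cdot> h2)) (\<Delta> k)"
  proof (rule HH.subtensor_linear_ext[OF order_refl Kc_subset TM_mod HH.lift_linear[OF TM_mod b1] HH.lift_linear[OF TM_mod b2]
        _ quotient_comodule_algebra.coaction_coinvariants[OF regular_quotient k]])
    fix u v assume u: "u \<in> carrier H" and v: "v \<in> Kc"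
    have vc: "v \<in> carrier H" using v Kc_subset by blast
    note [simp] = antipode_closed eh_closed
    have "pT (\<delta> \<one>\<^bsub>A\<^esub> \<otimes>\<^bsub>AH\<^esub> eh (antipode u)) (eh v) = pT (eh (antipode u)) (eh v \<otimes>\<^bsub>AH\<^esub> eh \<one>\<^bsub>H\<^esub>)"
      using u vc by (simp add: coaction_one em_eh eh_mult)
    also have "\<dots> = pT (eh (antipode u) \<otimes>\<^bsub>AH\<^esub> eh v) (eh \<one>\<^bsub>H\<^esub>)"
      by (rule pT_balanced[symmetric]) (use u RK_pure[OF A.one_closed v] in simp_all)
    finally show "?l (\<lambda>h1 h2. pT (\<delta> \<one>\<^bsub>A\<^esub> \<otimes>\<^bsub>AH\<^esub> eh (antipode h1)) (eh h2)) (pure_tensor K H H u v) =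
      ?l (\<lambda>h1 h2. ?L (antipode h1 \<cdot> h2)) (pure_tensor K H H u v)"
      using u vc by (simp add: HH.lift_pure[OF TM_mod b1] HH.lift_pure[OF TM_mod b2] eh_mult)
  qed
  also have "\<dots> = ?L (Sw (\<Delta> k) (\<lambda>h1 h2. antipode h1 \<cdot> h2))"
    by (rule HH.lift_comp[OF H_mod bS L TM_mod comult_closed[OF kc], symmetric])
  also have "\<dots> = ?L \<zero>\<^bsub>H\<^esub>"
    using antipode_left[OF kc] k0 by simp
  also have "\<dots> = \<zero>\<^bsub>TM\<^esub>"
    by (rule linear_hom_zero[OF H_mod TM_mod L])
  finally show ?thesis .
qed

text \<open>
  Write \<open>a \<otimes> k g = (1 \<otimes> k) (a \<otimes> g)\<close> and expand \<open>a \<otimes> g\<close> into elements \<open>(a' \<otimes> 1) \<delta>(b)\<close>. As \<open>1 \<otimes> k\<close> commutes with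
  \<open>a' \<otimes> 1\<close>, the claim reduces to \<open>\<Xi>(1 \<otimes> k) = 0\<close>.
\<close>

lemma xi_generator:
  assumes galois: "hopf_galois K H A \<delta> (coinvariants K H A \<delta>)"
    and a: "a \<in> carrier A" and k: "k \<in> Kc" and k0: "\<epsilon> k = \<zero>\<^bsub>K\<^esub>" and g: "g \<in> carrier H"
  shows "xi a (k \<cdot> g) = \<zero>\<^bsub>TM\<^esub>"
proof -
  have kc: "k \<in> carrier H" using k Kc_subset by blast
  note [simp] = em_closed coaction_closed eh_closed[OF kc]
  interpret TM: module K TM by (rule TM_mod)
  have "(\<lambda>v. eh k \<otimes>\<^bsub>AH\<^esub> v) \<in> linear_hom K AH AH" by (rule TM_rules kc A.one_closed)+
  from linear_hom_comp[OF this Xi_linear]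
  have f: "(\<lambda>v. Xi (eh k \<otimes>\<^bsub>AH\<^esub> v)) \<in> hom (add_monoid AH) (add_monoid TM)" by (simp add: linear_hom_def)
  have "Xi (eh k \<otimes>\<^bsub>AH\<^esub> pure_tensor K A H a g) = \<zero>\<^bsub>TM\<^esub>"
  proof (rule galois_hom_ext[OF galois module_comm_group[OF TM_mod] f, where g = "\<lambda>_. \<zero>\<^bsub>TM\<^esub>"])
    show "(\<lambda>_. \<zero>\<^bsub>TM\<^esub>) \<in> hom (add_monoid AH) (add_monoid TM)" by (simp add: hom_def)
    fix a' b assume ab: "a' \<in> carrier A" "b \<in> carrier A"
    have "eh k \<otimes>\<^bsub>AH\<^esub> em a' = em a' \<otimes>\<^bsub>AH\<^esub> eh k" using ab kc by (simp add: AH.tensor_mult_pure)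
    then have "eh k \<otimes>\<^bsub>AH\<^esub> canon a' b = em a' \<otimes>\<^bsub>AH\<^esub> (eh k \<otimes>\<^bsub>AH\<^esub> \<delta> b)"
      using ab by (simp flip: AHa.m_assoc)
    then show "Xi (eh k \<otimes>\<^bsub>AH\<^esub> canon a' b) = \<zero>\<^bsub>TM\<^esub>"
      using Xi_two_sided[OF galois ab eh_closed[OF kc] Xi_augmentation[OF k k0]] by simp
  qed (use a g in \<open>simp add: AH.pure_tensor_closed\<close>)
  then show ?thesis
    using a g kc by (simp add: AH.tensor_mult_pure AH.lift_pure[OF TM_mod xi_bilinear])
qed

lemma Xi_NI:
  assumes galois: "hopf_galois K H A \<delta> (coinvariants K H A \<delta>)" and I: "I \<subseteq> coinv_ideal" and t: "t \<in> NI"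
  shows "Xi t = \<zero>\<^bsub>TM\<^esub>"
proof -
  interpret TM: module K TM by (rule TM_mod)
  have triv: "subgroup {\<zero>\<^bsub>TM\<^esub>} (add_monoid TM)"
    using group.triv_subgroup[OF TM.a_group] by simp
  have xi0: "xi a y \<in> {\<zero>\<^bsub>TM\<^esub>}" if a: "a \<in> carrier A" and y: "y \<in> coinv_ideal" for a y
    by (rule group_hom_generate[OF linear_hom_group_hom[OF H_mod TM_mod bilinear_right[OF xi_bilinear a]] _ triv _
          y[unfolded coinv_ideal_def]])
       (use Kc_subset xi_generator[OF galois a] in auto)
  have "Xi t \<in> {\<zero>\<^bsub>TM\<^esub>}"
  proof (rule AH.subtensor_linear_image[OF order_refl I_subset TM_mod Xi_linear triv _ t])
    show "Xi (pure_tensor K A H a y) \<in> {\<zero>\<^bsub>TM\<^esub>}" if a: "a \<in> carrier A" and y: "y \<in> I" for a y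
    proof -
      have "y \<in> carrier H" "y \<in> coinv_ideal" using y I I_subset by auto
      then show ?thesis using xi0[OF a] by (simp only: AH.lift_pure[OF TM_mod xi_bilinear a])
    qed
  qed
  then show ?thesis by simp
qed

lemma canon_sum_zero_coact_sum:
  assumes "hopf_galois K H A \<delta> (coinvariants K H A \<delta>)" "I \<subseteq> coinv_ideal" "x \<in> carrier FA" "canon_sum x \<in> NI"
  shows "coact_sum x = \<zero>\<^bsub>TM\<^esub>"
  using Xi_NI[OF assms(1,2,4)] Xi_canon_sum[OF assms(3)] by simp

end

section \<open>Right ideal coideals given by generators\<close>

context hopf_algebra
begin

abbreviation coideal_sum where
  "coideal_sum J \<equiv> subtensor K H H J (carrier H) <+>\<^bsub>HH\<^esub> subtensor K H H (carrier H) J"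

lemma coideal_sum_subgroup:
  assumes "J \<subseteq> carrier H"
  shows "subgroup (coideal_sum J) (add_monoid HH)"
  unfolding set_add_def
  by (rule comm_group.mult_subgroups[OF module_comm_group[OF HH_mod]])
     (rule HH.subtensor_subgroup assms order_refl)+

lemma coideal_sum_left: "\<lbrakk>J \<subseteq> carrier H; t \<in> subtensor K H H J (carrier H)\<rbrakk> \<Longrightarrow> t \<in> coideal_sum J"
  and coideal_sum_right: "\<lbrakk>J \<subseteq> carrier H; t \<in> subtensor K H H (carrier H) J\<rbrakk> \<Longrightarrow> t \<in> coideal_sum J"
proof -
  interpret HHm: module K HH by (rule HH_mod)
  show "t \<in> coideal_sum J" if J: "J \<subseteq> carrier H" and t: "t \<in> subtensor K H H J (carrier H)"
  proof -
    have "t = t \<oplus>\<^bsub>HH\<^esub> \<zero>\<^bsub>HH\<^esub>" using HH.subtensor_closed[OF J order_refl t] by simp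
    then show ?thesis using t HH.subtensor_zero[OF order_refl J] unfolding set_add_defs by force
  qed
  show "t \<in> coideal_sum J" if J: "J \<subseteq> carrier H" and t: "t \<in> subtensor K H H (carrier H) J"
  proof -
    have "t = \<zero>\<^bsub>HH\<^esub> \<oplus>\<^bsub>HH\<^esub> t" using HH.subtensor_closed[OF order_refl J t] by simp
    then show ?thesis using t HH.subtensor_zero[OF J order_refl] unfolding set_add_defs by force
  qed
qed

lemma coideal_sum_mono:
  assumes "J \<subseteq> J'"
  shows "coideal_sum J \<subseteq> coideal_sum J'"
proof -
  have g: "group (add_monoid HH)" using module_comm_group[OF HH_mod] by (simp add: comm_group_def)
  have "subtensor K H H J (carrier H) \<subseteq> subtensor K H H J' (carrier H)"
    "subtensor K H H (carrier H) J \<subseteq> subtensor K H H (carrier H) J'"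
    unfolding subtensor_def by (rule group.mono_generate[OF g]; use assms in blast)+
  then show ?thesis unfolding set_add_def by (rule mono_set_mult)
qed

lemma generate_right_ideal:
  fixes Z
  defines "J \<equiv> generate (add_monoid H) Z"
  assumes Z: "Z \<subseteq> carrier H"
    and right: "\<And>x h. \<lbrakk>x \<in> Z; h \<in> carrier H\<rbrakk> \<Longrightarrow> x \<cdot> h \<in> J"
    and y: "y \<in> J" and h: "h \<in> carrier H"
  shows "y \<cdot> h \<in> J"
proof -
  have Z': "Z \<subseteq> carrier (add_monoid H)" using Z by simp
  have J: "subgroup J (add_monoid H)"
    unfolding J_def by (rule group.generate_is_subgroup[OF H.add.is_group Z'])
  have "(\<lambda>y. y \<cdot> h) \<in> linear_hom K H H" by (rule hopf_rules h)+
  from linear_hom_group_hom[OF H_mod H_mod this]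
  show ?thesis by (rule group_hom_generate[OF _ Z' J right[OF _ h] y[unfolded J_def]])
qed

lemma right_ideal_coideal_generate:
  fixes Z
  defines "J \<equiv> generate (add_monoid H) Z"
  assumes Z: "Z \<subseteq> carrier H"
    and right: "\<And>x h. \<lbrakk>x \<in> Z; h \<in> carrier H\<rbrakk> \<Longrightarrow> x \<cdot> h \<in> J"
    and comult: "\<And>x. x \<in> Z \<Longrightarrow> \<Delta> x \<in> coideal_sum J"
    and counit: "\<And>x. x \<in> Z \<Longrightarrow> \<epsilon> x = \<zero>\<^bsub>K\<^esub>"
  shows "right_ideal_coideal K H \<Delta> \<epsilon> J"
proof -
  have gH: "group (add_monoid H)" by (rule H.add.is_group)
  have Z': "Z \<subseteq> carrier (add_monoid H)" using Z by simp
  have Jsub: "subgroup J (add_monoid H)" unfolding J_def by (rule group.generate_is_subgroup[OF gH Z'])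
  have J: "J \<subseteq> carrier H" using subgroup.subset[OF Jsub] by simp
  have 1: "y \<cdot> h \<in> J" if y: "y \<in> J" and h: "h \<in> carrier H" for y h
    using generate_right_ideal[OF Z] right y h unfolding J_def by blast
  have 2: "\<Delta> y \<in> coideal_sum J" if y: "y \<in> J" for y
    by (rule group_hom_generate[OF linear_hom_group_hom[OF H_mod HH_mod comult_linear] Z'
          coideal_sum_subgroup[OF J] comult y[unfolded J_def]])
  have "\<epsilon> y \<in> {\<zero>\<^bsub>K\<^esub>}" if y: "y \<in> J" for y
  proof (rule group_hom_generate[OF _ Z' _ _ y[unfolded J_def]])
    show "group_hom (add_monoid H) (add_monoid K) \<epsilon>"
      using gH add.is_group counit_hom
      by (auto simp: group_hom_def group_hom_axioms_def hom_def ring_hom_def)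
    show "subgroup {\<zero>\<^bsub>K\<^esub>} (add_monoid K)"
      using group.triv_subgroup[OF add.is_group] by simp
  qed (use counit in simp)
  then show ?thesis
    unfolding right_ideal_coideal_def
    using 1 2 Jsub by (auto simp: additive_subgroup_def)
qed

end

section \<open>The right ideal generated by the augmentation ideal of the coinvariants\<close>

context quotient_comodule_algebra
begin

lemma coinv_ideal_generator: "\<lbrakk>k \<in> Kc; \<epsilon> k = \<zero>\<^bsub>K\<^esub>; g \<in> carrier H\<rbrakk> \<Longrightarrow> k \<cdot> g \<in> coinv_ideal"
  unfolding coinv_ideal_def by (rule generate.incl) blast

lemma coinv_ideal_subset: "coinv_ideal \<subseteq> carrier H"
  using group.generate_incl[OF H.add.is_group, of "{k \<cdot> g | k g. k \<in> Kc \<and> \<epsilon> k = \<zero>\<^bsub>K\<^esub> \<and> g \<in> carrier H}"] Kc_subset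
  unfolding coinv_ideal_def by force

lemma coinv_ideal_counit:
  assumes k: "k \<in> Kc"
  shows "\<epsilon> k \<odot>\<^bsub>H\<^esub> \<one>\<^bsub>H\<^esub> \<ominus>\<^bsub>H\<^esub> k \<in> coinv_ideal"
proof -
  have kc: "k \<in> carrier H" using k Kc_subset by blast
  define k' where "k' = \<epsilon> k \<odot>\<^bsub>H\<^esub> \<one>\<^bsub>H\<^esub> \<ominus>\<^bsub>H\<^esub> k"
  have "k' \<in> Kc"
    unfolding k'_def
    using submodule_diff[OF H_mod Kc_submodule H.submoduleE(4)[OF Kc_submodule counit_closed[OF kc] Kc_one] k] .
  moreover have "\<epsilon> k' = \<zero>\<^bsub>K\<^esub>"
  proof -
    have g: "group_hom (add_monoid H) (add_monoid K) \<epsilon>"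
      using H.add.is_group add.is_group counit_hom
      by (auto simp: group_hom_def group_hom_axioms_def hom_def ring_hom_def)
    have "\<epsilon> (\<ominus>\<^bsub>H\<^esub> k) = \<ominus>\<^bsub>K\<^esub> \<epsilon> k" using group_hom.hom_inv[OF g] kc by (simp add: a_inv_def)
    moreover have "\<epsilon> (\<epsilon> k \<odot>\<^bsub>H\<^esub> \<one>\<^bsub>H\<^esub>) = \<epsilon> k"
      using counit_linear[OF counit_closed[OF kc] H.one_closed] ring_hom_one[OF counit_hom] counit_closed[OF kc] by simp
    ultimately show ?thesis
      unfolding k'_def a_minus_def
      using ring_hom_add[OF counit_hom, of "\<epsilon> k \<odot>\<^bsub>H\<^esub> \<one>\<^bsub>H\<^esub>" "\<ominus>\<^bsub>H\<^esub> k"] kc counit_closed[OF kc] by (simp add: r_neg)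
  qed
  ultimately have "k' \<cdot> \<one>\<^bsub>H\<^esub> \<in> coinv_ideal" by (rule coinv_ideal_generator) simp
  moreover have "k' \<in> carrier H" unfolding k'_def using kc counit_closed[OF kc] by simp
  ultimately show ?thesis unfolding k'_def by simp
qed

text \<open>
  Write \<open>C = H\<^sup>c\<^sup>o\<^sup>Q\<close>, and let \<open>J\<close> be the right ideal. In \<open>\<Delta>(k g) = (\<Delta>(k) - k \<otimes> 1) \<Delta>(g) + (k \<otimes> 1) \<Delta>(g)\<close> the second
  summand lies in \<open>J \<otimes> H\<close>. The first one lies in \<open>H \<otimes> J\<close>, because \<open>\<Delta>(k) \<in> H \<otimes> C\<close> and \<open>k \<otimes> 1 = k\<^sub>1 \<otimes> \<epsilon>(k\<^sub>2) 1\<close>.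
\<close>

lemma coinv_ideal_right_ideal_coideal: "right_ideal_coideal K H \<Delta> \<epsilon> coinv_ideal"
  unfolding coinv_ideal_def
proof (rule right_ideal_coideal_generate, fold coinv_ideal_def)
  let ?X = "{k \<cdot> g | k g. k \<in> Kc \<and> \<epsilon> k = \<zero>\<^bsub>K\<^esub> \<and> g \<in> carrier H}"
  show "?X \<subseteq> carrier H" using Kc_subset by auto
  have right: "x \<cdot> h \<in> coinv_ideal" if "x \<in> ?X" "h \<in> carrier H" for x h
  proof -
    obtain k g where x: "x = k \<cdot> g" "k \<in> Kc" "\<epsilon> k = \<zero>\<^bsub>K\<^esub>" "g \<in> carrier H" using \<open>x \<in> ?X\<close> by blast
    then have "x \<cdot> h = k \<cdot> (g \<cdot> h)" using Kc_subset that(2) by (simp add: H.m_assoc subset_iff)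
    then show ?thesis using coinv_ideal_generator[OF x(2,3)] x(4) that(2) by simp
  qed
  then show "x \<cdot> h \<in> coinv_ideal" if "x \<in> ?X" "h \<in> carrier H" for x h using that .
  have right': "x \<cdot> h \<in> coinv_ideal" if "x \<in> coinv_ideal" "h \<in> carrier H" for x h
    using generate_right_ideal[OF \<open>?X \<subseteq> carrier H\<close>, folded coinv_ideal_def, OF right] that by blast
  show "\<epsilon> x = \<zero>\<^bsub>K\<^esub>" if "x \<in> ?X" for x
    using that Kc_subset ring_hom_mult[OF counit_hom] counit_closed by (auto simp: subset_iff)
  show "\<Delta> x \<in> coideal_sum coinv_ideal" if "x \<in> ?X" for x
  proof -
    obtain k g where x: "x = k \<cdot> g" and k: "k \<in> Kc" "\<epsilon> k = \<zero>\<^bsub>K\<^esub>" and g: "g \<in> carrier H" using \<open>x \<in> ?X\<close> by blast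
    have kc: "k \<in> carrier H" using k Kc_subset by blast
    interpret reg: quotient_comodule_algebra K H \<Delta> \<epsilon> antipode H \<Delta> I by (rule regular_quotient)
    let ?e = "pure_tensor K H H k \<one>\<^bsub>H\<^esub>"
    have c: "?e \<in> carrier HH" "\<Delta> k \<in> carrier HH" "\<Delta> g \<in> carrier HH"
      using kc g by (auto simp: comult_closed HH.pure_tensor_closed)
    have "?e \<ominus>\<^bsub>HH\<^esub> \<Delta> k \<in> subtensor K H H (carrier H) coinv_ideal"
      using reg.retract_RK[OF coinv_ideal_subset coinv_ideal_counit reg.coaction_coinvariants[OF k(1)]]
      by (simp add: reg.retract_coaction[OF kc])
    from HH.subtensor_inv[OF order_refl coinv_ideal_subset this]
    have 1: "\<Delta> k \<ominus>\<^bsub>HH\<^esub> ?e \<in> subtensor K H H (carrier H) coinv_ideal"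
      using c by (simp add: a_minus_def reg.AHa.minus_add reg.AHa.a_comm)
    have "(\<Delta> k \<ominus>\<^bsub>HH\<^esub> ?e) \<otimes>\<^bsub>HH\<^esub> \<Delta> g \<in> subtensor K H H (carrier H) coinv_ideal"
      by (rule HH.subtensor_right_ideal[OF coinv_ideal_subset right' 1 c(3)])
    then have 2: "(\<Delta> k \<ominus>\<^bsub>HH\<^esub> ?e) \<otimes>\<^bsub>HH\<^esub> \<Delta> g \<in> coideal_sum coinv_ideal"
      by (rule coideal_sum_right[OF coinv_ideal_subset])
    have "?e \<otimes>\<^bsub>HH\<^esub> u \<in> subtensor K H H coinv_ideal (carrier H)" if "u \<in> carrier HH" for u
      using that
    proof (induction rule: HH.ground_induct)
      case (pure m n)
      then show ?case
        using kc coinv_ideal_generator[OF k] HH.subtensor_pure[OF coinv_ideal_subset order_refl]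
        by (simp add: HH.tensor_mult_pure)
    next
      case (add t u)
      then show ?case
        using c HH.subtensor_add[OF coinv_ideal_subset order_refl] by (simp add: reg.AHa.r_distr)
    qed
    then have 3: "?e \<otimes>\<^bsub>HH\<^esub> \<Delta> g \<in> coideal_sum coinv_ideal"
      using coideal_sum_left[OF coinv_ideal_subset] c by blast
    have "\<Delta> x = (\<Delta> k \<ominus>\<^bsub>HH\<^esub> ?e) \<otimes>\<^bsub>HH\<^esub> \<Delta> g \<oplus>\<^bsub>HH\<^esub> ?e \<otimes>\<^bsub>HH\<^esub> \<Delta> g"
      using ring_hom_mult[OF comult_ring_hom kc g] c
      by (simp add: x a_minus_def reg.AHa.l_distr reg.AHa.l_minus reg.AHa.a_assoc reg.AHa.l_neg)
    then show ?thesis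
      using subgroup.m_closed[OF coideal_sum_subgroup[OF coinv_ideal_subset] 2 3] by simp
  qed
qed

text \<open>
  Since \<open>\<delta>(a)\<close> lies in \<open>A \<otimes> H\<^sup>c\<^sup>o\<^sup>Q\<close>, it is congruent to \<open>a\<^sub>0 \<otimes> \<epsilon>(a\<^sub>1) 1 = a \<otimes> 1\<close> modulo \<open>A \<otimes> J\<close>, where \<open>J\<close> is the right
  ideal.
\<close>

lemma coinvariants_coinv_ideal: "S \<subseteq> quot_coinvariants K H A \<delta> coinv_ideal"
proof
  interpret J: quotient_comodule_algebra K H \<Delta> \<epsilon> antipode A \<delta> coinv_ideal
    by unfold_locales (rule coinv_ideal_right_ideal_coideal)
  fix a assume a: "a \<in> S"
  have ac: "a \<in> carrier A" using a S_subset by blast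
  have "em a \<ominus>\<^bsub>AH\<^esub> \<delta> a \<in> J.NI"
    using retract_RK[OF coinv_ideal_subset coinv_ideal_counit coaction_coinvariants[OF a]]
    by (simp add: retract_coaction[OF ac])
  from J.NI_inv[OF this] have "\<delta> a \<ominus>\<^bsub>AH\<^esub> em a \<in> J.NI"
    using em_closed[OF ac] coaction_closed[OF ac] by (simp add: a_minus_def AHa.minus_add AHa.a_comm)
  then show "a \<in> quot_coinvariants K H A \<delta> coinv_ideal"
    using J.coinv_iff ac by simp
qed

end

section \<open>The Galois connection\<close>

context hopf_algebra
begin

lemma Quot_gen_simps:
  "carrier (Quot_gen K H \<Delta> \<epsilon>) = {I. right_ideal_coideal K H \<Delta> \<epsilon> I}"
  "x \<sqsubseteq>\<^bsub>Quot_gen K H \<Delta> \<epsilon>\<^esub> y \<longleftrightarrow> y \<subseteq> x"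
  by (simp_all add: Quot_gen_def)

lemma least_Upper_iff:
  assumes "\<S> \<subseteq> carrier (Quot_gen K H \<Delta> \<epsilon>)"
  shows "least (Quot_gen K H \<Delta> \<epsilon>) l (Upper (Quot_gen K H \<Delta> \<epsilon>) \<S>) \<longleftrightarrow>
    right_ideal_coideal K H \<Delta> \<epsilon> l \<and> (\<forall>I\<in>\<S>. l \<subseteq> I) \<and>
    (\<forall>u. right_ideal_coideal K H \<Delta> \<epsilon> u \<longrightarrow> (\<forall>I\<in>\<S>. u \<subseteq> I) \<longrightarrow> u \<subseteq> l)"
proof -
  have "Upper (Quot_gen K H \<Delta> \<epsilon>) \<S> = {u. right_ideal_coideal K H \<Delta> \<epsilon> u \<and> (\<forall>I\<in>\<S>. u \<subseteq> I)}"
    using assms unfolding Upper_def Quot_gen_simps by blast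
  then show ?thesis
    unfolding least_def Quot_gen_simps by blast
qed

lemma right_ideal_coideal_subset: "right_ideal_coideal K H \<Delta> \<epsilon> I \<Longrightarrow> I \<subseteq> carrier H"
  using additive_subgroup.a_subset unfolding right_ideal_coideal_def by blast

text \<open>The sum of all right ideal coideals that are contained in every member of \<open>\<S>\<close> is a right ideal coideal itself.\<close>

lemma ex_least_Upper:
  assumes S: "\<S> \<subseteq> carrier (Quot_gen K H \<Delta> \<epsilon>)" "\<S> \<noteq> {}"
  shows "\<exists>l. least (Quot_gen K H \<Delta> \<epsilon>) l (Upper (Quot_gen K H \<Delta> \<epsilon>) \<S>)"
proof -
  define \<G> where "\<G> = {u. right_ideal_coideal K H \<Delta> \<epsilon> u \<and> (\<forall>I\<in>\<S>. u \<subseteq> I)}"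
  define J where "J = generate (add_monoid H) (\<Union>\<G>)"
  have G: "right_ideal_coideal K H \<Delta> \<epsilon> u" "u \<subseteq> J" if "u \<in> \<G>" for u
    using that by (auto simp: \<G>_def J_def intro: generate.incl)
  have "right_ideal_coideal K H \<Delta> \<epsilon> J"
    unfolding J_def
  proof (rule right_ideal_coideal_generate, fold J_def)
    show "\<Union>\<G> \<subseteq> carrier H" using G(1) right_ideal_coideal_subset by blast
    fix x assume "x \<in> \<Union>\<G>"
    then obtain u where u: "u \<in> \<G>" "x \<in> u" by blast
    note r = G(1)[OF u(1), unfolded right_ideal_coideal_def]
    show "x \<cdot> h \<in> J" if "h \<in> carrier H" for h using r u that G(2) by blast
    show "\<Delta> x \<in> coideal_sum J" using r u coideal_sum_mono[OF G(2)[OF u(1)]] by blast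
    show "\<epsilon> x = \<zero>\<^bsub>K\<^esub>" using r u by blast
  qed
  moreover have "J \<subseteq> I" if "I \<in> \<S>" for I
    unfolding J_def
  proof (rule group.generate_subgroup_incl[OF H.add.is_group])
    show "\<Union>\<G> \<subseteq> I" using that unfolding \<G>_def by blast
    have "right_ideal_coideal K H \<Delta> \<epsilon> I" using S that by (auto simp: Quot_gen_simps)
    then show "subgroup I (add_monoid H)" by (simp add: right_ideal_coideal_def additive_subgroup_def)
  qed
  moreover have "u \<subseteq> J" if "right_ideal_coideal K H \<Delta> \<epsilon> u" "\<forall>I\<in>\<S>. u \<subseteq> I" for u
    using G(2) that by (simp add: \<G>_def)
  ultimately show ?thesis using least_Upper_iff[OF S(1)] by blast
qed

end

context quotient_comodule_algebra
begin

text \<open>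
  The ideal \<open>I\<close> is itself one of those whose quotients are joined, so its quotient is the join if and only if it is an
  upper bound. The join is a choice of a least upper bound, hence meaningful only because one exists.
\<close>

lemma galois_closed_iff:
  "galois_closed K H \<Delta> \<epsilon> A \<delta> I \<longleftrightarrow>
    (\<forall>J. right_ideal_coideal K H \<Delta> \<epsilon> J \<longrightarrow> S \<subseteq> quot_coinvariants K H A \<delta> J \<longrightarrow> I \<subseteq> J)"
proof -
  let ?L = "Quot_gen K H \<Delta> \<epsilon>"
  let ?S = "{J \<in> carrier ?L. S \<subseteq> quot_coinvariants K H A \<delta> J}"
  have I: "I \<in> ?S" using ideal_coideal by (simp add: Quot_gen_simps)
  have S: "?S \<subseteq> carrier ?L" by blast
  have "galois_psi K H \<Delta> \<epsilon> A \<delta> (galois_phi K H \<Delta> \<epsilon> A \<delta> I) = \<Squnion>\<^bsub>?L\<^esub> ?S"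
    using I S_sub_algebra by (simp add: galois_phi_def galois_psi_def)
  then have "galois_closed K H \<Delta> \<epsilon> A \<delta> I \<longleftrightarrow> (SOME l. least ?L l (Upper ?L ?S)) = I"
    by (simp add: galois_closed_def Lattice.sup_def)
  also have "\<dots> \<longleftrightarrow> least ?L I (Upper ?L ?S)"
  proof
    assume "(SOME l. least ?L l (Upper ?L ?S)) = I"
    then show "least ?L I (Upper ?L ?S)"
      using someI_ex[OF ex_least_Upper[OF S]] I by auto
  next
    assume "least ?L I (Upper ?L ?S)"
    then show "(SOME l. least ?L l (Upper ?L ?S)) = I"
      by (rule some_equality) (use \<open>least ?L I (Upper ?L ?S)\<close> in \<open>simp add: least_Upper_iff[OF S] set_eq_subset\<close>)
  qed
  also have "\<dots> \<longleftrightarrow> (\<forall>J\<in>?S. I \<subseteq> J)"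
    unfolding least_Upper_iff[OF S] using I ideal_coideal by blast
  finally show ?thesis unfolding Quot_gen_simps by blast
qed

lemma closed_imp_coinv_ideal: "galois_closed K H \<Delta> \<epsilon> A \<delta> I \<Longrightarrow> I \<subseteq> coinv_ideal"
  using galois_closed_iff coinv_ideal_right_ideal_coideal coinvariants_coinv_ideal by blast

text \<open>
  For an element \<open>y\<close> of \<open>I\<close> let \<open>x\<close> have the value \<open>1 \<otimes> y\<close> under the Galois map. By assumption \<open>x\<close> represents \<open>0\<close> over \<open>S\<close>,
  so \<open>1 \<otimes> y\<close> also vanishes in \<open>A \<otimes> H/J\<close>; and \<open>1 \<noteq> 0\<close> in \<open>A\<close>.
\<close>

lemma bij_imp_closed:
  assumes nonzero: "\<one>\<^bsub>A\<^esub> \<noteq> \<zero>\<^bsub>A\<^esub>"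
    and galois: "hopf_galois K H A \<delta> (coinvariants K H A \<delta>)"
    and inj: "\<And>x. \<lbrakk>x \<in> carrier FA; canon_sum x \<in> NI\<rbrakk> \<Longrightarrow> x \<in> KerS S"
  shows "galois_closed K H \<Delta> \<epsilon> A \<delta> I"
  unfolding galois_closed_iff
proof (intro allI impI subsetI)
  fix J y assume J: "right_ideal_coideal K H \<Delta> \<epsilon> J" "S \<subseteq> quot_coinvariants K H A \<delta> J" and y: "y \<in> I"
  interpret J: quotient_comodule_algebra K H \<Delta> \<epsilon> antipode A \<delta> J
    by unfold_locales (rule J(1))
  have yc: "y \<in> carrier H" using y I_subset by blast
  obtain x where x: "x \<in> carrier FA" "canon_sum x = eh y"
    using galois_canon_sum_surj[OF galois eh_closed[OF yc]] .
  have "canon_sum x \<in> NI" unfolding x(2) by (rule NI_pure[OF A.one_closed y])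
  then have "x \<in> KerS S" by (rule inj[OF x(1)])
  then have "eh y \<in> J.NI" by (rule J.KerS_canon_sum[OF J(2), of x, unfolded x(2)])
  then have "pure_tensor K A J.Q \<one>\<^bsub>A\<^esub> (J.\<pi> y) = \<zero>\<^bsub>J.AQ\<^esub>"
    using J.id_proj_zero_iff[OF eh_closed[OF yc]] J.id_proj_pure[OF A.one_closed yc] by simp
  then have "J.\<pi> y = \<zero>\<^bsub>J.Q\<^esub>"
    by (rule pure_tensor_eq_zero[OF field_axioms A_mod J.Q_mod A.one_closed nonzero
          linear_hom_closed[OF J.proj_linear yc]])
  then show "y \<in> J" using quot_proj_zero_iff[OF H_mod J.I_submodule yc] by simp
qed

end

theorem theorem4p6p7:
  fixes K :: "('k, 'w) ring_scheme"
    and H :: "('k, 'h, 'x) module_scheme"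
    and \<Delta> :: "'h \<Rightarrow> ('h \<times> 'h \<Rightarrow>\<^sub>0 int) set"
    and \<epsilon> :: "'h \<Rightarrow> 'k"
    and antipode :: "'h \<Rightarrow> 'h"
    and A :: "('k, 'a, 'y) module_scheme"
    and \<delta> :: "'a \<Rightarrow> ('a \<times> 'h \<Rightarrow>\<^sub>0 int) set"
    and B :: "'a set"
    and I :: "'h set"
    and Q :: "('k, 'h set) module"
    and \<pi> :: "'h \<Rightarrow> 'h set"
  assumes comodule_algebra: "right_comodule_algebra K H \<Delta> \<epsilon> antipode A \<delta>"
    and nonzero: "\<one>\<^bsub>A\<^esub> \<noteq> \<zero>\<^bsub>A\<^esub>"
    and B: "B = coinvariants K H A \<delta>"
    and galois: "hopf_galois K H A \<delta> B"
    and quotient: "I \<in> carrier (Quot_gen K H \<Delta> \<epsilon>)"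
    and Q: "Q = quot_module H I"
    and \<pi>: "\<pi> = quot_proj H I"
  shows
    "bij_betw (canonical_map K A \<delta> Q \<pi>)
       (carrier (tensor_over A (quot_coinvariants K H A \<delta> I))) (carrier (tensor K A Q))
     \<longleftrightarrow>
     galois_closed K H \<Delta> \<epsilon> A \<delta> I \<and>
     inj_on
       (tensor_map_over (tensor K A H)
          (subtensor K A H (carrier A) (quot_coinvariants K H H \<Delta> I)) \<delta> \<delta>)
       (carrier (tensor_over A (quot_coinvariants K H A \<delta> I)))"
proof -
  have ic: "right_ideal_coideal K H \<Delta> \<epsilon> I" using quotient by (simp add: Quot_gen_def)
  interpret Q: quotient_comodule_algebra K H \<Delta> \<epsilon> antipode A \<delta> I
    using comodule_algebra ic by (simp add: quotient_comodule_algebra_def quotient_comodule_algebra_axioms_def)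
  note galois' = galois[unfolded B]
  show ?thesis
    unfolding Q \<pi> Q.canonical_bij_iff[OF galois'] Q.tensor_map_over_inj_iff
    using Q.bij_imp_closed[OF nonzero galois'] Q.coact_sum_zero_canon_sum Q.canon_sum_zero_coact_sum[OF galois' Q.closed_imp_coinv_ideal] by blast
qed

end
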